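(* Let $(\Omega,\sigma)$ be a minimal and non periodic continuous flow on a compact metric space. Then: (i) For any $m\in\mathfrak{M}_{\mathrm{inv}}(\Omega,\sigma)$ the set $\mathcal{R}_m(\Omega)$ is nonempty, and it contains functions $a$ with $\Sigma_a=\{0\}$. (ii) In fact, there exist functions $a$ which belong to $\bigcap_{m\in\mathfrak{M}_{\mathrm{inv}}(\Omega,\sigma)}\mathcal{R}_m(\Omega)$ and satisfy $\Sigma_a=\{0\}$. (iii) If $a\in\mathcal{R}_m(\Omega)$ for a measure $m\in\mathfrak{M}_{\mathrm{inv}}(\Omega,\sigma)$, then there exists at least one measure $\widetilde m\in\mathfrak{M}_{\mathrm{erg}}(\Omega,\sigma)$ such that $a\in\mathcal{R}_{\widetilde m}(\Omega)$. More precisely, $a\in\mathcal{R}_{m_{\omega_0}}(\Omega)$ for $m$-almost every $\omega_0\in\widetilde\Omega_e$, where $m_{\omega_0}\in\mathfrak{M}_{\mathrm{erg}}(\Omega,\sigma)$ is the ergodic measure associated with the generic point $\omega_0$.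
   Context: A continuous flow is $\sigma:\mathbb{R}\times\Omega\to\Omega$, continuous, with $\sigma_0=\mathrm{Id}$ and $\sigma_{s+t}=\sigma_t\circ\sigma_s$; write $\omega\cdot t:=\sigma(t,\omega)$. It is minimal if $\Omega$ contains no proper nonempty compact $\sigma$-invariant subset (equivalently, every forward semiorbit and every backward semiorbit is dense). Non periodic means that $\Omega$ is not a single periodic (possibly constant) orbit. $\mathfrak{M}_{\mathrm{inv}}(\Omega,\sigma)$ and $\mathfrak{M}_{\mathrm{erg}}(\Omega,\sigma)$ are the sets of $\sigma$-invariant and $\sigma$-ergodic (regular) Borel probability measures. Continuous primitive: a continuous $a:\Omega\to\mathbb{R}$ admits a continuous primitive if there is a continuous $h_a:\Omega\to\mathbb{R}$ with $h_a(\omega\cdot t)-h_a(\omega)=\int_0^t a(\omega\cdot s)\,ds$ for all $\omega\in\Omega$, $t\in\mathbb{R}$. The set $\mathcal{R}_m(\Omega)$: for $m\in\mathfrak{M}_{\mathrm{inv}}(\Omega,\sigma)$, $\mathcal{R}_m(\Omega)$ is the set of continuous functions $a:\Omega\to\mathbb{R}$ with $\int_\Omega a\,dm=0$ which do not admit a continuous primitive and satisfy $\sup_{t\le 0}\int_0^t a(\omega\cdot s)\,ds<\infty$ for $m$-a.e. $\omega\in\Omega$. Sacker–Sell spectrum: the family $x'=c(\omega\cdot t)\,x$, $\omega\in\Omega$ ($c$ continuous) has exponential dichotomy over $\Omega$ if there are $\kappa\ge1$, $\gamma>0$ such that either $\exp\int_0^t c(\omega\cdot l)\,dl\le\kappa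 e^{-\gamma t}$ for all $\omega\in\Omega$, $t\ge0$, or $\exp\int_0^t c(\omega\cdot l)\,dl\le\kappa e^{\gamma t}$ for all $\omega\in\Omega$, $t\le0$. $\Sigma_a$ is the set of $\lambda\in\mathbb{R}$ such that $x'=(a(\omega\cdot t)-\lambda)\,x$, $\omega\in\Omega$, does not have exponential dichotomy over $\Omega$. Generic points: $\omega_0\in\Omega$ is $\sigma$-generic if $\lim_{t\to\infty}\frac1t\int_0^t f(\omega_0\cdot s)\,ds$ exists for every $f\in C(\Omega,\mathbb{R})$; then $m_{\omega_0}\in\mathfrak{M}_{\mathrm{inv}}(\Omega,\sigma)$ denotes the measure with $\lim_{t\to\infty}\frac1t\int_0^t f(\omega_0\cdot s)\,ds=\int_\Omega f\,dm_{\omega_0}$ for all such $f$. $\widetilde\Omega_e$ is the set of $\sigma$-generic points $\omega_0$ for which $m_{\omega_0}$ is $\sigma$-ergodic; it is $\sigma$-invariant and $m(\widetilde\Omega_e)=1$ for every $m\in\mathfrak{M}_{\mathrm{inv}}(\Omega,\sigma)$. *)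

theory Defs
  imports "HOL-Probability.Probability"
begin

text \<open>The phase space is a whole type \<open>'a :: metric_space\<close>, and \<open>\<sigma> t \<omega>\<close> is the point
  that is written \<open>\<omega> \<cdot> t\<close> in the literature.  Compactness is not part of the definitions
  below; it is assumed separately as \<open>compact UNIV\<close>.\<close>

definition continuous_flow :: "(real \<Rightarrow> 'a::metric_space \<Rightarrow> 'a) \<Rightarrow> bool" where
  "continuous_flow \<sigma> \<longleftrightarrow>
     continuous_on UNIV (\<lambda>(t, \<omega>). \<sigma> t \<omega>) \<and> \<sigma> 0 = id \<and> (\<forall>s t. \<sigma> (s + t) = \<sigma> t \<circ> \<sigma> s)"

definition minimal_flow :: "(real \<Rightarrow> 'a::metric_space \<Rightarrow> 'a) \<Rightarrow> bool" where
  "minimal_flow \<sigma> \<longleftrightarrow>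
     (\<forall>K. compact K \<and> K \<noteq> {} \<and> (\<forall>t. \<sigma> t ` K = K) \<longrightarrow> K = UNIV)"

text \<open>The phase space is a single periodic orbit.  Every \<open>T > 0\<close> is a period of a constant
  orbit, so this covers the one-point space.\<close>

definition periodic_flow :: "(real \<Rightarrow> 'a::metric_space \<Rightarrow> 'a) \<Rightarrow> bool" where
  "periodic_flow \<sigma> \<longleftrightarrow> (\<exists>\<omega>. (\<exists>T>0. \<sigma> T \<omega> = \<omega>) \<and> range (\<lambda>t. \<sigma> t \<omega>) = UNIV)"

text \<open>Regularity of the measures is not required explicitly: it is automatic for Borel
  probability measures on a compact metric space.\<close>

definition inv_measures :: "(real \<Rightarrow> 'a::metric_space \<Rightarrow> 'a) \<Rightarrow> 'a measure set" where
  "inv_measures \<sigma> =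
     {m. prob_space m \<and> sets m = sets borel \<and> (\<forall>t. distr m borel (\<sigma> t) = m)}"

definition erg_measures :: "(real \<Rightarrow> 'a::metric_space \<Rightarrow> 'a) \<Rightarrow> 'a measure set" where
  "erg_measures \<sigma> =
     {m \<in> inv_measures \<sigma>.
        \<forall>B \<in> sets borel. (\<forall>t. \<sigma> t ` B = B) \<longrightarrow> measure m B = 0 \<or> measure m B = 1}"

text \<open>The integral of \<open>a\<close> along the orbit of \<open>\<omega>\<close>, from \<open>0\<close> to \<open>t\<close>.  The interval integral
  is oriented, so for \<open>t < 0\<close> this is minus the integral over \<open>[t, 0]\<close>.\<close>

definition orbit_integral ::
    "(real \<Rightarrow> 'a \<Rightarrow> 'a) \<Rightarrow> ('a \<Rightarrow> real) \<Rightarrow> 'a \<Rightarrow> real \<Rightarrow> real" where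
  "orbit_integral \<sigma> a \<omega> t = (LBINT s=ereal 0..ereal t. a (\<sigma> s \<omega>))"

definition has_continuous_primitive ::
    "(real \<Rightarrow> 'a::metric_space \<Rightarrow> 'a) \<Rightarrow> ('a \<Rightarrow> real) \<Rightarrow> bool" where
  "has_continuous_primitive \<sigma> a \<longleftrightarrow>
     (\<exists>h :: 'a \<Rightarrow> real. continuous_on UNIV h \<and>
        (\<forall>\<omega> t. h (\<sigma> t \<omega>) - h \<omega> = orbit_integral \<sigma> a \<omega> t))"

definition R_set ::
    "(real \<Rightarrow> 'a::metric_space \<Rightarrow> 'a) \<Rightarrow> 'a measure \<Rightarrow> ('a \<Rightarrow> real) set" where
  "R_set \<sigma> m =
     {a. continuous_on UNIV a \<and> (\<integral>\<omega>. a \<omega> \<partial>m) = 0 \<and> \<not> has_continuous_primitive \<sigma> a \<and>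
         (AE \<omega> in m. bdd_above ((\<lambda>t. orbit_integral \<sigma> a \<omega> t) ` {..0}))}"

definition exponential_dichotomy ::
    "(real \<Rightarrow> 'a \<Rightarrow> 'a) \<Rightarrow> ('a \<Rightarrow> real) \<Rightarrow> bool" where
  "exponential_dichotomy \<sigma> c \<longleftrightarrow>
     (\<exists>\<kappa>\<ge>1. \<exists>\<gamma>>0.
        (\<forall>\<omega>. \<forall>t\<ge>0. exp (orbit_integral \<sigma> c \<omega> t) \<le> \<kappa> * exp (- \<gamma> * t)) \<or>
        (\<forall>\<omega>. \<forall>t\<le>0. exp (orbit_integral \<sigma> c \<omega> t) \<le> \<kappa> * exp (\<gamma> * t)))"

definition sacker_sell_spectrum ::
    "(real \<Rightarrow> 'a \<Rightarrow> 'a) \<Rightarrow> ('a \<Rightarrow> real) \<Rightarrow> real set" where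
  "sacker_sell_spectrum \<sigma> a = {l. \<not> exponential_dichotomy \<sigma> (\<lambda>\<omega>. a \<omega> - l)}"

definition generic_point :: "(real \<Rightarrow> 'a::metric_space \<Rightarrow> 'a) \<Rightarrow> 'a \<Rightarrow> bool" where
  "generic_point \<sigma> \<omega>\<^sub>0 \<longleftrightarrow>
     (\<forall>f :: 'a \<Rightarrow> real. continuous_on UNIV f \<longrightarrow>
        (\<exists>L. ((\<lambda>t. 1 / t * orbit_integral \<sigma> f \<omega>\<^sub>0 t) \<longlongrightarrow> L) at_top))"

text \<open>Only meaningful for a generic \<open>\<omega>\<^sub>0\<close>: then, on a compact space, existence and
  uniqueness follow from the Riesz representation theorem.\<close>

definition generic_measure ::
    "(real \<Rightarrow> 'a::metric_space \<Rightarrow> 'a) \<Rightarrow> 'a \<Rightarrow> 'a measure" where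
  "generic_measure \<sigma> \<omega>\<^sub>0 =
     (THE m. m \<in> inv_measures \<sigma> \<and>
        (\<forall>f :: 'a \<Rightarrow> real. continuous_on UNIV f \<longrightarrow>
           ((\<lambda>t. 1 / t * orbit_integral \<sigma> f \<omega>\<^sub>0 t) \<longlongrightarrow> (\<integral>\<omega>. f \<omega> \<partial>m)) at_top))"

definition generic_ergodic_points :: "(real \<Rightarrow> 'a::metric_space \<Rightarrow> 'a) \<Rightarrow> 'a set" where
  "generic_ergodic_points \<sigma> =
     {\<omega>\<^sub>0. generic_point \<sigma> \<omega>\<^sub>0 \<and> generic_measure \<sigma> \<omega>\<^sub>0 \<in> erg_measures \<sigma>}"

end

theory Submission
  imports Defs
begin

text \<open>For (i) and (ii), take \<open>a = (\<Sum>k. \<phi> k - \<phi> k \<circ> \<sigma> 1)\<close>, where \<open>\<phi> k\<close> takes values in \<open>[0, 1]\<close>, equals \<open>1\<close> at a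
  fixed point \<open>p\<close>, varies along orbits with speed at most \<open>2\<^sup>-\<^sup>k\<close>, and has integral at most \<open>2\<^sup>-\<^sup>k\<close>
  for every invariant measure.  Up to bounded errors the orbit integral of \<open>a\<close> from \<open>x\<close> to \<open>\<sigma> t x\<close> is
  \<open>S x - S (\<sigma> t x)\<close> with \<open>S = (\<Sum>k. \<phi> k) \<ge> 0\<close>, and \<open>S\<close> is almost everywhere finite, so the orbit
  integrals are bounded above.  A continuous primitive would bound \<open>S\<close> along a dense orbit, hence at
  \<open>p\<close> by lower semicontinuity, but \<open>S p = \<infinity>\<close>.  As a uniform limit of coboundaries, \<open>a\<close> has
  uniformly vanishing averages, which gives the spectrum \<open>{0}\<close>.

  For (iii), the generic measures form a kernel that preserves \<open>m\<close>, so an \<open>m\<close>-null Borel set is null for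
  almost every generic measure.  Since the kernel also computes time averages, these are constant
  under almost every generic measure, which is ergodicity.  The backward bound makes the time average
  of \<open>a\<close> nonnegative, and its \<open>m\<close>-mean is zero, so it vanishes almost everywhere.\<close>

section \<open>Orbit integrals\<close>

text \<open>The demands on \<open>\<phi> k\<close> pull against each other: slow variation keeps it
  near 1 on a long orbit segment through \<open>p\<close>, while its integral must be small. They
  are compatible because there are no periodic points: the segment does not come back to
  \<open>p\<close>, so the bump can be made thin across the flow. The integral bound rests on a
  pointwise inequality for a sum of translates, which is why one \<open>a\<close> serves all
  invariant measures. The two rates have separate uses: the speed makes the series of
  \<open>a\<close> converge uniformly, the integrals make \<open>S\<close> integrable. A difference
  over unit time stands in for the derivative along the flow, since a supremum of bumps is only
  Lipschitz along orbits.

  In (iii), ergodicity of a generic measure is a statement about all continuous functions, whereas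
  almost-everywhere arguments handle countably many. A countable family whose linear span is
  uniformly dense bridges the gap, both for the existence of time averages and for their
  constancy.\<close>

lemma continuous_bounded_on_compact_UNIV:
  fixes f :: "'a::metric_space \<Rightarrow> real"
  assumes "compact (UNIV :: 'a set)" and "continuous_on UNIV f"
  obtains B where "B > 0" and "\<And>x. \<bar>f x\<bar> \<le> B"
proof -
  have "bounded (range f)"
    using compact_continuous_image[OF assms(2,1)] by (rule compact_imp_bounded)
  then show ?thesis
    using that unfolding bounded_pos by auto
qed

locale compact_flow =
  fixes \<sigma> :: "real \<Rightarrow> 'a::metric_space \<Rightarrow> 'a"
  assumes compact_space: "compact (UNIV :: 'a set)"
    and flow: "continuous_flow \<sigma>"
begin

lemma flow_zero [simp]: "\<sigma> 0 x = x"
  using flow by (simp add: continuous_flow_def)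

lemma flow_add: "\<sigma> (s + t) x = \<sigma> t (\<sigma> s x)"
  using flow by (simp add: continuous_flow_def)

lemma flow_flow [simp]: "\<sigma> t (\<sigma> s x) = \<sigma> (s + t) x"
  by (simp add: flow_add)

lemma continuous_on_flow [continuous_intros]:
  assumes "continuous_on S g" and "continuous_on S h"
  shows "continuous_on S (\<lambda>z. \<sigma> (g z) (h z))"
proof -
  have "continuous_on UNIV (\<lambda>p. \<sigma> (fst p) (snd p))"
    using flow by (simp add: continuous_flow_def case_prod_unfold)
  then have "continuous_on S (\<lambda>z. \<sigma> (fst (g z, h z)) (snd (g z, h z)))"
    by (rule continuous_on_compose2) (auto intro: continuous_on_Pair assms)
  then show ?thesis by simp
qed

lemma continuous_on_comp_flow [continuous_intros]:
  assumes "continuous_on UNIV f" and "continuous_on S g" and "continuous_on S h"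
  shows "continuous_on S (\<lambda>z. f (\<sigma> (g z) (h z)))"
  by (rule continuous_on_compose2[OF assms(1)]) (auto intro: continuous_on_flow assms)

lemma bounded_continuous:
  fixes f :: "'a \<Rightarrow> real"
  assumes "continuous_on UNIV f"
  obtains B where "B > 0" and "\<And>x. \<bar>f x\<bar> \<le> B"
  using continuous_bounded_on_compact_UNIV[OF compact_space assms] that by blast

lemma uniformly_continuous_along_flow:
  fixes f :: "'a \<Rightarrow> real"
  assumes f: "continuous_on UNIV f" and "e > 0"
  obtains d where "d > 0"
    and "\<And>s t x y. \<lbrakk>\<bar>s\<bar> \<le> T; \<bar>t\<bar> \<le> T; \<bar>s - t\<bar> < d; dist x y < d\<rbrakk> \<Longrightarrow> \<bar>f (\<sigma> s x) - f (\<sigma> t y)\<bar> < e"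
proof -
  have "continuous_on ({-T..T} \<times> UNIV) (\<lambda>p. f (\<sigma> (fst p) (snd p)))"
    by (intro continuous_intros f)
  moreover have "compact ({-T..T} \<times> (UNIV :: 'a set))"
    by (intro compact_Times compact_space) auto
  ultimately have "uniformly_continuous_on ({-T..T} \<times> UNIV) (\<lambda>p. f (\<sigma> (fst p) (snd p)))"
    by (rule compact_uniformly_continuous)
  from uniformly_continuous_onE[OF this \<open>e > 0\<close>] obtain d where "d > 0"
    and d: "\<And>p q. \<lbrakk>p \<in> {-T..T} \<times> UNIV; q \<in> {-T..T} \<times> UNIV; dist q p < d\<rbrakk>
              \<Longrightarrow> dist (f (\<sigma> (fst q) (snd q))) (f (\<sigma> (fst p) (snd p))) < e" by metis
  show ?thesis
  \<comment> \<open>Halved because the product distance is compared with the sum of the distances of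
    the two components.\<close>
  proof (rule that[of "d / 2"])
    fix s t :: real and x y :: 'a
    assume *: "\<bar>s\<bar> \<le> T" "\<bar>t\<bar> \<le> T" "\<bar>s - t\<bar> < d / 2" "dist x y < d / 2"
    have "dist (s, x) (t, y) \<le> \<bar>s - t\<bar> + dist x y"
      using sqrt_sum_squares_le_sum[of "\<bar>s - t\<bar>" "dist x y"]
      by (simp add: dist_Pair_Pair dist_real_def)
    then show "\<bar>f (\<sigma> s x) - f (\<sigma> t y)\<bar> < e"
      using d[of "(t, y)" "(s, x)"] * by (simp add: dist_real_def abs_le_iff minus_le_iff)
  qed (use \<open>d > 0\<close> in simp)
qed

lemma orbit_integral_zero [simp]: "orbit_integral \<sigma> f x 0 = 0"
  by (simp add: orbit_integral_def)

lemma has_real_derivative_orbit_integral: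
  assumes f: "continuous_on UNIV f"
  shows "(orbit_integral \<sigma> f x has_real_derivative f (\<sigma> t x)) (at t)"
proof -
  define T where "T = \<bar>t\<bar> + 1"
  have "((\<lambda>u. LBINT y=ereal 0..ereal u. f (\<sigma> y x)) has_vector_derivative f (\<sigma> t x))
        (at t within {-T..T})"
    by (rule interval_integral_FTC2) (auto simp: T_def intro!: continuous_intros f)
  then have "((\<lambda>u. LBINT y=ereal 0..ereal u. f (\<sigma> y x)) has_vector_derivative f (\<sigma> t x)) (at t)"
    by (subst (asm) at_within_Icc_at) (auto simp: T_def)
  then show ?thesis
    by (simp add: has_real_derivative_iff_has_vector_derivative orbit_integral_def[abs_def])
qed

text \<open>The tool for most identities below: a candidate that vanishes at 0 and has the right
  derivative along the orbit is the orbit integral. Both signs of \<open>t\<close> are covered at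
  once.\<close>

lemma orbit_integral_unique:
  assumes f: "continuous_on UNIV f" and "F 0 = 0"
    and F: "\<And>t. (F has_real_derivative f (\<sigma> t x)) (at t)"
  shows "orbit_integral \<sigma> f x t = F t"
proof -
  have "((\<lambda>t. orbit_integral \<sigma> f x t - F t) has_real_derivative 0) (at s)" for s
    using DERIV_diff[OF has_real_derivative_orbit_integral[OF f] F, of x s] by simp
  then have "orbit_integral \<sigma> f x t - F t = orbit_integral \<sigma> f x 0 - F 0"
    by (intro DERIV_isconst_all) auto
  then show ?thesis using \<open>F 0 = 0\<close> by simp
qed

lemma orbit_integral_add:
  assumes "continuous_on UNIV f" and "continuous_on UNIV g"
  shows "orbit_integral \<sigma> (\<lambda>x. f x + g x) x t = orbit_integral \<sigma> f x t + orbit_integral \<sigma> g x t"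
  by (rule orbit_integral_unique)
    (auto intro!: continuous_intros derivative_intros has_real_derivative_orbit_integral assms)

lemma orbit_integral_diff:
  assumes "continuous_on UNIV f" and "continuous_on UNIV g"
  shows "orbit_integral \<sigma> (\<lambda>x. f x - g x) x t = orbit_integral \<sigma> f x t - orbit_integral \<sigma> g x t"
  by (rule orbit_integral_unique)
    (auto intro!: continuous_intros derivative_intros has_real_derivative_orbit_integral assms)

lemma orbit_integral_cmult:
  assumes "continuous_on UNIV f"
  shows "orbit_integral \<sigma> (\<lambda>x. c * f x) x t = c * orbit_integral \<sigma> f x t"
  by (rule orbit_integral_unique)
    (auto intro!: continuous_intros DERIV_cmult has_real_derivative_orbit_integral assms)

lemma orbit_integral_const [simp]: "orbit_integral \<sigma> (\<lambda>_. c) x t = c * t"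
  by (rule orbit_integral_unique) (auto intro!: derivative_eq_intros)

lemma orbit_integral_sum:
  assumes "\<And>i. i \<in> I \<Longrightarrow> continuous_on UNIV (f i)"
  shows "orbit_integral \<sigma> (\<lambda>x. \<Sum>i\<in>I. f i x) x t = (\<Sum>i\<in>I. orbit_integral \<sigma> (f i) x t)"
  by (rule orbit_integral_unique)
    (auto intro!: continuous_on_sum DERIV_sum has_real_derivative_orbit_integral assms)

lemma orbit_integral_cocycle:
  assumes f: "continuous_on UNIV f"
  shows "orbit_integral \<sigma> f x (s + t) = orbit_integral \<sigma> f x s + orbit_integral \<sigma> f (\<sigma> s x) t"
proof -
  have "((\<lambda>t. orbit_integral \<sigma> f x (s + t) - orbit_integral \<sigma> f x s)
         has_real_derivative f (\<sigma> t (\<sigma> s x))) (at t)" for t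
    using has_real_derivative_orbit_integral[OF f, of x "s + t"]
    by (auto intro!: derivative_eq_intros simp: DERIV_shift add.commute[of s])
  from orbit_integral_unique[OF f _ this] show ?thesis by simp
qed

lemma orbit_integral_comp_flow:
  assumes f: "continuous_on UNIV f"
  shows "orbit_integral \<sigma> (\<lambda>x. f (\<sigma> s x)) x t = orbit_integral \<sigma> f (\<sigma> s x) t"
  by (rule orbit_integral_unique)
    (use has_real_derivative_orbit_integral[OF f, of "\<sigma> s x"] in
      \<open>auto intro!: continuous_intros f simp: add.commute\<close>)

text \<open>The size estimates below go through this. The bound on \<open>s\<close> locates the
  sampling point, so over a short time the integral is close to \<open>t * f x\<close>.\<close>

lemma orbit_integral_mean_value:
  assumes f: "continuous_on UNIV f"
  obtains s where "\<bar>s\<bar> \<le> \<bar>t\<bar>" and "orbit_integral \<sigma> f x t = t * f (\<sigma> s x)"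
proof (cases t "0 :: real" rule: linorder_cases)
  case less
  from MVT2[OF less has_real_derivative_orbit_integral[OF f]] obtain z where
    "t < z" "z < 0" "orbit_integral \<sigma> f x 0 - orbit_integral \<sigma> f x t = (0 - t) * f (\<sigma> z x)" by blast
  then show ?thesis using that[of z] by auto
next
  case equal
  then show ?thesis using that[of 0] by simp
next
  case greater
  from MVT2[OF greater has_real_derivative_orbit_integral[OF f]] obtain z where
    "0 < z" "z < t" "orbit_integral \<sigma> f x t - orbit_integral \<sigma> f x 0 = (t - 0) * f (\<sigma> z x)" by blast
  then show ?thesis using that[of z] by auto
qed

lemma abs_orbit_integral_le:
  assumes "continuous_on UNIV f" and "\<And>x. \<bar>f x\<bar> \<le> B"
  shows "\<bar>orbit_integral \<sigma> f x t\<bar> \<le> B * \<bar>t\<bar>"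
proof -
  obtain s where "orbit_integral \<sigma> f x t = t * f (\<sigma> s x)"
    using orbit_integral_mean_value[OF assms(1)] by metis
  then show ?thesis
    using mult_left_mono[OF assms(2), of "\<bar>t\<bar>" "\<sigma> s x"] by (simp add: abs_mult mult.commute)
qed

lemma orbit_integral_nonneg:
  assumes "continuous_on UNIV f" and "\<And>x. f x \<ge> 0" and "t \<ge> 0"
  shows "orbit_integral \<sigma> f x t \<ge> 0"
proof -
  obtain s where "orbit_integral \<sigma> f x t = t * f (\<sigma> s x)"
    using orbit_integral_mean_value[OF assms(1)] by metis
  then show ?thesis using assms(2,3) by simp
qed

lemma continuous_on_orbit_integral:
  assumes f: "continuous_on UNIV f"
  shows "continuous_on UNIV (\<lambda>x. orbit_integral \<sigma> f x t)"
proof -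
  have *: "continuous_on UNIV (\<lambda>x. orbit_integral \<sigma> f x t)" if "t \<ge> 0" for t
  proof -
    have "orbit_integral \<sigma> f x t = integral (cbox 0 t) (\<lambda>s. f (\<sigma> s x))" for x
      unfolding orbit_integral_def cbox_interval
      by (intro interval_integral_eq_integral borel_integrable_atLeastAtMost' continuous_intros f)
        (use that in auto)
    moreover have "continuous_on UNIV (\<lambda>x. integral (cbox 0 t) (\<lambda>s. f (\<sigma> s x)))"
      by (intro integral_continuous_on_param) (auto simp: case_prod_unfold intro!: continuous_intros f)
    ultimately show ?thesis by simp
  qed
  show ?thesis
  proof (cases "t \<ge> 0")
    case False
    \<comment> \<open>The cocycle identity at \<open>t + (- t) = 0\<close> reverses time and reduces
      to the nonnegative case.\<close>
    have "orbit_integral \<sigma> f x t = - orbit_integral \<sigma> f (\<sigma> t x) (- t)" for x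
      using orbit_integral_cocycle[OF f, of x t "- t"] by simp
    moreover have "continuous_on UNIV (\<lambda>x. - orbit_integral \<sigma> f (\<sigma> t x) (- t))"
      using False
      by (intro continuous_intros continuous_on_compose2[OF *[of "- t"]]) (auto intro!: continuous_intros)
    ultimately show ?thesis by simp
  qed (rule *)
qed

end

section \<open>Invariant measures\<close>

lemma inv_measures_prob_space: "m \<in> inv_measures \<sigma> \<Longrightarrow> prob_space m"
  and inv_measures_sets [measurable_cong]: "m \<in> inv_measures \<sigma> \<Longrightarrow> sets m = sets borel"
  by (auto simp: inv_measures_def)

lemma inv_measures_space: "m \<in> inv_measures \<sigma> \<Longrightarrow> space m = UNIV"
  using sets_eq_imp_space_eq[of m borel] by (auto simp: inv_measures_def)

lemma continuous_on_borel_measurable: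
  fixes f :: "'a::topological_space \<Rightarrow> 'b::topological_space"
  assumes "sets m = sets borel" and "continuous_on UNIV f"
  shows "f \<in> m \<rightarrow>\<^sub>M borel"
  using borel_measurable_continuous_onI[OF assms(2)] measurable_cong_sets[OF assms(1) refl] by blast

context compact_flow
begin

lemma continuous_on_flow_map: "continuous_on UNIV (\<sigma> t)"
  by (intro continuous_intros)

lemma flow_map_measurable [measurable]: "\<sigma> t \<in> borel \<rightarrow>\<^sub>M borel"
  by (intro borel_measurable_continuous_onI continuous_on_flow_map)

lemma integrable_continuous:
  fixes f :: "'a \<Rightarrow> real"
  assumes m: "m \<in> inv_measures \<sigma>" and f: "continuous_on UNIV f"
  shows "integrable m f"
proof -
  interpret prob_space m using m by (rule inv_measures_prob_space)
  obtain B where "\<And>x. \<bar>f x\<bar> \<le> B" using bounded_continuous[OF f] by metis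
  then show ?thesis
    using continuous_on_borel_measurable[OF inv_measures_sets[OF m] f]
    by (intro integrable_const_bound[where B = B]) auto
qed

lemma integral_comp_flow:
  fixes f :: "'a \<Rightarrow> real"
  assumes m: "m \<in> inv_measures \<sigma>" and f: "f \<in> borel_measurable borel"
  shows "(\<integral>x. f (\<sigma> t x) \<partial>m) = (\<integral>x. f x \<partial>m)"
proof -
  have "(\<integral>x. f x \<partial>m) = (\<integral>x. f x \<partial>(distr m borel (\<sigma> t)))"
    using m by (simp add: inv_measures_def)
  also have "\<dots> = (\<integral>x. f (\<sigma> t x) \<partial>m)"
    using continuous_on_borel_measurable[OF inv_measures_sets[OF m] continuous_on_flow_map] f
    by (rule integral_distr)
  finally show ?thesis ..
qed

end

section \<open>Slowly varying bump functions\<close>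

locale minimal_nonperiodic_flow = compact_flow +
  assumes minimal: "minimal_flow \<sigma>" and nonperiodic: "\<not> periodic_flow \<sigma>"
begin

text \<open>Flowing back by \<open>- t\<close> upgrades the inclusions to the equalities that
  \<open>minimal_flow\<close> asks for.\<close>

lemma invariant_compact_UNIV:
  assumes "compact K" and "K \<noteq> {}" and "\<And>t. \<sigma> t ` K \<subseteq> K"
  shows "K = UNIV"
proof -
  have "\<sigma> t ` K = K" for t
  proof
    show "K \<subseteq> \<sigma> t ` K"
    proof
      fix y assume "y \<in> K"
      then have "\<sigma> (- t) y \<in> K" using assms(3) by blast
      then show "y \<in> \<sigma> t ` K" by (rule rev_image_eqI) simp
    qed
  qed (rule assms(3))
  then show ?thesis using minimal assms(1,2) unfolding minimal_flow_def by blast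
qed

lemma orbit_dense: "closure (range (\<lambda>t. \<sigma> t x)) = UNIV"
proof (rule invariant_compact_UNIV)
  show "compact (closure (range (\<lambda>t. \<sigma> t x)))"
    using compact_Int_closed[OF compact_space closed_closure] by simp
  show "\<sigma> t ` closure (range (\<lambda>t. \<sigma> t x)) \<subseteq> closure (range (\<lambda>t. \<sigma> t x))" for t
    by (rule image_closure_subset)
      (auto intro!: continuous_intros subsetD[OF closure_subset])
qed auto

text \<open>A periodic orbit is the image of the compact interval \<open>{0..r}\<close> and is
  invariant, so minimality would make it the whole space. A hypothesis on the space thus becomes one
  on each point.\<close>

lemma no_periodic_point:
  assumes "r > 0"
  shows "\<sigma> r p \<noteq> p"
proof
  assume r: "\<sigma> r p = p"
  have nat: "\<sigma> (real n * r) p = p" for n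
    by (induction n) (simp_all add: distrib_right flow_add r)
  have int: "\<sigma> (of_int k * r) p = p" for k
  proof (cases k)
    case (neg n)
    then have "of_int k * r = - (real (Suc n) * r)"
      by (simp only: of_int_minus of_int_of_nat_eq mult_minus_left)
    moreover have "\<sigma> (- (real (Suc n) * r)) (\<sigma> (real (Suc n) * r) p) = p"
      by (simp only: flow_flow add.right_inverse flow_zero)
    ultimately show ?thesis by (simp only: nat)
  qed (use nat in simp)
  have "range (\<lambda>t. \<sigma> t p) \<subseteq> (\<lambda>t. \<sigma> t p) ` {0..r}"
  proof safe
    fix t :: real
    define k where "k = \<lfloor>t / r\<rfloor>"
    have "\<sigma> t p = \<sigma> (of_int k * r + (t - of_int k * r)) p" by simp
    also have "\<dots> = \<sigma> (t - of_int k * r) p" by (simp only: flow_add int)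
    finally have "\<sigma> t p = \<sigma> (t - of_int k * r) p" .
    moreover have "t - of_int k * r \<in> {0..r}"
      using floor_divide_lower[OF \<open>r > 0\<close>, of t] floor_divide_upper[OF \<open>r > 0\<close>, of t]
      by (simp add: k_def distrib_right)
    ultimately show "\<sigma> t p \<in> (\<lambda>t. \<sigma> t p) ` {0..r}" by blast
  qed
  then have "range (\<lambda>t. \<sigma> t p) = (\<lambda>t. \<sigma> t p) ` {0..r}" by auto
  moreover have "compact ((\<lambda>t. \<sigma> t p) ` {0..r})"
    by (intro compact_continuous_image continuous_intros) auto
  ultimately have "range (\<lambda>t. \<sigma> t p) = UNIV"
    using \<open>r > 0\<close> by (intro invariant_compact_UNIV) auto
  then show False
    using nonperiodic r \<open>r > 0\<close> unfolding periodic_flow_def by blast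
qed

text \<open>On the compact \<open>{S..T}\<close>, away from time 0, the distance from
  \<open>p\<close> to \<open>\<sigma> r p\<close> is at least some \<open>c > 0\<close>; uniform
  continuity carries half of this bound to all \<open>x\<close> near \<open>p\<close>.\<close>

lemma no_return:
  assumes "0 < S"
  obtains e where "e > 0"
    and "\<And>r x. \<lbrakk>r \<in> {S..T}; dist p x < e\<rbrakk> \<Longrightarrow> dist p (\<sigma> r x) \<ge> e"
proof -
  have "\<exists>c>0. \<forall>r\<in>{S..T}. dist p (\<sigma> r p) \<ge> c"
  proof (cases "{S..T} = {}")
    case False
    have "continuous_on {S..T} (\<lambda>r. dist p (\<sigma> r p))"
      by (intro continuous_intros)
    from continuous_attains_inf[OF compact_Icc False this] obtain q where "q \<in> {S..T}"
      "\<forall>r\<in>{S..T}. dist p (\<sigma> q p) \<le> dist p (\<sigma> r p)" by blast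
    moreover have "dist p (\<sigma> q p) > 0"
      using no_periodic_point[of q p] \<open>q \<in> {S..T}\<close> \<open>0 < S\<close> by force
    ultimately show ?thesis by blast
  qed (auto intro: exI[of _ 1])
  then obtain c where "c > 0" and c: "\<And>r. r \<in> {S..T} \<Longrightarrow> dist p (\<sigma> r p) \<ge> c" by blast
  have "continuous_on UNIV (dist p)" by (intro continuous_intros)
  then obtain d where "d > 0" and d: "\<And>s t x y. \<lbrakk>\<bar>s\<bar> \<le> T; \<bar>t\<bar> \<le> T; \<bar>s - t\<bar> < d; dist x y < d\<rbrakk>
      \<Longrightarrow> \<bar>dist p (\<sigma> s x) - dist p (\<sigma> t y)\<bar> < c / 2"
    using uniformly_continuous_along_flow[of "dist p" "c / 2" T] \<open>c > 0\<close> by (metis half_gt_zero)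
  show ?thesis
  proof (rule that[of "min d (c / 2)"])
    fix r x assume r: "r \<in> {S..T}" and "dist p x < min d (c / 2)"
    then have "\<bar>dist p (\<sigma> r p) - dist p (\<sigma> r x)\<bar> < c / 2"
      using \<open>0 < S\<close> \<open>d > 0\<close> by (intro d) auto
    then show "dist p (\<sigma> r x) \<ge> min d (c / 2)" using c[OF r] by linarith
  qed (use \<open>c > 0\<close> \<open>d > 0\<close> in simp)
qed

text \<open>The supremum over the orbit of a bump at \<open>p\<close>, damped by a tent of width \<open>L\<close>, varies slowly along
  orbits.  It has small integral because the bump is so narrow that many translates of it along
  the flow have disjoint supports.\<close>

lemma slow_bump:
  fixes L :: real and N :: nat
  assumes "L > 0"
  obtains \<phi> :: "'a \<Rightarrow> real" where "continuous_on UNIV \<phi>" and "\<And>x. 0 \<le> \<phi> x" and "\<And>x. \<phi> x \<le> 1" and "\<phi> p = 1"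
    and "\<And>t x. \<bar>\<phi> (\<sigma> t x) - \<phi> x\<bar> \<le> \<bar>t\<bar> / L"
    and "\<And>x. (\<Sum>j<N. \<phi> (\<sigma> (3 * L * real j) x)) \<le> 1"
proof -
  \<comment> \<open>If \<open>\<phi>\<close> is nonzero at the translates by
    \<open>3 * L * i\<close> and \<open>3 * L * j\<close> with \<open>i < j < N\<close>, the orbit
    is near \<open>p\<close> at these times up to offsets below \<open>L\<close>. The two visits are
    more than \<open>3 * L - 2 * L = L\<close> and less than \<open>3 * L * N\<close> apart, and
    returns in this window are what \<open>e\<close> excludes.\<close>
  obtain e where "e > 0"
    and e: "\<And>r x. \<lbrakk>r \<in> {L..3 * L * real N}; dist p x < e\<rbrakk> \<Longrightarrow> dist p (\<sigma> r x) \<ge> e"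
    using no_return[OF \<open>L > 0\<close>] by metis
  define \<psi> where "\<psi> x = max 0 (1 - dist p x / e)" for x
  define w where "w s = max 0 (1 - \<bar>s\<bar> / L)" for s
  define \<phi> where "\<phi> x = (SUP s. w s * \<psi> (\<sigma> s x))" for x
  have \<psi>: "0 \<le> \<psi> x" "\<psi> x \<le> 1" "\<psi> x \<noteq> 0 \<Longrightarrow> dist p x < e" for x
    using \<open>e > 0\<close> by (auto simp: \<psi>_def max_def split: if_splits)
  have \<psi>_cont: "continuous_on UNIV \<psi>"
    unfolding \<psi>_def using \<open>e > 0\<close> by (intro continuous_intros) auto
  have w: "0 \<le> w s" "w s \<le> 1" "w s \<noteq> 0 \<Longrightarrow> \<bar>s\<bar> < L" for s
    using \<open>L > 0\<close> by (auto simp: w_def max_def field_simps split: if_splits)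
  have w_lip: "w s \<le> w (t + s) + \<bar>t\<bar> / L" for s t
  proof -
    have "\<bar>t + s\<bar> / L \<le> \<bar>t\<bar> / L + \<bar>s\<bar> / L"
      using \<open>L > 0\<close> by (simp add: add_divide_distrib[symmetric] divide_right_mono)
    moreover have "\<bar>t\<bar> / L \<ge> 0" using \<open>L > 0\<close> by simp
    ultimately show ?thesis unfolding w_def by linarith
  qed
  have w\<psi>: "w s * \<psi> x \<le> 1" for s x
    using mult_mono[of "w s" 1 "\<psi> x" 1] w \<psi> by simp
  have upper: "w s * \<psi> (\<sigma> s x) \<le> \<phi> x" for s x
    unfolding \<phi>_def by (rule cSUP_upper) (auto intro!: bdd_aboveI[of _ 1] w\<psi>)
  have least: "\<phi> x \<le> c" if "\<And>s. w s * \<psi> (\<sigma> s x) \<le> c" for x c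
    unfolding \<phi>_def by (rule cSUP_least) (auto intro: that)
  have nonneg: "0 \<le> \<phi> x" for x
    using upper[of 0 x] mult_nonneg_nonneg[OF w(1)[of 0] \<psi>(1)[of "\<sigma> 0 x"]] by simp
  have le1: "\<phi> x \<le> 1" for x
    by (rule least) (rule w\<psi>)
  have "\<phi> p = 1"
    using upper[of 0 p] le1[of p] by (simp add: w_def \<psi>_def)
  have lip1: "\<phi> (\<sigma> t x) \<le> \<phi> x + \<bar>t\<bar> / L" for t x
  proof (rule least)
    fix s
    have "w s * \<psi> (\<sigma> (t + s) x) \<le> (w (t + s) + \<bar>t\<bar> / L) * \<psi> (\<sigma> (t + s) x)"
      by (rule mult_right_mono[OF w_lip \<psi>(1)])
    also have "\<dots> \<le> w (t + s) * \<psi> (\<sigma> (t + s) x) + \<bar>t\<bar> / L"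
      unfolding distrib_right
      using mult_left_mono[OF \<psi>(2)[of "\<sigma> (t + s) x"], of "\<bar>t\<bar> / L"] \<open>L > 0\<close> by simp
    also have "\<dots> \<le> \<phi> x + \<bar>t\<bar> / L" using upper[of "t + s" x] by simp
    finally show "w s * \<psi> (\<sigma> s (\<sigma> t x)) \<le> \<phi> x + \<bar>t\<bar> / L" by simp
  qed
  \<comment> \<open>The two-sided bound is \<open>lip1\<close> once forwards and once backwards from
    \<open>\<sigma> t x\<close>.\<close>
  have lip: "\<bar>\<phi> (\<sigma> t x) - \<phi> x\<bar> \<le> \<bar>t\<bar> / L" for t x
    using lip1[of t x] lip1[of "- t" "\<sigma> t x"] by simp
  have cont: "continuous_on UNIV \<phi>"
    unfolding continuous_on_iff
  proof safe
    fix x :: 'a and c :: real assume "c > 0"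
    then obtain d where "d > 0" and d: "\<And>s t x y. \<lbrakk>\<bar>s\<bar> \<le> L; \<bar>t\<bar> \<le> L; \<bar>s - t\<bar> < d; dist x y < d\<rbrakk>
        \<Longrightarrow> \<bar>\<psi> (\<sigma> s x) - \<psi> (\<sigma> t y)\<bar> < c / 2"
      using uniformly_continuous_along_flow[OF \<psi>_cont, of "c / 2" L] by (metis half_gt_zero)
    \<comment> \<open>Only offsets with \<open>\<bar>s\<bar> < L\<close> contribute, and for these
      the functions \<open>\<psi> \<circ> \<sigma> s\<close> are equicontinuous; a supremum of an
      equicontinuous family is continuous.\<close>
    have *: "\<phi> x \<le> \<phi> y + c / 2" if "dist x y < d" for x y
    proof (rule least)
      fix s
      show "w s * \<psi> (\<sigma> s x) \<le> \<phi> y + c / 2"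
      proof (cases "w s = 0")
        case True
        then show ?thesis using nonneg[of y] \<open>c > 0\<close> by simp
      next
        case False
        then have "\<bar>\<psi> (\<sigma> s x) - \<psi> (\<sigma> s y)\<bar> < c / 2"
          using w(3)[of s] that \<open>d > 0\<close> by (intro d) auto
        then have "w s * \<psi> (\<sigma> s x) \<le> w s * (\<psi> (\<sigma> s y) + c / 2)"
          by (intro mult_left_mono w) linarith
        also have "\<dots> \<le> w s * \<psi> (\<sigma> s y) + c / 2"
          unfolding distrib_left using mult_right_mono[OF w(2)[of s], of "c / 2"] \<open>c > 0\<close> by simp
        also have "\<dots> \<le> \<phi> y + c / 2" using upper[of s y] by simp
        finally show ?thesis .
      qed
    qed
    show "\<exists>d>0. \<forall>x'\<in>UNIV. dist x' x < d \<longrightarrow> dist (\<phi> x') (\<phi> x) < c"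
    proof (intro exI[of _ d] conjI ballI impI \<open>d > 0\<close>)
      fix x' assume "dist x' x < d"
      then show "dist (\<phi> x') (\<phi> x) < c"
        using *[of x x'] *[of x' x] \<open>c > 0\<close> by (simp add: dist_real_def dist_commute abs_less_iff)
    qed
  qed
  have support: "\<exists>s. \<bar>s\<bar> < L \<and> dist p (\<sigma> s x) < e" if "\<phi> x \<noteq> 0" for x
  proof (rule ccontr)
    assume "\<not> ?thesis"
    then have "w s = 0 \<or> \<psi> (\<sigma> s x) = 0" for s
      using w(3)[of s] \<psi>(3)[of "\<sigma> s x"] by blast
    then have "w s * \<psi> (\<sigma> s x) \<le> 0" for s
      by (metis mult_eq_0_iff order_refl)
    then have "\<phi> x \<le> 0" by (rule least)
    then show False using nonneg[of x] that by simp
  qed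
  have disjoint: "\<phi> (\<sigma> (3 * L * real i) x) = 0 \<or> \<phi> (\<sigma> (3 * L * real j) x) = 0"
    if "i < j" "j < N" for i j x
  proof (rule ccontr)
    assume "\<not> ?thesis"
    then obtain s s' where s: "\<bar>s\<bar> < L" "dist p (\<sigma> (3 * L * real i + s) x) < e"
      and s': "\<bar>s'\<bar> < L" "dist p (\<sigma> (3 * L * real j + s') x) < e"
      using support[of "\<sigma> (3 * L * real i) x"] support[of "\<sigma> (3 * L * real j) x"] by auto
    define r where "r = 3 * L * (real j - real i) + s' - s"
    have "real j - real i \<ge> 1" using \<open>i < j\<close> by simp
    then have "3 * L * (real j - real i) \<ge> 3 * L * 1" using \<open>L > 0\<close> by (intro mult_left_mono) auto
    moreover have "real j - real i \<le> real N - 1" using \<open>j < N\<close> by linarith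
    then have "3 * L * (real j - real i) \<le> 3 * L * (real N - 1)" using \<open>L > 0\<close> by (intro mult_left_mono) auto
    ultimately have "r \<in> {L..3 * L * real N}"
      using s(1) s'(1) unfolding r_def atLeastAtMost_iff right_diff_distrib by linarith
    from e[OF this s(2)] have "dist p (\<sigma> (3 * L * real j + s') x) \<ge> e"
      by (simp add: r_def algebra_simps)
    then show False using s'(2) by simp
  qed
  have "(\<Sum>j<N. \<phi> (\<sigma> (3 * L * real j) x)) \<le> 1" for x
  proof (cases "\<exists>i<N. \<phi> (\<sigma> (3 * L * real i) x) \<noteq> 0")
    case True
    then obtain i where i: "i < N" "\<phi> (\<sigma> (3 * L * real i) x) \<noteq> 0" by blast
    have "\<phi> (\<sigma> (3 * L * real j) x) = 0" if "j \<in> {..<N} - {i}" for j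
      using disjoint[of i j x] disjoint[of j i x] i that by (cases i j rule: linorder_cases) auto
    then have "(\<Sum>j<N. \<phi> (\<sigma> (3 * L * real j) x)) = \<phi> (\<sigma> (3 * L * real i) x)"
      using i(1) by (subst sum.remove[of _ i]) auto
    then show ?thesis using le1 by simp
  qed auto
  with cont nonneg le1 \<open>\<phi> p = 1\<close> lip show ?thesis by (rule that)
qed

text \<open>Invariance gives the \<open>N\<close> translates equal integrals, and their sum is at
  most 1. The bound depends on \<open>N\<close> alone, hence is common to all invariant
  measures.\<close>

lemma integral_slow_bump:
  fixes \<phi> :: "'a \<Rightarrow> real"
  assumes m: "m \<in> inv_measures \<sigma>" and cont: "continuous_on UNIV \<phi>"
    and sum: "\<And>x. (\<Sum>j<N. \<phi> (\<sigma> (c * real j) x)) \<le> 1" and "N > 0"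
  shows "(\<integral>x. \<phi> x \<partial>m) \<le> 1 / real N"
proof -
  interpret prob_space m using m by (rule inv_measures_prob_space)
  have int: "integrable m (\<lambda>x. \<phi> (\<sigma> t x))" for t
    by (intro integrable_continuous[OF m] continuous_intros cont)
  have "real N * (\<integral>x. \<phi> x \<partial>m) = (\<Sum>j<N. \<integral>x. \<phi> (\<sigma> (c * real j) x) \<partial>m)"
    using integral_comp_flow[OF m borel_measurable_continuous_onI[OF cont]] by simp
  also have "\<dots> = (\<integral>x. (\<Sum>j<N. \<phi> (\<sigma> (c * real j) x)) \<partial>m)"
    by (rule Bochner_Integration.integral_sum[symmetric]) (rule int)
  also have "\<dots> \<le> (\<integral>x. 1 \<partial>m)"
    by (intro integral_mono sum Bochner_Integration.integrable_sum int) auto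
  finally show ?thesis using \<open>N > 0\<close> by (simp add: field_simps prob_space)
qed

end

section \<open>A function in every set \<open>R_set \<sigma> m\<close>\<close>

context compact_flow
begin

text \<open>By \<open>small\<close>, orbit integrals grow sublinearly, uniformly over the space. So
  \<open>- l * t\<close> dominates for \<open>l \<noteq> 0\<close>, whereas for \<open>l = 0\<close>
  neither exponential rate can be met.\<close>

lemma sacker_sell_spectrum_eq_zero:
  assumes a: "continuous_on UNIV a"
    and small: "\<And>e. e > 0 \<Longrightarrow> \<exists>C. \<forall>x t. \<bar>orbit_integral \<sigma> a x t\<bar> \<le> C + e * \<bar>t\<bar>"
  shows "sacker_sell_spectrum \<sigma> a = {0}"
proof -
  have shift: "orbit_integral \<sigma> (\<lambda>x. a x - l) x t = orbit_integral \<sigma> a x t - l * t" for l x t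
    using orbit_integral_diff[OF a, of "\<lambda>_. l"] by simp
  have dich: "exponential_dichotomy \<sigma> (\<lambda>x. a x - l)" if "l \<noteq> 0" for l
  proof -
    \<comment> \<open>Half of the drift \<open>\<bar>l\<bar>\<close> absorbs the error in
      \<open>small\<close>, the other half is the dichotomy rate; the sign of \<open>l\<close>
      selects the alternative.\<close>
    define e where "e = \<bar>l\<bar> / 2"
    have "e > 0" using that by (simp add: e_def)
    then obtain C where C: "\<And>x t. \<bar>orbit_integral \<sigma> a x t\<bar> \<le> C + e * \<bar>t\<bar>"
      using small by blast
    have "C \<ge> 0" using C[of undefined 0] by simp
    have bound: "exp (orbit_integral \<sigma> a x t - l * t) \<le> exp C * exp (- e * \<bar>t\<bar>)"
      if "l * t = \<bar>l\<bar> * \<bar>t\<bar>" for x t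
    proof -
      have "l * t = 2 * (e * \<bar>t\<bar>)" using that by (simp add: e_def)
      then have "orbit_integral \<sigma> a x t - l * t \<le> C + - e * \<bar>t\<bar>"
        using C[of x t] by simp
      then show ?thesis by (simp only: exp_add[symmetric] exp_le_cancel_iff)
    qed
    show ?thesis
    proof (cases "l > 0")
      case True
      have "exp (orbit_integral \<sigma> (\<lambda>x. a x - l) x t) \<le> exp C * exp (- e * t)" if "t \<ge> 0" for x t
        using bound[of t x] that True by (simp add: shift)
      then show ?thesis
        unfolding exponential_dichotomy_def using \<open>C \<ge> 0\<close> \<open>e > 0\<close> by (meson one_le_exp_iff)
    next
      case False
      have "exp (orbit_integral \<sigma> (\<lambda>x. a x - l) x t) \<le> exp C * exp (e * t)" if "t \<le> 0" for x t
        using bound[of t x] that False \<open>l \<noteq> 0\<close> by (simp add: shift)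
      then show ?thesis
        unfolding exponential_dichotomy_def using \<open>C \<ge> 0\<close> \<open>e > 0\<close> by (meson one_le_exp_iff)
    qed
  qed
  have "\<not> exponential_dichotomy \<sigma> a"
  proof
    assume "exponential_dichotomy \<sigma> a"
    then obtain \<kappa> \<gamma> where "\<kappa> \<ge> 1" "\<gamma> > 0"
      and *: "(\<forall>x. \<forall>t\<ge>0. exp (orbit_integral \<sigma> a x t) \<le> \<kappa> * exp (- \<gamma> * t)) \<or>
        (\<forall>x. \<forall>t\<le>0. exp (orbit_integral \<sigma> a x t) \<le> \<kappa> * exp (\<gamma> * t))"
      unfolding exponential_dichotomy_def by blast
    from \<open>\<gamma> > 0\<close> obtain C where C: "\<And>x t. \<bar>orbit_integral \<sigma> a x t\<bar> \<le> C + \<gamma> / 2 * \<bar>t\<bar>"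
      using small[of "\<gamma> / 2"] by auto
    \<comment> \<open>The two bounds on the orbit integral will force
      \<open>\<gamma> * t / 2 \<le> C + ln \<kappa>\<close>; this \<open>t\<close> makes the left
      side \<open>\<bar>C\<bar> + ln \<kappa> + 1\<close>.\<close>
    define t where "t = 2 * (\<bar>C\<bar> + ln \<kappa> + 1) / \<gamma>"
    have "t > 0" using \<open>\<gamma> > 0\<close> ln_ge_zero[OF \<open>\<kappa> \<ge> 1\<close>] by (simp add: t_def)
    have t: "\<gamma> * t = 2 * (\<bar>C\<bar> + ln \<kappa> + 1)" using \<open>\<gamma> > 0\<close> by (simp add: t_def)
    \<comment> \<open>The first alternative is used at \<open>s = t\<close>, the second at
      \<open>s = - t\<close>.\<close>
    from * obtain x s where "\<bar>s\<bar> = t" and "exp (orbit_integral \<sigma> a x s) \<le> \<kappa> * exp (- \<gamma> * t)"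
      using \<open>t > 0\<close>
      by (metis abs_minus_cancel abs_of_pos less_imp_le minus_mult_commute neg_le_0_iff_le)
    then have "exp (orbit_integral \<sigma> a x s) \<le> exp (ln \<kappa> - \<gamma> * t)"
      using \<open>\<kappa> \<ge> 1\<close> by (simp add: exp_diff exp_minus field_simps)
    then have "orbit_integral \<sigma> a x s \<le> ln \<kappa> - \<gamma> * t" by simp
    moreover have "orbit_integral \<sigma> a x s \<ge> - C - \<gamma> * t / 2"
      using C[of x s] \<open>\<bar>s\<bar> = t\<close> by simp
    ultimately show False using t abs_ge_self[of C] by argo
  qed
  with dich show ?thesis
    unfolding sacker_sell_spectrum_def by auto
qed

end

context minimal_nonperiodic_flow
begin

lemma exists_common_R_set:
  "\<exists>a. sacker_sell_spectrum \<sigma> a = {0} \<and> (\<forall>m\<in>inv_measures \<sigma>. a \<in> R_set \<sigma> m)"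
proof -
  \<comment> \<open>Any point will do.\<close>
  define p :: 'a where "p = undefined"
  have "\<forall>k::nat. \<exists>\<phi> :: 'a \<Rightarrow> real. continuous_on UNIV \<phi> \<and> (\<forall>x. 0 \<le> \<phi> x) \<and> (\<forall>x. \<phi> x \<le> 1) \<and> \<phi> p = 1
      \<and> (\<forall>t x. \<bar>\<phi> (\<sigma> t x) - \<phi> x\<bar> \<le> \<bar>t\<bar> / 2 ^ k)
      \<and> (\<forall>x. (\<Sum>j<2 ^ k. \<phi> (\<sigma> (3 * 2 ^ k * real j) x)) \<le> 1)" (is "\<forall>k. \<exists>\<phi>. ?Q k \<phi>")
  proof
    fix k :: nat
    show "\<exists>\<phi>. ?Q k \<phi>"
    \<comment> \<open>The tent width governs the speed, the number of translates the integral; with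
      both equal to \<open>2 ^ k\<close>, both bounds are summable.\<close>
    proof (rule slow_bump[of "2 ^ k" p "2 ^ k"])
      fix \<phi> :: "'a \<Rightarrow> real"
      assume "continuous_on UNIV \<phi>" "\<And>x. 0 \<le> \<phi> x" "\<And>x. \<phi> x \<le> 1" "\<phi> p = 1"
        "\<And>t x. \<bar>\<phi> (\<sigma> t x) - \<phi> x\<bar> \<le> \<bar>t\<bar> / 2 ^ k"
        "\<And>x. (\<Sum>j<2 ^ k. \<phi> (\<sigma> (3 * 2 ^ k * real j) x)) \<le> 1"
      then have "?Q k \<phi>" by simp
      then show ?thesis by (rule exI[of "?Q k" \<phi>])
    qed simp
  qed
  from choice[OF this] obtain \<phi> :: "nat \<Rightarrow> 'a \<Rightarrow> real" where \<phi>: "\<forall>k. ?Q k (\<phi> k)" ..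
  then have cont: "\<And>k. continuous_on UNIV (\<phi> k)"
    and nonneg: "\<And>k x. 0 \<le> \<phi> k x" and le1: "\<And>k x. \<phi> k x \<le> 1" and one: "\<And>k. \<phi> k p = 1"
    and lip: "\<And>k t x. \<bar>\<phi> k (\<sigma> t x) - \<phi> k x\<bar> \<le> \<bar>t\<bar> / 2 ^ k"
    and sum: "\<And>k x. (\<Sum>j<2 ^ k. \<phi> k (\<sigma> (3 * 2 ^ k * real j) x)) \<le> 1"
    by auto
  define u where "u k x = \<phi> k x - \<phi> k (\<sigma> 1 x)" for k x
  define a where "a x = (\<Sum>k. u k x)" for x
  have u_cont: "continuous_on UNIV (u k)" for k
    unfolding u_def by (intro continuous_intros cont)
  have u_bound: "\<bar>u k x\<bar> \<le> (1/2) ^ k" for k x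
    using lip[of k 1 x] by (simp add: u_def abs_minus_commute power_one_over)
  have geom: "summable (\<lambda>k. (1/2 :: real) ^ k)" by (rule summable_geometric) simp
  have "uniform_limit UNIV (\<lambda>n x. \<Sum>k<n. u k x) (\<lambda>x. \<Sum>k. u k x) sequentially"
    by (rule Weierstrass_m_test[OF _ geom]) (simp add: u_bound)
  then have a_cont: "continuous_on UNIV a"
    unfolding a_def[abs_def]
    by (intro uniform_limit_theorem) (auto intro!: always_eventually continuous_on_sum u_cont)
  have tail: "\<bar>a x - (\<Sum>k<n. u k x)\<bar> \<le> 2 / 2 ^ n" for n x
  proof -
    have su: "summable (\<lambda>k. u k x)"
      by (rule summable_comparison_test[OF _ geom]) (use u_bound in auto)
    have sg: "summable (\<lambda>k. (1/2 :: real) ^ (k + n))"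
      using summable_iff_shift[of "\<lambda>k. (1/2 :: real) ^ k" n] geom by simp
    have "a x - (\<Sum>k<n. u k x) = (\<Sum>k. u (k + n) x)"
      using suminf_split_initial_segment[OF su, of n] by (simp add: a_def)
    also have "\<bar>\<dots>\<bar> \<le> (\<Sum>k. (1/2 :: real) ^ (k + n))"
      using norm_suminf_le[of "\<lambda>k. u (k + n) x", OF _ sg] u_bound by simp
    also have "\<dots> = 2 / 2 ^ n"
      using suminf_mult2[OF geom, of "(1/2) ^ n"] suminf_geometric[of "1/2 :: real"]
      by (simp add: power_add power_one_over)
    finally show ?thesis .
  qed
  define D where "D k x t = orbit_integral \<sigma> (u k) x t" for k x t
  define A where "A x t = orbit_integral \<sigma> a x t" for x t
  \<comment> \<open>The orbit segments of length \<open>t\<close> from \<open>x\<close> and from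
    \<open>\<sigma> 1 x\<close> differ by one unit window at each end; the cocycle identity cancels
    the rest.\<close>
  have D_eq: "D k x t = orbit_integral \<sigma> (\<phi> k) x 1 - orbit_integral \<sigma> (\<phi> k) (\<sigma> t x) 1" for k x t
  proof -
    have "D k x t = orbit_integral \<sigma> (\<phi> k) x t - orbit_integral \<sigma> (\<phi> k) (\<sigma> 1 x) t"
      unfolding D_def u_def
      by (subst orbit_integral_diff) (auto intro!: cont continuous_intros simp: orbit_integral_comp_flow[OF cont])
    then show ?thesis
      using orbit_integral_cocycle[OF cont, of k x 1 t] orbit_integral_cocycle[OF cont, of k x t 1]
      by (simp add: add.commute)
  qed
  \<comment> \<open>A unit-window average is a value taken within unit time of \<open>x\<close>, so
    slow variation bounds the error, summably in \<open>k\<close>.\<close>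
  have avg: "\<bar>orbit_integral \<sigma> (\<phi> k) x 1 - \<phi> k x\<bar> \<le> 1 / 2 ^ k" for k x
  proof -
    obtain s where "\<bar>s\<bar> \<le> 1" "orbit_integral \<sigma> (\<phi> k) x 1 = \<phi> k (\<sigma> s x)"
      using orbit_integral_mean_value[OF cont, of 1 k x] by auto
    then show ?thesis using lip[of k s x] divide_right_mono[of "\<bar>s\<bar>" 1 "2 ^ k"] by simp
  qed
  have D_near: "\<bar>D k x t - (\<phi> k x - \<phi> k (\<sigma> t x))\<bar> \<le> 2 * (1/2) ^ k" for k x t
    using avg[of k x] avg[of k "\<sigma> t x"] unfolding D_eq by (simp add: power_one_over abs_le_iff)
  have D_bound: "\<bar>D k x t\<bar> \<le> 2" for k x t
    using abs_orbit_integral_le[OF cont, of k 1 x 1] abs_orbit_integral_le[OF cont, of k 1 "\<sigma> t x" 1]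
      nonneg[of k] le1[of k] unfolding D_eq by simp
  have A_near: "\<bar>A x t - (\<Sum>k<n. D k x t)\<bar> \<le> 2 / 2 ^ n * \<bar>t\<bar>" for n x t
  proof -
    have "A x t - (\<Sum>k<n. D k x t) = orbit_integral \<sigma> (\<lambda>x. a x - (\<Sum>k<n. u k x)) x t"
      unfolding A_def D_def
      by (simp add: orbit_integral_diff orbit_integral_sum a_cont u_cont continuous_on_sum)
    then show ?thesis
      using abs_orbit_integral_le[of "\<lambda>x. a x - (\<Sum>k<n. u k x)" "2 / 2 ^ n" x t] tail
      by (simp add: a_cont u_cont continuous_on_sum continuous_on_diff)
  qed
  have pow0: "(\<lambda>n. 2 / 2 ^ n * c) \<longlonglongrightarrow> (0 :: real)" for c
    using tendsto_mult_right_zero[OF LIMSEQ_realpow_zero[of "1/2 :: real"], of "2 * c"]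
    by (simp add: power_one_over field_simps)
  have A_lim: "(\<lambda>n. \<Sum>k<n. D k x t) \<longlonglongrightarrow> A x t" for x t
  proof (rule LIM_zero_cancel, rule Lim_null_comparison)
    show "\<forall>\<^sub>F n in sequentially. norm ((\<Sum>k<n. D k x t) - A x t) \<le> 2 / 2 ^ n * \<bar>t\<bar>"
      using A_near[of x t] by (simp add: abs_minus_commute)
  qed (rule pow0)
  \<comment> \<open>Each \<open>D k\<close> is bounded by 2 for all times, so the first
    \<open>n\<close> terms cost a constant \<open>2 * n\<close>; the rest has slope
    \<open>2 / 2 ^ n\<close>, taken below \<open>e\<close>.\<close>
  have "sacker_sell_spectrum \<sigma> a = {0}"
  proof (rule sacker_sell_spectrum_eq_zero[OF a_cont])
    fix e :: real assume "e > 0"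
    then obtain n where n: "2 / 2 ^ n * 1 < e"
      using order_tendstoD(2)[OF pow0[of 1]] eventually_sequentially by (meson order_refl)
    have "\<bar>A x t\<bar> \<le> 2 * real n + e * \<bar>t\<bar>" for x t
    proof -
      have "\<bar>\<Sum>k<n. D k x t\<bar> \<le> (\<Sum>k<n. 2)"
        by (rule order_trans[OF sum_abs sum_mono]) (rule D_bound)
      moreover have "2 / 2 ^ n * \<bar>t\<bar> \<le> e * \<bar>t\<bar>" using n by (intro mult_right_mono) auto
      ultimately show ?thesis using A_near[of x t n] by simp
    qed
    then show "\<exists>C. \<forall>x t. \<bar>orbit_integral \<sigma> a x t\<bar> \<le> C + e * \<bar>t\<bar>" unfolding A_def by blast
  qed
  \<comment> \<open>The 4 is the sum of the errors \<open>2 * (1/2) ^ k\<close> from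
    \<open>D_near\<close>.\<close>
  have sum_D: "(\<Sum>k<n. D k x t) \<le> (\<Sum>k. \<phi> k x) + 4 - (\<Sum>k<n. \<phi> k (\<sigma> t x))"
    if "summable (\<lambda>k. \<phi> k x)" for x t n
  proof -
    have "(\<Sum>k<n. D k x t) \<le> (\<Sum>k<n. \<phi> k x - \<phi> k (\<sigma> t x) + 2 * (1/2) ^ k)"
    proof (rule sum_mono)
      show "D k x t \<le> \<phi> k x - \<phi> k (\<sigma> t x) + 2 * (1/2) ^ k" for k
        using D_near[of k x t] by linarith
    qed
    also have "\<dots> = (\<Sum>k<n. \<phi> k x) - (\<Sum>k<n. \<phi> k (\<sigma> t x)) + 2 * (\<Sum>k<n. (1/2) ^ k)"
      by (simp add: sum.distrib sum_subtractf sum_distrib_left)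
    also have "\<dots> \<le> (\<Sum>k. \<phi> k x) - (\<Sum>k<n. \<phi> k (\<sigma> t x)) + 2 * 2"
      using sum_le_suminf[OF that, of "{..<n}"] sum_le_suminf[OF geom, of "{..<n}"]
        suminf_geometric[of "1/2 :: real"] nonneg by simp
    finally show ?thesis by simp
  qed
  \<comment> \<open>The number \<open>n\<close> of endpoint terms stays free: \<open>n = 0\<close>
    bounds the orbit integrals, and arbitrary \<open>n\<close> is needed against a
    primitive.\<close>
  have A_upper: "A x t \<le> (\<Sum>k. \<phi> k x) + 4 - (\<Sum>k<n. \<phi> k (\<sigma> t x))"
    if "summable (\<lambda>k. \<phi> k x)" for x t n
  proof (rule LIMSEQ_le_const2[OF A_lim], intro exI[of _ n] allI impI)
    fix j assume "n \<le> j"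
    then have "(\<Sum>k<n. \<phi> k (\<sigma> t x)) \<le> (\<Sum>k<j. \<phi> k (\<sigma> t x))"
      by (intro sum_mono2) (auto intro: nonneg)
    then show "(\<Sum>k<j. D k x t) \<le> (\<Sum>k. \<phi> k x) + 4 - (\<Sum>k<n. \<phi> k (\<sigma> t x))"
      using sum_D[OF that, of t j] by linarith
  qed
  have no_primitive: "\<not> has_continuous_primitive \<sigma> a" if x: "summable (\<lambda>k. \<phi> k x)" for x
  proof
    assume "has_continuous_primitive \<sigma> a"
    then obtain h where h: "continuous_on UNIV h" "\<And>x t. h (\<sigma> t x) - h x = A x t"
      unfolding has_continuous_primitive_def A_def by blast
    obtain C where C: "\<And>x. \<bar>h x\<bar> \<le> C" using bounded_continuous[OF h(1)] by metis
    define c where "c = (\<Sum>k. \<phi> k x) + 4 + 2 * C"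
    have orbit: "(\<Sum>k<n. \<phi> k (\<sigma> t x)) \<le> c" for n t
      using A_upper[OF x, of t n] h(2)[of t x] C[of x] C[of "\<sigma> t x"] unfolding c_def by linarith
    \<comment> \<open>Each finite sum is continuous, so its bound on the dense orbit of
      \<open>x\<close> reaches \<open>p\<close>, where the sum is \<open>n\<close>.\<close>
    have "(\<Sum>k<n. \<phi> k p) \<le> c" for n
    proof (rule continuous_le_on_closure[where S = "range (\<lambda>t. \<sigma> t x)" and f = "\<lambda>y. \<Sum>k<n. \<phi> k y"])
      show "continuous_on (closure (range (\<lambda>t. \<sigma> t x))) (\<lambda>y. \<Sum>k<n. \<phi> k y)"
        unfolding orbit_dense by (intro continuous_on_sum cont)
    qed (auto simp: orbit_dense orbit)
    then have "real n \<le> c" for n by (simp add: one)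
    then show False using reals_Archimedean2[of c] by (meson not_le)
  qed
  have "a \<in> R_set \<sigma> m" if m: "m \<in> inv_measures \<sigma>" for m
  proof -
    interpret prob_space m using m by (rule inv_measures_prob_space)
    have [measurable]: "\<phi> k \<in> borel_measurable m" for k
      by (rule continuous_on_borel_measurable[OF inv_measures_sets[OF m] cont])
    have int: "(\<integral>\<^sup>+x. \<phi> k x \<partial>m) \<le> ennreal ((1/2) ^ k)" for k
      using integral_slow_bump[OF m cont[of k] sum[of k]]
        nn_integral_eq_integral[OF integrable_continuous[OF m cont[of k]]] nonneg[of k]
      by (simp add: power_one_over ennreal_leI)
    have "(\<integral>\<^sup>+x. (\<Sum>k. ennreal (\<phi> k x)) \<partial>m) = (\<Sum>k. \<integral>\<^sup>+x. \<phi> k x \<partial>m)"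
      by (rule nn_integral_suminf) measurable
    also have "\<dots> \<le> (\<Sum>k. ennreal ((1/2) ^ k))"
      by (intro suminf_le int) auto
    also have "\<dots> < \<infinity>"
      by (subst suminf_ennreal2[OF _ geom]) auto
    finally have "(\<integral>\<^sup>+x. (\<Sum>k. ennreal (\<phi> k x)) \<partial>m) \<noteq> \<infinity>" by simp
    then have "AE x in m. (\<Sum>k. ennreal (\<phi> k x)) \<noteq> \<infinity>"
      by (intro nn_integral_noteq_infinite) measurable
    then have AE: "AE x in m. summable (\<lambda>k. \<phi> k x)"
      by eventually_elim (use nonneg in \<open>auto intro: summable_suminf_not_top\<close>)
    \<comment> \<open>A set of full measure is nonempty, and one point with a finite sum suffices,
      since having a primitive does not involve the measure.\<close>
    then obtain x where "summable (\<lambda>k. \<phi> k x)"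
      using AE_False eventually_mono[OF AE, of "\<lambda>_. False"] by auto
    then have "\<not> has_continuous_primitive \<sigma> a" by (rule no_primitive)
    moreover have "AE x in m. bdd_above ((\<lambda>t. orbit_integral \<sigma> a x t) ` {..0})"
      using AE
    proof eventually_elim
      case (elim x)
      then show ?case
        using A_upper[OF elim, of _ 0] unfolding A_def
        by (intro bdd_aboveI[of _ "(\<Sum>k. \<phi> k x) + 4"]) auto
    qed
    moreover have "(\<integral>x. a x \<partial>m) = 0"
    proof -
      \<comment> \<open>Coboundaries have mean zero, and their partial sums converge uniformly to
        \<open>a\<close>.\<close>
      have "(\<integral>x. u k x \<partial>m) = 0" for k
        unfolding u_def
        using integral_comp_flow[OF m borel_measurable_continuous_onI[OF cont], of k 1]
        by (subst Bochner_Integration.integral_diff)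
          (auto intro!: integrable_continuous[OF m] continuous_intros cont)
      then have zero: "(\<integral>x. (\<Sum>k<n. u k x) \<partial>m) = 0" for n
        by (subst Bochner_Integration.integral_sum) (auto intro!: integrable_continuous[OF m] u_cont)
      have "\<bar>\<integral>x. a x \<partial>m\<bar> \<le> 2 / 2 ^ n * 1" for n
      proof -
        have "(\<integral>x. a x \<partial>m) = (\<integral>x. a x - (\<Sum>k<n. u k x) \<partial>m)"
          by (subst Bochner_Integration.integral_diff)
            (auto intro!: integrable_continuous[OF m] a_cont u_cont continuous_on_sum simp: zero)
        also have "\<bar>\<dots>\<bar> \<le> (\<integral>x. \<bar>a x - (\<Sum>k<n. u k x)\<bar> \<partial>m)"
          by (rule integral_abs_bound)
        also have "\<dots> \<le> (\<integral>x. 2 / 2 ^ n \<partial>m)"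
          by (intro integral_mono tail integrable_continuous[OF m] continuous_intros a_cont u_cont
              continuous_on_sum) auto
        finally show ?thesis by (simp add: prob_space)
      qed
      then have "\<bar>\<integral>x. a x \<partial>m\<bar> \<le> 0"
        by (intro LIMSEQ_le_const[OF pow0[of 1]]) auto
      then show ?thesis by simp
    qed
    ultimately show ?thesis using a_cont by (simp add: R_set_def)
  qed
  with \<open>sacker_sell_spectrum \<sigma> a = {0}\<close> show ?thesis by blast
qed

end

section \<open>Birkhoff's ergodic theorem\<close>

primrec birkhoff_sum :: "('a \<Rightarrow> 'a) \<Rightarrow> ('a \<Rightarrow> real) \<Rightarrow> nat \<Rightarrow> 'a \<Rightarrow> real" where
  "birkhoff_sum T f 0 x = 0"
| "birkhoff_sum T f (Suc n) x = f x + birkhoff_sum T f n (T x)"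

text \<open>The maximum of the Birkhoff sums of orders \<open>0\<close> to \<open>n\<close>, in the
  recursive form on which Garsia's argument rests.\<close>

primrec birkhoff_max :: "('a \<Rightarrow> 'a) \<Rightarrow> ('a \<Rightarrow> real) \<Rightarrow> nat \<Rightarrow> 'a \<Rightarrow> real" where
  "birkhoff_max T f 0 x = 0"
| "birkhoff_max T f (Suc n) x = max 0 (f x + birkhoff_max T f n (T x))"

lemma birkhoff_max_nonneg: "0 \<le> birkhoff_max T f n x"
  by (cases n) auto

lemma birkhoff_max_Suc: "birkhoff_max T f n x \<le> birkhoff_max T f (Suc n) x"
proof (induction n arbitrary: x)
  case (Suc n)
  from add_left_mono[OF Suc.IH[of "T x"], of "f x"] show ?case
    unfolding birkhoff_max.simps(2)[of T f n] birkhoff_max.simps(2)[of T f "Suc n"]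
    by (rule max.mono[OF order_refl])
qed simp

lemma birkhoff_sum_le_max: "birkhoff_sum T f n x \<le> birkhoff_max T f n x"
proof (induction n arbitrary: x)
  case (Suc n)
  show ?case using Suc.IH[of "T x"] by (simp add: le_max_iff_disj)
qed simp

lemma birkhoff_sum_uminus: "birkhoff_sum T (\<lambda>x. - f x) n x = - birkhoff_sum T f n x"
  by (induction n arbitrary: x) auto

lemma abs_birkhoff_sum_le:
  assumes "\<And>x. \<bar>f x\<bar> \<le> B"
  shows "\<bar>birkhoff_sum T f n x\<bar> \<le> real n * B"
proof (induction n arbitrary: x)
  case (Suc n)
  show ?case
    using Suc.IH[of "T x"] assms[of x] unfolding birkhoff_sum.simps of_nat_Suc distrib_right by linarith
qed simp

locale measure_preserving = prob_space +
  fixes T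
  assumes T_measurable [measurable]: "T \<in> M \<rightarrow>\<^sub>M M"
    and T_preserves: "distr M M T = M"
begin

lemma integrable_comp:
  fixes f :: "'a \<Rightarrow> real"
  assumes "integrable M f"
  shows "integrable M (\<lambda>x. f (T x))"
  using integrable_distr[OF T_measurable, of f] assms by (simp add: T_preserves)

lemma integral_comp:
  fixes f :: "'a \<Rightarrow> real"
  assumes "f \<in> borel_measurable M"
  shows "(\<integral>x. f (T x) \<partial>M) = (\<integral>x. f x \<partial>M)"
  using integral_distr[OF T_measurable assms] by (simp add: T_preserves)

lemma birkhoff_sum_measurable [measurable]:
  assumes "f \<in> borel_measurable M"
  shows "birkhoff_sum T f n \<in> borel_measurable M"
proof (induction n)
  case (Suc n)
  then show ?case
    using assms unfolding birkhoff_sum.simps by measurable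
qed simp

lemma birkhoff_max_integrable:
  assumes "integrable M f"
  shows "integrable M (birkhoff_max T f n)"
proof (induction n)
  case (Suc n)
  show ?case
    unfolding birkhoff_max.simps
    by (rule integrable_max[OF _ Bochner_Integration.integrable_add[OF assms integrable_comp[OF Suc]]]) simp
qed simp

text \<open>Garsia's argument: where \<open>birkhoff_max T f (Suc n)\<close> is positive it is at most
  \<open>f x + birkhoff_max T f (Suc n) (T x)\<close>, and the two maximal functions have the same integral.\<close>

lemma maximal_ergodic:
  assumes f: "integrable M f"
  shows "0 \<le> (\<integral>x. indicator {x. \<exists>n. birkhoff_max T f n x > 0} x * f x \<partial>M)"
proof -
  let ?P = "birkhoff_max T f"
  have [measurable]: "f \<in> borel_measurable M" "?P n \<in> borel_measurable M" for n
    using f birkhoff_max_integrable[OF f] by (auto simp: borel_measurable_integrable)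
  have pred: "Measurable.pred M (\<lambda>x. ?P n x > 0)" for n by measurable
  have ind: "(\<lambda>x. indicator {x. Q x} x * f x) \<in> borel_measurable M" if [measurable]: "Measurable.pred M Q" for Q
  proof -
    have "(\<lambda>x. indicator {x. Q x} x * f x) = (\<lambda>x. if Q x then f x else 0)" by auto
    then show ?thesis by simp
  qed
  have int: "integrable M (\<lambda>x. indicator {x. ?P (Suc n) x > 0} x * f x)" for n
    by (rule Bochner_Integration.integrable_bound[OF f ind[OF pred]]) (simp add: indicator_def)
  note P_int = birkhoff_max_integrable[OF f]
  \<comment> \<open>Stated for \<open>Suc n\<close> so that the recursion of
    \<open>birkhoff_max\<close> unfolds once.\<close>
  have nonneg: "0 \<le> (\<integral>x. indicator {x. ?P (Suc n) x > 0} x * f x \<partial>M)" for n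
  proof -
    have "0 = (\<integral>x. ?P (Suc n) x - ?P (Suc n) (T x) \<partial>M)"
      unfolding Bochner_Integration.integral_diff[OF P_int integrable_comp[OF P_int]]
      by (simp add: integral_comp del: birkhoff_max.simps)
    also have "\<dots> \<le> (\<integral>x. indicator {x. ?P (Suc n) x > 0} x * f x \<partial>M)"
    proof (rule integral_mono[OF _ int])
      show "integrable M (\<lambda>x. ?P (Suc n) x - ?P (Suc n) (T x))"
        by (rule Bochner_Integration.integrable_diff[OF P_int integrable_comp[OF P_int]])
      fix x
      show "?P (Suc n) x - ?P (Suc n) (T x) \<le> indicator {x. ?P (Suc n) x > 0} x * f x"
      proof (cases "?P (Suc n) x > 0")
        case True
        \<comment> \<open>Being positive, the maximum is its second argument; monotonicity in
          \<open>n\<close> at \<open>T x\<close> does the rest.\<close>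
        then have "?P (Suc n) x = f x + ?P n (T x)" by auto
        with True show ?thesis
          using birkhoff_max_Suc[of T f n "T x"] by (simp del: birkhoff_max.simps)
      next
        case False
        then show ?thesis
          using birkhoff_max_nonneg[of T f "Suc n" "T x"] by (simp del: birkhoff_max.simps)
      qed
    qed
    finally show ?thesis .
  qed
  have lim: "(\<lambda>n. \<integral>x. indicator {x. ?P (Suc n) x > 0} x * f x \<partial>M)
      \<longlonglongrightarrow> (\<integral>x. indicator {x. \<exists>n. ?P n x > 0} x * f x \<partial>M)"
  proof (rule integral_dominated_convergence[where w = "\<lambda>x. \<bar>f x\<bar>"])
    show "AE x in M. (\<lambda>n. indicator {x. ?P (Suc n) x > 0} x * f x)
        \<longlonglongrightarrow> indicator {x. \<exists>n. ?P n x > 0} x * f x"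
    proof (rule AE_I2, rule tendsto_eventually)
      fix x
      have mono: "?P m x \<le> ?P n x" if "m \<le> n" for m n
        using lift_Suc_mono_le[of "\<lambda>n. ?P n x", OF birkhoff_max_Suc that] .
      show "\<forall>\<^sub>F n in sequentially. indicator {x. ?P (Suc n) x > 0} x * f x
          = indicator {x. \<exists>n. ?P n x > 0} x * f x"
      proof (cases "\<exists>m. ?P m x > 0")
        case True
        then obtain m where m: "?P m x > 0" by blast
        have "?P (Suc n) x > 0" if "m \<le> n" for n
          using mono[of m "Suc n"] m that by simp
        then show ?thesis
          using True by (intro eventually_sequentiallyI[of m]) (simp del: birkhoff_max.simps)
      next
        case False
        then show ?thesis by (simp del: birkhoff_max.simps)
      qed
    qed
    show "AE x in M. norm (indicator {x. ?P (Suc n) x > 0} x * f x) \<le> \<bar>f x\<bar>" for n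
      by (rule AE_I2) (simp del: birkhoff_max.simps add: indicator_def)
    show "(\<lambda>x. indicator {x. \<exists>n. ?P n x > 0} x * f x) \<in> borel_measurable M"
      by (intro ind pred_intros_countable) (rule pred)
  qed (use f in \<open>auto intro!: ind pred simp del: birkhoff_max.simps\<close>)
  show ?thesis
    by (rule LIMSEQ_le_const[OF lim]) (use nonneg in blast)
qed

text \<open>The maximal inequality for \<open>g x = indicator E x * (f x - b)\<close>: on the
  invariant set \<open>E\<close> its Birkhoff sums are those of \<open>f\<close> minus
  \<open>n * b\<close>, so \<open>large\<close> makes one of them positive at each point of
  \<open>E\<close>.\<close>

lemma birkhoff_sum_invariant_bound:
  assumes f: "integrable M f" and E: "E \<in> sets M"
    and inv: "\<And>x. x \<in> E \<Longrightarrow> T x \<in> E"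
    and large: "\<And>x. x \<in> E \<Longrightarrow> \<exists>n. birkhoff_sum T f n x > real n * b"
  shows "b * prob E \<le> (\<integral>x. indicator E x * f x \<partial>M)"
proof -
  define g where "g x = indicator E x * (f x - b)" for x
  have fE: "integrable M (\<lambda>x. indicator E x * f x)"
    using integrable_mult_indicator[OF E f] by simp
  have bE: "integrable M (\<lambda>x. indicator E x * b)"
    using integrable_mult_indicator[OF E, of "\<lambda>_. b"] by simp
  have g: "integrable M g"
    using Bochner_Integration.integrable_diff[OF fE bE] unfolding g_def right_diff_distrib .
  have sum: "birkhoff_sum T g n x = birkhoff_sum T f n x - real n * b" if "x \<in> E" for n x
    using that by (induction n arbitrary: x) (auto simp: g_def inv algebra_simps)
  have "\<exists>n. birkhoff_max T g n x > 0" if "x \<in> E" for x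
    using large[OF that] sum[OF that] birkhoff_sum_le_max[of T g _ x]
    by (metis diff_gt_0_iff_gt less_le_trans)
  \<comment> \<open>An orbit starting outside \<open>E\<close> may enter it and make the maximum
    positive, but at such a starting point \<open>g x\<close> itself is 0.\<close>
  then have "indicator {x. \<exists>n. birkhoff_max T g n x > 0} x * g x = g x" for x
    by (auto simp: g_def indicator_def)
  then have "0 \<le> (\<integral>x. g x \<partial>M)" using maximal_ergodic[OF g] by (simp only:)
  also have "\<dots> = (\<integral>x. indicator E x * f x \<partial>M) - b * prob E"
    unfolding g_def right_diff_distrib using E
    by (subst Bochner_Integration.integral_diff[OF fE bE]) (simp add: mult.commute)
  finally show ?thesis by simp
qed

text \<open>The difference is \<open>(birkhoff_sum T f n (T x) / n - f x) / (n + 1)\<close>, with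
  bounded numerator. It makes the upper and lower limits of the averages
  \<open>T\<close>-invariant.\<close>

lemma birkhoff_average_shift:
  assumes B: "\<And>x. \<bar>f x\<bar> \<le> B"
  shows "(\<lambda>n. birkhoff_sum T f n (T x) / real n - birkhoff_sum T f (Suc n) x / real (Suc n)) \<longlonglongrightarrow> 0"
proof (rule Lim_null_comparison)
  have B0: "B \<ge> 0" using B[of x] by simp
  show "\<forall>\<^sub>F n in sequentially. norm (birkhoff_sum T f n (T x) / real n
      - birkhoff_sum T f (Suc n) x / real (Suc n)) \<le> 2 * B / real (Suc n)"
  proof (rule eventually_sequentiallyI[of 1])
    fix n :: nat assume "1 \<le> n"
    let ?s = "birkhoff_sum T f n (T x)"
    have "?s / real n - birkhoff_sum T f (Suc n) x / real (Suc n)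
        = (?s / real n - f x) / real (Suc n)"
      using \<open>1 \<le> n\<close> by (simp add: field_simps)
    moreover have "\<bar>?s / real n\<bar> \<le> B"
      using abs_birkhoff_sum_le[of f B T n "T x", OF B] \<open>1 \<le> n\<close> by (simp add: field_simps)
    then have "\<bar>?s / real n - f x\<bar> \<le> 2 * B" using B[of x] by linarith
    ultimately show "norm (?s / real n - birkhoff_sum T f (Suc n) x / real (Suc n)) \<le> 2 * B / real (Suc n)"
      by (simp add: divide_right_mono del: of_nat_Suc)
  qed
  show "(\<lambda>n. 2 * B / real (Suc n)) \<longlonglongrightarrow> 0"
    by (intro LIMSEQ_Suc lim_const_over_n)
qed

text \<open>For \<open>a < b\<close> let \<open>E\<close> be the invariant set where the lower limit
  is below \<open>a\<close> and the upper limit above \<open>b\<close>. The previous bound for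
  \<open>f\<close> and for \<open>- f\<close> gives \<open>b * prob E \<le> a * prob E\<close>, so
  \<open>E\<close> is null; rational \<open>a\<close> and \<open>b\<close> exhaust the points where
  the two limits differ.\<close>

theorem birkhoff_ergodic:
  assumes f [measurable]: "f \<in> borel_measurable M" and B: "\<And>x. \<bar>f x\<bar> \<le> B"
  shows "AE x in M. convergent (\<lambda>n. birkhoff_sum T f n x / real n)"
proof -
  let ?a = "\<lambda>n x. ereal (birkhoff_sum T f n x / real n)"
  define U where "U x = limsup (\<lambda>n. ?a n x)" for x
  define V where "V x = liminf (\<lambda>n. ?a n x)" for x
  have [measurable]: "U \<in> borel_measurable M" "V \<in> borel_measurable M"
    unfolding U_def V_def by measurable
  have int: "integrable M f" by (rule integrable_const_bound[where B = B]) (auto simp: B)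
  have shift: "?a n (T x) = ereal (birkhoff_sum T f n (T x) / real n - birkhoff_sum T f (Suc n) x / real (Suc n))
      + ?a (n + 1) x" for n x
    by (simp del: of_nat_Suc birkhoff_sum.simps)
  have shift0: "(\<lambda>n. ereal (birkhoff_sum T f n (T x) / real n - birkhoff_sum T f (Suc n) x / real (Suc n)))
      \<longlonglongrightarrow> 0" for x
    using birkhoff_average_shift[OF B, where x = x] by (simp add: zero_ereal_def del: birkhoff_sum.simps of_nat_Suc)
  have U_inv: "U (T x) = U x" for x
  proof -
    have "U (T x) = limsup (\<lambda>n. ereal (birkhoff_sum T f n (T x) / real n
        - birkhoff_sum T f (Suc n) x / real (Suc n)) + ?a (n + 1) x)"
      unfolding U_def by (intro arg_cong[where f = limsup] ext shift)
    also have "\<dots> = 0 + limsup (\<lambda>n. ?a (n + 1) x)"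
      by (rule ereal_limsup_lim_add[OF shift0]) simp
    also have "\<dots> = U x"
      unfolding U_def using limsup_shift[of "\<lambda>n. ?a n x"] by simp
    finally show ?thesis .
  qed
  have V_inv: "V (T x) = V x" for x
  proof -
    have "V (T x) = liminf (\<lambda>n. ereal (birkhoff_sum T f n (T x) / real n
        - birkhoff_sum T f (Suc n) x / real (Suc n)) + ?a (n + 1) x)"
      unfolding V_def by (intro arg_cong[where f = liminf] ext shift)
    also have "\<dots> = 0 + liminf (\<lambda>n. ?a (n + 1) x)"
      by (rule ereal_liminf_lim_add[OF shift0]) simp
    also have "\<dots> = V x"
      unfolding V_def using liminf_shift[of "\<lambda>n. ?a n x"] by simp
    finally show ?thesis .
  qed
  have gap: "AE x in M. \<not> (V x < ereal a \<and> ereal b < U x)" if "a < b" for a b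
  proof -
    define E where "E = {x \<in> space M. V x < ereal a \<and> ereal b < U x}"
    have [measurable]: "E \<in> sets M" unfolding E_def by measurable
    have E_inv: "T x \<in> E" if "x \<in> E" for x
      using that measurable_space[OF T_measurable, of x] by (simp add: E_def U_inv V_inv)
    have "b * prob E \<le> (\<integral>x. indicator E x * f x \<partial>M)"
    proof (rule birkhoff_sum_invariant_bound[OF int _ E_inv])
      fix x assume "x \<in> E"
      have "\<exists>n>0. b < birkhoff_sum T f n x / real n"
      proof (rule ccontr)
        assume "\<not> ?thesis"
        then have "\<not> b < birkhoff_sum T f n x / real n" if "n > 0" for n
          using that by blast
        then have "\<forall>\<^sub>F n in sequentially. ?a n x \<le> ereal b"
          by (intro eventually_sequentiallyI[of 1]) (simp add: not_less)
        from Limsup_bounded[OF this] show False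
          using \<open>x \<in> E\<close> by (auto simp: E_def U_def)
      qed
      then show "\<exists>n. birkhoff_sum T f n x > real n * b" by (auto simp: field_simps)
    qed auto
    moreover have "- a * prob E \<le> (\<integral>x. indicator E x * - f x \<partial>M)"
    proof (rule birkhoff_sum_invariant_bound[OF _ _ E_inv])
      fix x assume "x \<in> E"
      have "\<exists>n>0. birkhoff_sum T f n x / real n < a"
      proof (rule ccontr)
        assume "\<not> ?thesis"
        then have "\<not> birkhoff_sum T f n x / real n < a" if "n > 0" for n
          using that by blast
        then have "\<forall>\<^sub>F n in sequentially. ereal a \<le> ?a n x"
          by (intro eventually_sequentiallyI[of 1]) (simp add: not_less)
        from Liminf_bounded[OF this] show False
          using \<open>x \<in> E\<close> by (auto simp: E_def V_def)
      qed
      then show "\<exists>n. birkhoff_sum T (\<lambda>x. - f x) n x > real n * - a"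
        by (auto simp: field_simps birkhoff_sum_uminus)
    qed (use int in auto)
    ultimately have "b * prob E \<le> a * prob E" by simp
    then have "prob E = 0"
      using \<open>a < b\<close> measure_nonneg[of M E] by (metis linorder_not_less mult_strict_right_mono order_le_less)
    then have "E \<in> null_sets M" by (simp add: emeasure_eq_measure null_sets_def)
    then show ?thesis by (rule AE_I') (auto simp: E_def)
  qed
  have "AE x in M. \<forall>a b :: rat. a < b \<longrightarrow> \<not> (V x < ereal (real_of_rat a) \<and> ereal (real_of_rat b) < U x)"
    unfolding AE_all_countable using gap by (auto simp: of_rat_less)
  then show ?thesis
  proof eventually_elim
    case (elim x)
    have "U x \<le> V x"
    proof (rule ccontr)
      assume "\<not> ?thesis"
      then obtain a where a: "V x < ereal (real_of_rat a)" "ereal (real_of_rat a) < U x"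
        using ereal_dense3[of "V x" "U x"] by (auto simp: not_le)
      then obtain b where b: "ereal (real_of_rat a) < ereal (real_of_rat b)" "ereal (real_of_rat b) < U x"
        using ereal_dense3[of "ereal (real_of_rat a)" "U x"] by auto
      then show False using elim a by (auto simp: of_rat_less)
    qed
    moreover have "V x \<le> U x" unfolding U_def V_def by (rule Liminf_le_Limsup) simp
    ultimately have "(\<lambda>n. ?a n x) \<longlonglongrightarrow> U x"
      unfolding U_def V_def by (intro Liminf_eq_Limsup) auto
    moreover have bd: "\<bar>birkhoff_sum T f n x / real n\<bar> \<le> B" for n
      using abs_birkhoff_sum_le[of f B T n x, OF B] B[of x] by (cases "n = 0") (auto simp: field_simps)
    have "\<bar>U x\<bar> \<noteq> \<infinity>"
    proof -
      have "U x \<le> ereal B"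
        using \<open>(\<lambda>n. ?a n x) \<longlonglongrightarrow> U x\<close>
        by (rule LIMSEQ_le_const2) (use bd in \<open>simp only: abs_le_iff ereal_less_eq(3), blast\<close>)
      moreover have "ereal (- B) \<le> U x"
        using \<open>(\<lambda>n. ?a n x) \<longlonglongrightarrow> U x\<close>
        by (rule LIMSEQ_le_const) (use bd in \<open>simp only: abs_le_iff ereal_less_eq(3) minus_le_iff[of B], blast\<close>)
      ultimately show ?thesis by auto
    qed
    then obtain L where "U x = ereal L" by auto
    ultimately show ?case by (auto simp: convergent_def)
  qed
qed

end

section \<open>Riesz representation on a compact metric space\<close>

text \<open>A Urysohn function decreasing to the indicator of a closed \<open>C\<close>. Since
  \<open>infdist x {} = 0\<close>, it is constantly 1 for empty \<open>C\<close>, which is why that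
  case is always treated apart.\<close>

definition closed_bump :: "'a::metric_space set \<Rightarrow> nat \<Rightarrow> 'a \<Rightarrow> real" where
  "closed_bump C k x = max 0 (1 - real k * infdist x C)"

lemma continuous_on_closed_bump: "continuous_on UNIV (closed_bump C k)"
  unfolding closed_bump_def by (intro continuous_intros)

lemma closed_bump_bounds: "0 \<le> closed_bump C k x" "closed_bump C k x \<le> 1"
  using infdist_nonneg[of x C] by (auto simp: closed_bump_def)

lemma closed_bump_Suc_le: "closed_bump C (Suc k) x \<le> closed_bump C k x"
  using infdist_nonneg[of x C] by (simp add: closed_bump_def max.coboundedI2 distrib_right)

lemma closed_bump_eq_1: "x \<in> C \<Longrightarrow> closed_bump C k x = 1"
  by (simp add: closed_bump_def)

lemma closed_bump_LIMSEQ: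
  assumes "closed C" and "C \<noteq> {}"
  shows "(\<lambda>k. closed_bump C k x) \<longlonglongrightarrow> indicator C x"
proof (cases "x \<in> C")
  case False
  then have pos: "infdist x C > 0"
    using assms in_closed_iff_infdist_zero[of C x] infdist_nonneg[of x C] by fastforce
  obtain k0 where k0: "1 / infdist x C < real k0" using reals_Archimedean2 by blast
  have "closed_bump C k x = indicator C x" if "k0 \<le> k" for k
  proof -
    have "1 / infdist x C < real k" using k0 that by simp
    then have "1 < real k * infdist x C" using pos by (simp add: field_simps)
    then show ?thesis using False by (simp add: closed_bump_def)
  qed
  then show ?thesis by (intro tendsto_eventually eventually_sequentiallyI[of k0]) simp
qed (simp add: closed_bump_eq_1)

text \<open>\<open>L\<close> is constrained on continuous functions only and arbitrary elsewhere,
  hence the continuity premises throughout.\<close>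

locale normalized_positive_functional =
  fixes L :: "('a::metric_space \<Rightarrow> real) \<Rightarrow> real"
  assumes compact_UNIV: "compact (UNIV :: 'a set)"
    and L_add: "\<lbrakk>continuous_on UNIV f; continuous_on UNIV g\<rbrakk> \<Longrightarrow> L (\<lambda>x. f x + g x) = L f + L g"
    and L_cmult: "continuous_on UNIV f \<Longrightarrow> L (\<lambda>x. c * f x) = c * L f"
    and L_nonneg: "\<lbrakk>continuous_on UNIV f; \<And>x. 0 \<le> f x\<rbrakk> \<Longrightarrow> 0 \<le> L f"
    and L_one: "L (\<lambda>_. 1) = 1"
begin

lemma L_const [simp]: "L (\<lambda>_. c) = c"
  using L_cmult[of "\<lambda>_. 1" c] L_one by simp

lemma L_diff: "\<lbrakk>continuous_on UNIV f; continuous_on UNIV g\<rbrakk> \<Longrightarrow> L (\<lambda>x. f x - g x) = L f - L g"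
  using L_add[of f "\<lambda>x. - 1 * g x"] L_cmult[of g "- 1"] by (simp add: continuous_on_minus)

lemma L_mono: "\<lbrakk>continuous_on UNIV f; continuous_on UNIV g; \<And>x. f x \<le> g x\<rbrakk> \<Longrightarrow> L f \<le> L g"
  using L_nonneg[of "\<lambda>x. g x - f x"] L_diff[of g f] by (simp add: continuous_on_diff)

lemma L_sum:
  assumes "\<And>i. i \<in> I \<Longrightarrow> continuous_on UNIV (f i)" and "finite I"
  shows "L (\<lambda>x. \<Sum>i\<in>I. f i x) = (\<Sum>i\<in>I. L (f i))"
  using assms(2,1) by (induction I) (simp_all add: L_add continuous_on_sum)

text \<open>Families of functions take the place of open covers: a double series merges countably
  many covers into one, and a cover may be multiplied by Urysohn functions, as splitting along a
  closed set requires.\<close>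

definition cover :: "'a set \<Rightarrow> (nat \<Rightarrow> 'a \<Rightarrow> real) \<Rightarrow> bool" where
  "cover A F \<longleftrightarrow> (\<forall>n. continuous_on UNIV (F n)) \<and> (\<forall>n x. 0 \<le> F n x) \<and>
     (\<forall>x\<in>A. 1 \<le> (\<Sum>n. ennreal (F n x)))"

definition mass :: "(nat \<Rightarrow> 'a \<Rightarrow> real) \<Rightarrow> ennreal" where
  "mass F = (\<Sum>n. ennreal (L (F n)))"

text \<open>An outer measure in the style of Daniell, to which Caratheodory's construction is
  applied.\<close>

definition outer :: "'a set \<Rightarrow> ennreal" where
  "outer A = (INF F\<in>Collect (cover A). mass F)"

lemma outer_le: "cover A F \<Longrightarrow> outer A \<le> mass F"
  unfolding outer_def by (rule INF_lower) simp

lemma suminf_ennreal_single: "(\<Sum>n. if n = 0 then c else 0) = (c :: ennreal)"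
  using suminf_finite[of "{0}" "\<lambda>n :: nat. if n = 0 then c else 0"] by simp

lemma outer_le_single:
  assumes "continuous_on UNIV f" and "\<And>x. 0 \<le> f x" and "\<And>x. x \<in> A \<Longrightarrow> 1 \<le> f x"
  shows "outer A \<le> ennreal (L f)"
proof -
  define F where "F n = (if n = 0 then f else (\<lambda>_. 0))" for n :: nat
  have F: "ennreal (F n x) = (if n = 0 then ennreal (f x) else 0)"
    and LF: "ennreal (L (F n)) = (if n = 0 then ennreal (L f) else 0)" for n x
    by (simp_all add: F_def)
  have "cover A F"
    unfolding cover_def F suminf_ennreal_single using assms by (auto simp: F_def)
  from outer_le[OF this] show ?thesis unfolding mass_def LF suminf_ennreal_single .
qed

lemma outer_le_one: "outer A \<le> 1"
  using outer_le_single[of "\<lambda>_. 1" A] by simp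

lemma outer_empty: "outer {} = 0"
  using outer_le_single[of "\<lambda>_. 0" "{}"] by simp

lemma outer_mono: "A \<subseteq> B \<Longrightarrow> outer A \<le> outer B"
  unfolding outer_def by (rule INF_superset_mono) (unfold cover_def, blast, simp)

lemma outer_approx:
  assumes "e > 0"
  obtains F where "cover A F" and "mass F \<le> outer A + ennreal e"
proof -
  have "outer A < outer A + ennreal e"
    using assms le_less_trans[OF outer_le_one[of A] ennreal_one_less_top]
    by (simp add: ennreal_add_left_cancel_less[of "outer A" 0, simplified])
  then have "(INF F\<in>Collect (cover A). mass F) < outer A + ennreal e"
    by (simp add: outer_def)
  then show ?thesis unfolding INF_less_iff using that by (auto intro: less_imp_le)
qed

lemma suminf_geometric_ennreal:
  assumes "e \<ge> 0"
  shows "(\<Sum>n. ennreal (e * (1/2) ^ Suc n)) = ennreal e"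
proof (rule suminf_ennreal_eq)
  show "(\<lambda>n. e * (1/2) ^ Suc n) sums e"
    using sums_mult[OF power_half_series, of e] by simp
qed (use assms in simp)

text \<open>Covers of the \<open>A n\<close> that are optimal up to \<open>e / 2 ^ (n + 1)\<close>
  are merged into one sequence by \<open>prod_decode\<close>.\<close>

lemma outer_countably_subadditive: "outer (\<Union>n. A n) \<le> (\<Sum>n. outer (A n))"
proof (rule ennreal_le_epsilon)
  fix e :: real assume "e > 0"
  have "\<forall>n. \<exists>F. cover (A n) F \<and> mass F \<le> outer (A n) + ennreal (e * (1/2) ^ Suc n)"
  proof
    fix n
    show "\<exists>F. cover (A n) F \<and> mass F \<le> outer (A n) + ennreal (e * (1/2) ^ Suc n)"
      by (rule outer_approx[of "e * (1/2) ^ Suc n" "A n"]) (use \<open>e > 0\<close> in auto)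
  qed
  from choice[OF this] obtain F where F: "\<And>n. cover (A n) (F n)"
    and mF: "\<And>n. mass (F n) \<le> outer (A n) + ennreal (e * (1/2) ^ Suc n)" by blast
  define G where "G k = (case prod_decode k of (n, j) \<Rightarrow> F n j)" for k
  have sum_G: "(\<Sum>k. ennreal (G k x)) = (\<Sum>n. \<Sum>j. ennreal (F n j x))" for x
    using suminf_ennreal_2dimen[of "\<lambda>n. \<Sum>j. ennreal (F n j x)" "\<lambda>(n, j). ennreal (F n j x)"]
    by (simp add: G_def case_prod_unfold)
  have mass_G: "mass G = (\<Sum>n. mass (F n))"
    using suminf_ennreal_2dimen[of "\<lambda>n. mass (F n)" "\<lambda>(n, j). ennreal (L (F n j))"]
    by (simp add: G_def mass_def case_prod_unfold)
  have "cover (\<Union>n. A n) G"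
    unfolding cover_def
  proof (intro conjI ballI)
    fix x assume "x \<in> (\<Union>n. A n)"
    then obtain n where "x \<in> A n" by blast
    then have "1 \<le> (\<Sum>j. ennreal (F n j x))" using F[of n] by (simp add: cover_def)
    also have "\<dots> \<le> (\<Sum>n. \<Sum>j. ennreal (F n j x))"
      using sum_le_suminf[OF summableI, of "{n}" "\<lambda>n. \<Sum>j. ennreal (F n j x)"] by simp
    finally show "1 \<le> (\<Sum>k. ennreal (G k x))" by (simp add: sum_G)
  qed (use F in \<open>auto simp: cover_def G_def split: prod.split\<close>)
  then have "outer (\<Union>n. A n) \<le> (\<Sum>n. mass (F n))" by (metis outer_le mass_G)
  also have "\<dots> \<le> (\<Sum>n. outer (A n) + ennreal (e * (1/2) ^ Suc n))"
    by (intro suminf_le mF) auto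
  also have "\<dots> = (\<Sum>n. outer (A n)) + (\<Sum>n. ennreal (e * (1/2) ^ Suc n))"
    by (rule suminf_add[symmetric]) (rule summableI)+
  also have "\<dots> = (\<Sum>n. outer (A n)) + ennreal e"
    by (simp only: suminf_geometric_ennreal[OF less_imp_le[OF \<open>e > 0\<close>]])
  finally show "outer (\<Union>n. A n) \<le> (\<Sum>n. outer (A n)) + ennreal e" .
qed

lemma outer_measure_space_outer: "outer_measure_space (Pow UNIV) outer"
  unfolding outer_measure_space_def positive_def increasing_def countably_subadditive_def
  using outer_empty outer_mono outer_countably_subadditive by simp

text \<open>With Urysohn functions \<open>h\<^sub>k\<close> decreasing to the indicator of \<open>C\<close>, a cover \<open>f\<close> of \<open>A\<close> splits into
  the cover \<open>f n * h (K n)\<close> of \<open>A \<inter> C\<close> and the telescoping cover \<open>f n * (h k - h (k + 1))\<close> of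
  \<open>A - C\<close>.\<close>

lemma outer_split_closed:
  assumes C: "closed C" "C \<noteq> {}" and f: "cover A f" and "e > 0"
  shows "outer (A \<inter> C) + outer (A - C) \<le> mass f + ennreal e"
proof -
  define h where "h = closed_bump C"
  have h_cont: "continuous_on UNIV (h k)" for k
    unfolding h_def by (rule continuous_on_closed_bump)
  have h01: "0 \<le> h k x" for k x by (simp add: h_def closed_bump_bounds)
  have h0: "h 0 x = 1" for x by (simp add: h_def closed_bump_def)
  have hC: "h k x = 1" if "x \<in> C" for k x using that by (simp add: h_def closed_bump_eq_1)
  have h_dec: "h (Suc k) x \<le> h k x" for k x by (simp add: h_def closed_bump_Suc_le)
  have h_lim: "(\<lambda>k. h k x) \<longlonglongrightarrow> 0" if "x \<notin> C" for x
    using closed_bump_LIMSEQ[OF C, of x] that by (simp add: h_def)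
  have f_cont: "continuous_on UNIV (f n)" and f0: "0 \<le> f n x" for n x
    using f by (auto simp: cover_def)
  define a where "a n k = L (\<lambda>x. f n x * h k x)" for n k
  have fh_cont: "continuous_on UNIV (\<lambda>x. f n x * h k x)" for n k
    by (intro continuous_intros f_cont h_cont)
  have a0: "0 \<le> a n k" for n k
    unfolding a_def by (rule L_nonneg[OF fh_cont]) (simp add: f0 h01)
  have a_dec: "a n (Suc k) \<le> a n k" for n k
    unfolding a_def by (intro L_mono fh_cont mult_left_mono h_dec f0)
  have a_init: "a n 0 = L (f n)" for n by (simp add: a_def h0)
  have "\<exists>l. a n \<longlonglongrightarrow> l \<and> (\<forall>k. l \<le> a n k)" for n
    using decseq_convergent[of "a n" 0] a_dec a0 by (metis decseq_SucI)
  \<comment> \<open>\<open>l n\<close> plays the part of the mass of \<open>f n\<close> on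
    \<open>C\<close>: the telescoping family has mass \<open>L (f n) - l n\<close>, and stopping at
    \<open>K n\<close> exceeds \<open>l n\<close> by a summable error only.\<close>
  then obtain l where l: "\<And>n. a n \<longlonglongrightarrow> l n" and l_le: "\<And>n k. l n \<le> a n k" by metis
  have "\<exists>k. a n k < l n + e * (1/2) ^ Suc n" for n
    using order_tendstoD(2)[OF l, of n "l n + e * (1/2) ^ Suc n"] \<open>e > 0\<close>
    by (auto simp: eventually_sequentially)
  then obtain K where K: "\<And>n. a n (K n) < l n + e * (1/2) ^ Suc n" by metis
  define g where "g k = (case prod_decode k of (n, j) \<Rightarrow> (\<lambda>x. f n x * (h j x - h (Suc j) x)))" for k
  have "cover (A \<inter> C) (\<lambda>n x. f n x * h (K n) x)"
    using f unfolding cover_def by (auto simp: h01 hC intro: fh_cont)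
  then have "outer (A \<inter> C) \<le> (\<Sum>n. ennreal (a n (K n)))"
    unfolding a_def mass_def[symmetric] by (rule outer_le)
  moreover have "outer (A - C) \<le> (\<Sum>n. ennreal (L (f n) - l n))"
  proof -
    have inner: "(\<Sum>j. ennreal (L (\<lambda>x. f n x * (h j x - h (Suc j) x)))) = ennreal (L (f n) - l n)" for n
    proof (rule suminf_ennreal_eq)
      have L_eq: "L (\<lambda>x. f n x * (h j x - h (Suc j) x)) = a n j - a n (Suc j)" for j
        unfolding right_diff_distrib a_def by (rule L_diff[OF fh_cont fh_cont])
      show "(\<lambda>j. L (\<lambda>x. f n x * (h j x - h (Suc j) x))) sums (L (f n) - l n)"
        unfolding L_eq a_init[symmetric] by (rule telescope_sums'[OF l])
      show "0 \<le> L (\<lambda>x. f n x * (h j x - h (Suc j) x))" for j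
        unfolding L_eq using a_dec by simp
    qed
    have "mass g = (\<Sum>n. ennreal (L (f n) - l n))"
      using suminf_ennreal_2dimen[of "\<lambda>n. ennreal (L (f n) - l n)"
          "\<lambda>(n, j). ennreal (L (\<lambda>x. f n x * (h j x - h (Suc j) x)))"] inner
      by (simp add: g_def mass_def case_prod_unfold)
    moreover have "cover (A - C) g"
      unfolding cover_def
    proof (intro conjI ballI allI)
      fix x assume x: "x \<in> A - C"
      have "(\<Sum>j. ennreal (f n x * (h j x - h (Suc j) x))) = ennreal (f n x)" for n
      proof (rule suminf_ennreal_eq)
        show "(\<lambda>j. f n x * (h j x - h (Suc j) x)) sums f n x"
          using sums_mult[OF telescope_sums'[OF h_lim[of x]], of "f n x"] x by (simp add: h0)
      qed (simp add: f0 h_dec)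
      then have "(\<Sum>k. ennreal (g k x)) = (\<Sum>n. ennreal (f n x))"
        using suminf_ennreal_2dimen[of "\<lambda>n. ennreal (f n x)"
            "\<lambda>(n, j). ennreal (f n x * (h j x - h (Suc j) x))"]
        by (simp add: g_def case_prod_unfold)
      then show "1 \<le> (\<Sum>k. ennreal (g k x))" using f x by (simp add: cover_def)
    qed (auto simp: g_def f0 h_dec split: prod.split intro!: continuous_intros f_cont h_cont)
    ultimately show ?thesis using outer_le by metis
  qed
  ultimately have "outer (A \<inter> C) + outer (A - C)
      \<le> (\<Sum>n. ennreal (a n (K n))) + (\<Sum>n. ennreal (L (f n) - l n))"
    by (rule add_mono)
  also have "\<dots> = (\<Sum>n. ennreal (a n (K n)) + ennreal (L (f n) - l n))"
    by (rule suminf_add) (rule summableI)+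
  also have "\<dots> \<le> (\<Sum>n. ennreal (L (f n)) + ennreal (e * (1/2) ^ Suc n))"
  proof (intro suminf_le)
    fix n
    have "ennreal (a n (K n)) + ennreal (L (f n) - l n) = ennreal (a n (K n) + (L (f n) - l n))"
      using l_le[of n 0] a0 by (simp add: a_init)
    also have "\<dots> \<le> ennreal (L (f n) + e * (1/2) ^ Suc n)"
      using K[of n] by (intro ennreal_leI) simp
    also have "\<dots> = ennreal (L (f n)) + ennreal (e * (1/2) ^ Suc n)"
      using a0[of n 0] \<open>e > 0\<close> by (intro ennreal_plus) (auto simp: a_init)
    finally show "ennreal (a n (K n)) + ennreal (L (f n) - l n)
        \<le> ennreal (L (f n)) + ennreal (e * (1/2) ^ Suc n)" .
  qed auto
  also have "\<dots> = mass f + ennreal e"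
    unfolding mass_def suminf_geometric_ennreal[OF less_imp_le[OF \<open>e > 0\<close>], symmetric]
    by (rule suminf_add[symmetric]) (rule summableI)+
  finally show ?thesis .
qed

text \<open>This is Caratheodory measurability of \<open>C\<close>. Half of \<open>e\<close> pays
  for a near-optimal cover, half for splitting it.\<close>

lemma closed_in_lambda_system:
  assumes "closed C"
  shows "C \<in> lambda_system UNIV (Pow UNIV) outer"
proof -
  interpret sigma_algebra UNIV "Pow UNIV" by (rule sigma_algebra_Pow)
  have "outer (A \<inter> C) + outer (A - C) = outer A" for A
  proof (rule antisym)
    show "outer (A \<inter> C) + outer (A - C) \<le> outer A"
    proof (cases "C = {}")
      case False
      show ?thesis
      proof (rule ennreal_le_epsilon)
        fix e :: real assume "e > 0"
        obtain f where f: "cover A f" "mass f \<le> outer A + ennreal (e / 2)"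
          using outer_approx[of "e / 2" A] \<open>e > 0\<close> by auto
        have "outer (A \<inter> C) + outer (A - C) \<le> mass f + ennreal (e / 2)"
          using outer_split_closed[OF assms False f(1), of "e / 2"] \<open>e > 0\<close> by simp
        also have "\<dots> \<le> outer A + ennreal (e / 2) + ennreal (e / 2)"
          by (rule add_right_mono[OF f(2)])
        also have "\<dots> = outer A + ennreal e"
          using \<open>e > 0\<close> by (simp add: add.assoc flip: ennreal_plus)
        finally show "outer (A \<inter> C) + outer (A - C) \<le> outer A + ennreal e" .
      qed
    qed (simp add: outer_empty)
    have "subadditive (Pow UNIV) outer"
      using outer_measure_space_outer
      by (intro countably_subadditive_subadditive) (auto simp: outer_measure_space_def)
    then have "outer ((A \<inter> C) \<union> (A - C)) \<le> outer (A \<inter> C) + outer (A - C)"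
      by (rule subadditiveD) auto
    then show "outer A \<le> outer (A \<inter> C) + outer (A - C)"
      by (simp add: Int_Diff_Un)
  qed
  then show ?thesis unfolding lambda_system_eq by auto
qed

text \<open>Compactness enters here: finitely many members of a cover already sum to at least
  \<open>1 - e\<close> everywhere, and for finite sums \<open>L\<close> is additive and
  monotone.\<close>

lemma outer_UNIV: "outer UNIV = 1"
proof (rule antisym[OF outer_le_one])
  show "1 \<le> outer UNIV"
    unfolding outer_def
  proof (rule INF_greatest)
    fix F assume "F \<in> Collect (cover UNIV)"
    then have F: "\<And>n. continuous_on UNIV (F n)" "\<And>n x. 0 \<le> F n x"
      "\<And>x. 1 \<le> (\<Sum>n. ennreal (F n x))" by (auto simp: cover_def)
    show "1 \<le> mass F"
    proof (rule ennreal_le_epsilon)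
      fix e :: real assume "e > 0"
      define U where "U N = {x. 1 - e < (\<Sum>n<N. F n x)}" for N
      have "open (U N)" for N
        unfolding U_def by (intro open_Collect_less continuous_intros F)
      moreover have "UNIV \<subseteq> (\<Union>N\<in>UNIV. U N)"
      proof
        fix x
        have "ennreal (1 - e) < (\<Sum>n. ennreal (F n x))"
          using \<open>e > 0\<close> by (intro less_le_trans[OF _ F(3)]) (simp add: ennreal_less_one_iff)
        then obtain N where "ennreal (1 - e) < (\<Sum>n<N. ennreal (F n x))"
          unfolding suminf_eq_SUP less_SUP_iff by blast
        then have "ennreal (1 - e) < ennreal (\<Sum>n<N. F n x)"
          by (simp only: sum_ennreal F(2))
        then have "1 - e < (\<Sum>n<N. F n x)"
          by (rule contrapos_pp) (simp add: not_less ennreal_leI)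
        then show "x \<in> (\<Union>N\<in>UNIV. U N)" by (auto simp: U_def)
      qed
      ultimately obtain I where I: "finite I" "UNIV \<subseteq> (\<Union>N\<in>I. U N)"
        using compactE_image[OF compact_UNIV, of UNIV U] by metis
      define N where "N = Max I"
      have bound: "1 - e \<le> (\<Sum>n<N. F n x)" for x
      proof -
        obtain j where "j \<in> I" "x \<in> U j" using I(2) by auto
        moreover have "j \<le> N" unfolding N_def using I(1) \<open>j \<in> I\<close> by simp
        then have "(\<Sum>n<j. F n x) \<le> (\<Sum>n<N. F n x)" by (intro sum_mono2) (auto simp: F)
        ultimately show ?thesis by (simp add: U_def)
      qed
      have "L (\<lambda>_. 1 - e) \<le> L (\<lambda>x. \<Sum>n<N. F n x)"
        using bound by (intro L_mono continuous_on_sum F) auto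
      then have "1 - e \<le> (\<Sum>n<N. L (F n))"
        by (subst (asm) L_sum) (auto simp: F)
      then have "1 \<le> ennreal ((\<Sum>n<N. L (F n)) + e)"
        by (simp add: ennreal_leI flip: ennreal_1)
      also have "\<dots> = (\<Sum>n<N. ennreal (L (F n))) + ennreal e"
        using \<open>e > 0\<close> F by (simp add: sum_ennreal L_nonneg sum_nonneg)
      also have "\<dots> \<le> mass F + ennreal e"
        unfolding mass_def by (intro add_right_mono sum_le_suminf) auto
      finally show "1 \<le> mass F + ennreal e" .
    qed
  qed
qed

definition repr_measure :: "'a measure" where
  "repr_measure = measure_of UNIV (sets borel) outer"

lemma sets_repr_measure [simp, measurable_cong]: "sets repr_measure = sets borel"
  using sigma_algebra.sigma_sets_eq[OF sets.sigma_algebra_axioms, of "borel :: 'a measure"]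
  unfolding repr_measure_def by (subst sets_measure_of) auto

lemma space_repr_measure [simp]: "space repr_measure = UNIV"
  using sets_eq_imp_space_eq[OF sets_repr_measure] by simp

lemma emeasure_repr_measure:
  assumes "A \<in> sets borel"
  shows "emeasure repr_measure A = outer A"
proof -
  interpret sigma_algebra UNIV "Pow UNIV" by (rule sigma_algebra_Pow)
  have ms: "measure_space UNIV (lambda_system UNIV (Pow UNIV) outer) outer"
    by (rule caratheodory_lemma[OF outer_measure_space_outer])
  then interpret l: sigma_algebra UNIV "lambda_system UNIV (Pow UNIV) outer"
    by (simp add: measure_space_def)
  have "sigma_sets UNIV (Collect closed) \<subseteq> lambda_system UNIV (Pow UNIV) outer"
    using closed_in_lambda_system by (intro l.sigma_sets_subset) auto
  then have "sets borel \<subseteq> lambda_system UNIV (Pow UNIV) outer"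
    by (simp add: borel_eq_closed)
  then have "measure_space UNIV (sets borel) outer"
    using sets.sigma_algebra_axioms[of "borel :: 'a measure"] by (intro measure_down[OF ms]) auto
  then show ?thesis
    using assms emeasure_measure_of_sigma[of UNIV "sets borel" outer A]
    unfolding repr_measure_def measure_space_def by blast
qed

lemma prob_space_repr_measure: "prob_space repr_measure"
  by (rule prob_spaceI) (simp add: emeasure_repr_measure outer_UNIV)

lemma sum_clamp: "0 \<le> y \<Longrightarrow> (\<Sum>i<n. max 0 (min 1 (y - real i))) = min y (real n)"
  by (induction n) auto

text \<open>Layers of height \<open>1 / n\<close>: \<open>n * f\<close> is the sum of the clamps
  \<open>c i\<close>, each at most the indicator of \<open>V i\<close> and equal to 1 on
  \<open>V (Suc i)\<close>. So \<open>c i\<close> has integral at most \<open>prob (V i)\<close>,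
  and \<open>prob (V (Suc i)) \<le> L (c i)\<close> because \<open>c i\<close> alone covers
  \<open>V (Suc i)\<close>.\<close>

lemma integral_repr_measure_le:
  assumes f: "continuous_on UNIV f" "\<And>x. 0 \<le> f x" "\<And>x. f x \<le> 1"
  shows "(\<integral>x. f x \<partial>repr_measure) \<le> L f"
proof -
  interpret prob_space repr_measure by (rule prob_space_repr_measure)
  have "(\<integral>x. f x \<partial>repr_measure) \<le> L f + 1 / real (Suc k)" for k
  proof -
    let ?n = "real (Suc k)"
    define c where "c i x = max 0 (min 1 (?n * f x - real i))" for i x
    have c_cont: "continuous_on UNIV (c i)" for i
      unfolding c_def by (intro continuous_intros f)
    have c01: "0 \<le> c i x" "c i x \<le> 1" for i x by (auto simp: c_def)
    have nf: "?n * f x = (\<Sum>i<Suc k. c i x)" for x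
    proof -
      have "(\<Sum>i<Suc k. c i x) = min (?n * f x) ?n"
        unfolding c_def using sum_clamp[of "?n * f x" "Suc k"] f(2)[of x] by simp
      also have "?n * f x \<le> ?n" using mult_left_mono[OF f(3)[of x], of ?n] by simp
      then have "min (?n * f x) ?n = ?n * f x" by simp
      finally show ?thesis ..
    qed
    have c_meas [measurable]: "c i \<in> borel_measurable repr_measure" for i
      by (rule continuous_on_borel_measurable[OF sets_repr_measure c_cont])
    have c_int: "integrable repr_measure (c i)" for i
      by (rule integrable_const_bound[where B = 1]) (auto simp: c01)
    define V where "V i = {x. real i < ?n * f x}" for i
    have V: "V i \<in> sets borel" for i
      unfolding V_def by (intro borel_open open_Collect_less continuous_intros f)
    have c_le: "(\<integral>x. c i x \<partial>repr_measure) \<le> prob (V i)" for i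
    proof -
      have "(\<integral>x. c i x \<partial>repr_measure) \<le> (\<integral>x. indicator (V i) x \<partial>repr_measure)"
      proof (rule integral_mono[OF c_int])
        show "integrable repr_measure (indicator (V i) :: 'a \<Rightarrow> real)"
          using V[of i] by (simp add: integrable_indicator_iff emeasure_eq_measure)
        show "c i x \<le> indicator (V i) x" for x
          by (simp add: V_def c_def indicator_def del: of_nat_Suc)
      qed
      then show ?thesis using V[of i] by simp
    qed
    have V_le: "prob (V (Suc i)) \<le> L (c i)" for i
    proof -
      have "ennreal (prob (V (Suc i))) = outer (V (Suc i))"
        using V by (simp add: emeasure_repr_measure flip: emeasure_eq_measure)
      also have "\<dots> \<le> ennreal (L (c i))"
        by (rule outer_le_single[OF c_cont c01(1)]) (auto simp: V_def c_def)
      finally show ?thesis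
        using L_nonneg[OF c_cont c01(1)] by (simp add: ennreal_le_iff)
    qed
    have "?n * (\<integral>x. f x \<partial>repr_measure) = (\<Sum>i<Suc k. \<integral>x. c i x \<partial>repr_measure)"
      unfolding integral_mult_right_zero[symmetric] nf
      by (rule Bochner_Integration.integral_sum) (rule c_int)
    also have "\<dots> \<le> (\<Sum>i<Suc k. prob (V i))" by (rule sum_mono) (rule c_le)
    \<comment> \<open>The shift of index leaves over \<open>prob (V 0) \<le> 1\<close>, which
      becomes the error \<open>1 / n\<close> after division.\<close>
    also have "\<dots> = prob (V 0) + (\<Sum>i<k. prob (V (Suc i)))" by (rule sum.lessThan_Suc_shift)
    also have "\<dots> \<le> 1 + (\<Sum>i<Suc k. L (c i))"
    proof (intro add_mono prob_le_1)
      have "(\<Sum>i<k. prob (V (Suc i))) \<le> (\<Sum>i<k. L (c i))" by (rule sum_mono) (rule V_le)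
      also have "\<dots> \<le> (\<Sum>i<Suc k. L (c i))" using L_nonneg[OF c_cont c01(1)] by simp
      finally show "(\<Sum>i<k. prob (V (Suc i))) \<le> (\<Sum>i<Suc k. L (c i))" .
    qed
    also have "(\<Sum>i<Suc k. L (c i)) = L (\<lambda>x. \<Sum>i<Suc k. c i x)"
      by (rule L_sum[symmetric]) (auto simp: c_cont)
    also have "\<dots> = ?n * L f" unfolding nf[symmetric] by (rule L_cmult[OF f(1)])
    finally show ?thesis by (simp add: field_simps del: of_nat_Suc)
  qed
  then have "(\<integral>x. f x \<partial>repr_measure) \<le> L f + 0"
    by (intro LIMSEQ_le_const[OF tendsto_add[OF tendsto_const LIMSEQ_inverse_real_of_nat]])
      (auto simp: inverse_eq_divide)
  then show ?thesis by simp
qed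

text \<open>An affine rescaling \<open>g\<close> of \<open>f\<close> has values between 0 and 1; the
  inequality for \<open>g\<close> and for \<open>1 - g\<close> gives both directions.\<close>

theorem integral_repr_measure:
  assumes f: "continuous_on UNIV f"
  shows "(\<integral>x. f x \<partial>repr_measure) = L f"
proof -
  interpret prob_space repr_measure by (rule prob_space_repr_measure)
  obtain B where "B > 0" and B: "\<And>x. \<bar>f x\<bar> \<le> B"
    using continuous_bounded_on_compact_UNIV[OF compact_UNIV f] by metis
  define g where "g x = (1 / (2 * B)) * f x + 1 / 2" for x
  have g_cont: "continuous_on UNIV g" unfolding g_def by (intro continuous_intros f)
  have g01: "0 \<le> g x" "g x \<le> 1" for x
    using B[of x] \<open>B > 0\<close> by (auto simp: g_def field_simps abs_le_iff)
  have f_int: "integrable repr_measure f"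
    using B continuous_on_borel_measurable[OF sets_repr_measure f]
    by (intro integrable_const_bound[where B = B]) auto
  have int_g: "(\<integral>x. g x \<partial>repr_measure) = (1 / (2 * B)) * (\<integral>x. f x \<partial>repr_measure) + 1 / 2"
    unfolding g_def using f_int prob_space by simp
  have g_int: "integrable repr_measure g" unfolding g_def using f_int by simp
  have "L g = L (\<lambda>x. (1 / (2 * B)) * f x) + L (\<lambda>_. 1 / 2)"
    unfolding g_def by (intro L_add continuous_intros f)
  then have L_g: "L g = (1 / (2 * B)) * L f + 1 / 2"
    by (simp only: L_cmult[OF f] L_const)
  have "(\<integral>x. 1 - g x \<partial>repr_measure) \<le> L (\<lambda>x. 1 - g x)"
    using g01 by (intro integral_repr_measure_le continuous_intros g_cont) auto
  then have "1 - (\<integral>x. g x \<partial>repr_measure) \<le> 1 - L g"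
    using g_int prob_space by (simp add: L_diff g_cont)
  moreover have "(\<integral>x. g x \<partial>repr_measure) \<le> L g"
    by (rule integral_repr_measure_le[OF g_cont g01])
  ultimately have "(\<integral>x. g x \<partial>repr_measure) = L g" by simp
  then show ?thesis using \<open>B > 0\<close> by (simp add: int_g L_g)
qed

end

section \<open>Quasi-regular points and time averages\<close>

lemma closed_bump_integral_LIMSEQ:
  fixes C :: "'a::metric_space set"
  assumes "prob_space P" and P: "sets P = sets borel" and C: "closed C" "C \<noteq> {}"
  shows "(\<lambda>k. \<integral>x. closed_bump C k x \<partial>P) \<longlonglongrightarrow> measure P C"
proof -
  interpret prob_space P by fact
  have [measurable]: "C \<in> sets P" using C P by simp
  have "(\<lambda>k. \<integral>x. closed_bump C k x \<partial>P) \<longlonglongrightarrow> (\<integral>x. indicator C x \<partial>P)"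
  proof (rule integral_dominated_convergence[where w = "\<lambda>_. 1"])
    show "closed_bump C k \<in> borel_measurable P" for k
      by (rule continuous_on_borel_measurable[OF P continuous_on_closed_bump])
    show "AE x in P. norm (closed_bump C k x) \<le> 1" for k
      using closed_bump_bounds[of C k] by simp
    show "AE x in P. (\<lambda>k. closed_bump C k x) \<longlonglongrightarrow> indicator C x"
      using closed_bump_LIMSEQ[OF C] by simp
  qed auto
  then show ?thesis by simp
qed

text \<open>Integrals of bumps converge to the measure of a closed set, and the closed sets are a
  generator stable under intersection.\<close>

lemma measure_eqI_continuous:
  fixes M N :: "'a::metric_space measure"
  assumes "prob_space M" "prob_space N" and sM: "sets M = sets borel" and sN: "sets N = sets borel"
    and eq: "\<And>f :: 'a \<Rightarrow> real. continuous_on UNIV f \<Longrightarrow> (\<integral>x. f x \<partial>M) = (\<integral>x. f x \<partial>N)"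
  shows "M = N"
proof -
  note lim = closed_bump_integral_LIMSEQ
  interpret M: prob_space M by fact
  interpret N: prob_space N by fact
  show ?thesis
  proof (rule measure_eqI_generator_eq[where E = "Collect closed" and A = "\<lambda>_. UNIV" and \<Omega> = UNIV])
    fix C :: "'a set" assume "C \<in> Collect closed"
    then have "closed C" by simp
    show "emeasure M C = emeasure N C"
    proof (cases "C = {}")
      case False
      have "measure M C = measure N C"
        using lim[OF assms(1) sM \<open>closed C\<close> False] lim[OF assms(2) sN \<open>closed C\<close> False]
        unfolding eq[OF continuous_on_closed_bump] by (rule LIMSEQ_unique)
      then show ?thesis by (simp add: M.emeasure_eq_measure N.emeasure_eq_measure)
    qed simp
  qed (auto simp: Int_stable_def sM sN borel_eq_closed)
qed

text \<open>Normalized bumps on a finite net form a partition of unity, which replaces a function by an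
  interpolation of its values on the net.\<close>

lemma countable_spanning_family:
  assumes "compact (UNIV :: 'a::metric_space set)"
  obtains \<Theta> :: "('a::metric_space \<Rightarrow> real) set" where "countable \<Theta>" and "\<And>g. g \<in> \<Theta> \<Longrightarrow> continuous_on UNIV g"
    and "\<And>f :: 'a::metric_space \<Rightarrow> real. \<And>e. \<lbrakk>continuous_on UNIV f; e > 0\<rbrakk> \<Longrightarrow>
      \<exists>I c g. finite (I :: 'a::metric_space set) \<and> (\<forall>j\<in>I. g j \<in> \<Theta>) \<and> (\<forall>x. \<bar>f x - (\<Sum>j\<in>I. c j * g j x)\<bar> < e)"
proof -
  have "\<forall>n::nat. \<exists>I :: 'a set. finite I \<and> UNIV \<subseteq> (\<Union>c\<in>I. ball c (1 / Suc n))"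
  proof
    fix n :: nat
    show "\<exists>I :: 'a set. finite I \<and> UNIV \<subseteq> (\<Union>c\<in>I. ball c (1 / Suc n))"
      by (rule compactE_image[OF assms, of UNIV "\<lambda>c. ball c (1 / Suc n)"])
        (auto simp del: of_nat_Suc)
  qed
  from choice[OF this] obtain I :: "nat \<Rightarrow> 'a set" where fin: "\<And>n. finite (I n)"
    and net: "\<And>n. UNIV \<subseteq> (\<Union>c\<in>I n. ball c (1 / Suc n))" by blast
  define u where "u n c x = max 0 (1 / real (Suc n) - dist c x)" for n and c x :: 'a
  define s where "s n x = (\<Sum>c\<in>I n. u n c x)" for n x
  define g where "g n c x = u n c x / s n x" for n c x
  have u0: "0 \<le> u n c x" for n c x by (simp add: u_def)
  have u_near: "dist c x < 1 / real (Suc n)" if "u n c x \<noteq> 0" for n c x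
    using that by (auto simp: u_def max_def split: if_splits)
  have s_pos: "0 < s n x" for n x
  proof -
    obtain c where c: "c \<in> I n" "dist c x < 1 / real (Suc n)" using net[of n] by force
    have "0 < u n c x" using c(2) by (simp add: u_def)
    also have "\<dots> \<le> s n x" unfolding s_def by (rule member_le_sum[OF c(1)]) (auto simp: u0 fin)
    finally show ?thesis .
  qed
  have cont: "continuous_on UNIV (g n c)" for n c
  proof -
    have "continuous_on UNIV (u n c)" and "continuous_on UNIV (s n)"
      unfolding s_def u_def by (intro continuous_intros)+
    then show ?thesis
      unfolding g_def by (rule continuous_on_divide) (metis s_pos less_irrefl)
  qed
  have one: "(\<Sum>c\<in>I n. g n c x) = 1" for n x
  proof -
    have "(\<Sum>c\<in>I n. g n c x) = s n x / s n x"
      unfolding g_def sum_divide_distrib[symmetric] by (simp only: s_def)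
    then show ?thesis using s_pos[of n x] by simp
  qed
  have g0: "0 \<le> g n c x" for n c x using u0 s_pos[of n x] by (simp add: g_def)
  show ?thesis
  proof (rule that[of "\<Union>n. g n ` I n"])
    show "countable (\<Union>n. g n ` I n)" 
      by (rule countable_UN[OF countableI_type]) (simp add: countable_finite fin)
    show "continuous_on UNIV h" if "h \<in> (\<Union>n. g n ` I n)" for h using that cont by auto
    fix f :: "'a \<Rightarrow> real" and e :: real assume f: "continuous_on UNIV f" and "e > 0"
    obtain d where "d > 0" and d: "\<And>x y. dist x y < d \<Longrightarrow> \<bar>f x - f y\<bar> < e"
      using uniformly_continuous_onE[OF compact_uniformly_continuous[OF f assms] \<open>e > 0\<close>]
      by (metis UNIV_I dist_real_def)
    obtain n where n: "1 / real (Suc n) < d" using nat_approx_posE[OF \<open>d > 0\<close>] .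
    have "\<bar>f x - (\<Sum>c\<in>I n. f c * g n c x)\<bar> < e" for x
    proof -
      have "f x - (\<Sum>c\<in>I n. f c * g n c x) = (\<Sum>c\<in>I n. (f x - f c) * g n c x)"
        using one[of n x] by (simp add: left_diff_distrib sum_subtractf flip: sum_distrib_left)
      also have "\<bar>\<dots>\<bar> \<le> (\<Sum>c\<in>I n. \<bar>(f x - f c) * g n c x\<bar>)" by (rule sum_abs)
      \<comment> \<open>Strict because some net point within \<open>d\<close> of \<open>x\<close>
        has positive weight at \<open>x\<close>.\<close>
      also have "\<dots> < (\<Sum>c\<in>I n. e * g n c x)"
      proof (rule sum_strict_mono_ex1[OF fin])
        show "\<forall>c\<in>I n. \<bar>(f x - f c) * g n c x\<bar> \<le> e * g n c x"
        proof
          fix c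
          show "\<bar>(f x - f c) * g n c x\<bar> \<le> e * g n c x"
          proof (cases "u n c x = 0")
            case False
            then have "\<bar>f x - f c\<bar> \<le> e"
              using d[of x c] u_near[OF False] n by (simp add: dist_commute less_imp_le)
            then show ?thesis using g0 by (simp add: abs_mult mult_right_mono)
          qed (simp add: g_def)
        qed
        obtain c where c: "c \<in> I n" "dist c x < 1 / real (Suc n)" using net[of n] by force
        then have "0 < g n c x" using s_pos[of n x] by (simp add: g_def u_def)
        moreover have "\<bar>f x - f c\<bar> < e" using d[of x c] c(2) n by (simp add: dist_commute)
        ultimately have "\<bar>(f x - f c) * g n c x\<bar> < e * g n c x" by (simp add: abs_mult)
        with c(1) show "\<exists>c\<in>I n. \<bar>(f x - f c) * g n c x\<bar> < e * g n c x" by blast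
      qed
      also have "\<dots> = e" by (simp add: one flip: sum_distrib_left)
      finally show ?thesis .
    qed
    then show "\<exists>J c h. finite (J :: 'a set) \<and> (\<forall>j\<in>J. h j \<in> (\<Union>n. g n ` I n)) \<and>
        (\<forall>x. \<bar>f x - (\<Sum>j\<in>J. c j * h j x)\<bar> < e)"
      using fin by (intro exI[of _ "I n"] exI[of _ f] exI[of _ "g n"]) auto
  qed
qed

section \<open>Time averages along integer times\<close>

context compact_flow
begin

text \<open>Sampled at integer times to match Birkhoff's theorem for the time-one map;
  \<open>time_avg_at_top\<close> recovers real times. The value is meaningful only where the limit
  exists.\<close>

definition time_avg :: "('a \<Rightarrow> real) \<Rightarrow> 'a \<Rightarrow> real" where
  "time_avg f x = lim (\<lambda>n. orbit_integral \<sigma> f x (real n) / real n)"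

definition quasi_regular :: "'a set" where
  "quasi_regular = {x. \<forall>f :: 'a \<Rightarrow> real. continuous_on UNIV f \<longrightarrow>
     convergent (\<lambda>n. orbit_integral \<sigma> f x (real n) / real n)}"

lemma abs_average_le:
  assumes "continuous_on UNIV f" and "\<And>x. \<bar>f x\<bar> \<le> B"
  shows "\<bar>orbit_integral \<sigma> f x (real n) / real n\<bar> \<le> B"
proof (cases "n = 0")
  case True
  then show ?thesis using assms(2)[of x] by simp
next
  case False
  then show ?thesis
    using abs_orbit_integral_le[OF assms, of x "real n"] by (simp add: field_simps)
qed

lemma average_diff_le:
  assumes "continuous_on UNIV f" and "continuous_on UNIV g" and "\<And>x. \<bar>f x - g x\<bar> \<le> e"
  shows "\<bar>orbit_integral \<sigma> f x (real n) / real n - orbit_integral \<sigma> g x (real n) / real n\<bar> \<le> e"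
  using abs_average_le[of "\<lambda>x. f x - g x" e x n] assms
  by (simp add: orbit_integral_diff continuous_on_diff diff_divide_distrib)

lemma time_avg_LIMSEQ:
  assumes "x \<in> quasi_regular" and "continuous_on UNIV f"
  shows "(\<lambda>n. orbit_integral \<sigma> f x (real n) / real n) \<longlonglongrightarrow> time_avg f x"
  using assms unfolding quasi_regular_def time_avg_def by (simp add: convergent_LIMSEQ_iff)

lemma time_avg_eqI:
  assumes "(\<lambda>n. orbit_integral \<sigma> f x (real n) / real n) \<longlonglongrightarrow> l"
  shows "time_avg f x = l"
  using assms unfolding time_avg_def by (rule limI)

lemma abs_time_avg_le:
  assumes "x \<in> quasi_regular" and "continuous_on UNIV f" and "\<And>x. \<bar>f x\<bar> \<le> B"
  shows "\<bar>time_avg f x\<bar> \<le> B"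
  using tendsto_rabs[OF time_avg_LIMSEQ[OF assms(1,2)]] abs_average_le[OF assms(2,3)]
  by (blast intro: LIMSEQ_le_const2)

lemma time_avg_add:
  assumes "x \<in> quasi_regular" and "continuous_on UNIV f" and "continuous_on UNIV g"
  shows "time_avg (\<lambda>x. f x + g x) x = time_avg f x + time_avg g x"
  by (rule time_avg_eqI)
    (simp add: assms orbit_integral_add add_divide_distrib tendsto_add time_avg_LIMSEQ)

lemma time_avg_cmult:
  assumes "x \<in> quasi_regular" and "continuous_on UNIV f"
  shows "time_avg (\<lambda>x. c * f x) x = c * time_avg f x"
proof (rule time_avg_eqI)
  show "(\<lambda>n. orbit_integral \<sigma> (\<lambda>x. c * f x) x (real n) / real n) \<longlonglongrightarrow> c * time_avg f x"
    using tendsto_mult_left[OF time_avg_LIMSEQ[OF assms], of c] by (simp add: orbit_integral_cmult assms)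
qed

lemma normalized_positive_functional_time_avg:
  assumes x: "x \<in> quasi_regular"
  shows "normalized_positive_functional (\<lambda>f. time_avg f x)"
proof
  show "0 \<le> time_avg f x" if "continuous_on UNIV f" "\<And>x. 0 \<le> f x" for f
    using orbit_integral_nonneg[OF that]
    by (intro LIMSEQ_le_const[OF time_avg_LIMSEQ[OF x that(1)]]) auto
  \<comment> \<open>At \<open>n = 0\<close> the quotient is \<open>0 / 0 = 0\<close>, so it equals 1
    only eventually.\<close>
  have "\<forall>\<^sub>F n in sequentially. 1 = orbit_integral \<sigma> (\<lambda>_. 1) x (real n) / real n"
    by (rule eventually_sequentiallyI[of 1]) simp
  then show "time_avg (\<lambda>_. 1) x = 1"
    by (intro time_avg_eqI) (rule tendsto_eventually, auto elim: eventually_mono)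
qed (simp_all add: compact_space time_avg_add time_avg_cmult x)

text \<open>Shifting by \<open>t\<close> changes an orbit integral by two boundary terms of length
  \<open>t\<close>, bounded whatever the time horizon. This yields the invariance of generic
  measures.\<close>

lemma time_avg_comp_flow:
  assumes x: "x \<in> quasi_regular" and f: "continuous_on UNIV f"
  shows "time_avg (\<lambda>y. f (\<sigma> t y)) x = time_avg f x"
proof (rule time_avg_eqI)
  obtain B where "B > 0" and B: "\<And>x. \<bar>f x\<bar> \<le> B" using bounded_continuous[OF f] by metis
  have eq: "orbit_integral \<sigma> (\<lambda>y. f (\<sigma> t y)) x s
      = orbit_integral \<sigma> f x s + (orbit_integral \<sigma> f (\<sigma> s x) t - orbit_integral \<sigma> f x t)" for s
    using orbit_integral_cocycle[OF f, of x t s] orbit_integral_cocycle[OF f, of x s t]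
    by (simp add: orbit_integral_comp_flow[OF f] add.commute)
  have "(\<lambda>n. (orbit_integral \<sigma> f (\<sigma> (real n) x) t - orbit_integral \<sigma> f x t) / real n) \<longlonglongrightarrow> 0"
  proof (rule Lim_null_comparison)
    have "\<bar>orbit_integral \<sigma> f y t - orbit_integral \<sigma> f x t\<bar> \<le> 2 * B * \<bar>t\<bar>" for y
      using abs_orbit_integral_le[OF f B, of y t] abs_orbit_integral_le[OF f B, of x t] by linarith
    then show "\<forall>\<^sub>F n in sequentially. norm ((orbit_integral \<sigma> f (\<sigma> (real n) x) t - orbit_integral \<sigma> f x t) / real n)
        \<le> 2 * B * \<bar>t\<bar> / real n"
      by (simp add: divide_right_mono)
  qed (rule lim_const_over_n)
  from tendsto_add[OF time_avg_LIMSEQ[OF x f] this]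
  show "(\<lambda>n. orbit_integral \<sigma> (\<lambda>y. f (\<sigma> t y)) x (real n) / real n) \<longlonglongrightarrow> time_avg f x"
    by (simp add: eq add_divide_distrib)
qed

lemma time_avg_at_top:
  assumes x: "x \<in> quasi_regular" and f: "continuous_on UNIV f"
  shows "((\<lambda>t. 1 / t * orbit_integral \<sigma> f x t) \<longlongrightarrow> time_avg f x) at_top"
proof -
  obtain B where "B > 0" and B: "\<And>x. \<bar>f x\<bar> \<le> B" using bounded_continuous[OF f] by metis
  let ?A = "orbit_integral \<sigma> f x"
  have "((\<lambda>t. 1 / t * ?A t - ?A (real (nat \<lfloor>t\<rfloor>)) / real (nat \<lfloor>t\<rfloor>)) \<longlongrightarrow> 0) at_top"
  proof (rule Lim_null_comparison)
    show "\<forall>\<^sub>F t in at_top. norm (1 / t * ?A t - ?A (real (nat \<lfloor>t\<rfloor>)) / real (nat \<lfloor>t\<rfloor>)) \<le> 2 * B / t"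
      using eventually_ge_at_top[of "1 :: real"]
    proof eventually_elim
      case (elim t)
      define n where "n = nat \<lfloor>t\<rfloor>"
      have n: "real n \<le> t" "t \<le> real n + 1" "n \<ge> 1"
        using elim by (auto simp: n_def le_nat_iff)
      \<comment> \<open>\<open>?r\<close> is the integral over the fractional part of
        \<open>t\<close>, and \<open>?q\<close> corrects the divisor from \<open>n\<close> to
        \<open>t\<close>; both are at most \<open>B\<close> in absolute value.\<close>
      let ?r = "orbit_integral \<sigma> f (\<sigma> (real n) x) (t - real n)"
      let ?q = "?A (real n) / real n * (t - real n)"
      have "?A t = ?A (real n) + ?r"
        using orbit_integral_cocycle[OF f, of x "real n" "t - real n"] by simp
      then have eq: "1 / t * ?A t - ?A (real n) / real n = (?r - ?q) / t"
        using n elim by (simp add: field_simps)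
      have "\<bar>?r\<bar> \<le> B * 1"
        using n \<open>B > 0\<close> by (intro order_trans[OF abs_orbit_integral_le[OF f B]] mult_left_mono) auto
      moreover have "\<bar>?q\<bar> \<le> B * 1"
        unfolding abs_mult using n abs_average_le[OF f B, of x n] \<open>B > 0\<close>
        by (intro mult_mono) auto
      ultimately have "\<bar>?r - ?q\<bar> \<le> 2 * B" by linarith
      from divide_right_mono[OF this, of t] show ?case
        unfolding n_def[symmetric] eq real_norm_def abs_divide using elim by simp
    qed
    show "((\<lambda>t. 2 * B / t) \<longlongrightarrow> 0) at_top"
      by (rule tendsto_divide_0[OF tendsto_const]) (rule filterlim_at_top_imp_at_infinity[OF filterlim_ident])
  qed
  moreover have "filterlim (\<lambda>t :: real. nat \<lfloor>t\<rfloor>) sequentially at_top"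
    by (rule filterlim_compose[OF filterlim_nat_sequentially filterlim_floor_sequentially])
  from filterlim_compose[OF time_avg_LIMSEQ[OF x f] this]
  have "((\<lambda>t :: real. ?A (real (nat \<lfloor>t\<rfloor>)) / real (nat \<lfloor>t\<rfloor>)) \<longlongrightarrow> time_avg f x) at_top" .
  ultimately show ?thesis by (rule Lim_transform[rotated])
qed

end

section \<open>Means of time averages, and quasi-regularity of almost every point\<close>

context compact_flow
begin

text \<open>In place of Fubini: by invariance the mean \<open>J\<close> is additive in time, so
  \<open>J t = n * J (t / n)\<close>, and for short times \<open>s\<close> uniform continuity puts
  \<open>J s\<close> close to \<open>s\<close> times the mean of \<open>f\<close>.\<close>

lemma integral_orbit_integral:
  assumes m: "m \<in> inv_measures \<sigma>" and f: "continuous_on UNIV f"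
  shows "(\<integral>x. orbit_integral \<sigma> f x t \<partial>m) = t * (\<integral>x. f x \<partial>m)"
proof -
  interpret prob_space m using m by (rule inv_measures_prob_space)
  note cont = continuous_on_orbit_integral[OF f]
  note int = integrable_continuous[OF m cont]
  define J where "J t = (\<integral>x. orbit_integral \<sigma> f x t \<partial>m)" for t
  have J_add: "J (s + t) = J s + J t" for s t
  proof -
    have "J (s + t) = (\<integral>x. orbit_integral \<sigma> f x s + orbit_integral \<sigma> f (\<sigma> s x) t \<partial>m)"
      unfolding J_def orbit_integral_cocycle[OF f] ..
    also have "\<dots> = J s + (\<integral>x. orbit_integral \<sigma> f (\<sigma> s x) t \<partial>m)"
      unfolding J_def
      by (rule Bochner_Integration.integral_add[OF int])
        (intro integrable_continuous[OF m] continuous_on_compose2[OF cont continuous_on_flow_map] subset_UNIV)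
    also have "(\<integral>x. orbit_integral \<sigma> f (\<sigma> s x) t \<partial>m) = J t"
      unfolding J_def by (rule integral_comp_flow[OF m borel_measurable_continuous_onI[OF cont]])
    finally show ?thesis .
  qed
  have J_mult: "J (real n * s) = real n * J s" for n s
    by (induction n) (simp_all add: J_def[of 0] J_add distrib_right)
  have "\<bar>J t - t * (\<integral>x. f x \<partial>m)\<bar> \<le> e" if "e > 0" for e
  proof -
    \<comment> \<open>The errors of \<open>n\<close> steps of length \<open>t / n\<close> add up to
      \<open>\<bar>t\<bar> * c\<close>; the summand 1 guards against \<open>t = 0\<close>.\<close>
    define c where "c = e / (\<bar>t\<bar> + 1)"
    have "c > 0" using \<open>e > 0\<close> by (simp add: c_def add_nonneg_pos)
    obtain d where "d > 0" and d: "\<And>s t x y. \<lbrakk>\<bar>s\<bar> \<le> 1; \<bar>t\<bar> \<le> 1; \<bar>s - t\<bar> < d; dist x y < d\<rbrakk>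
        \<Longrightarrow> \<bar>f (\<sigma> s x) - f (\<sigma> t y)\<bar> < c"
      using uniformly_continuous_along_flow[OF f \<open>c > 0\<close>, of 1] by metis
    obtain n where n: "\<bar>t\<bar> / min d 1 < real n" using reals_Archimedean2 by blast
    have "real n > 0" using n \<open>d > 0\<close> by (intro le_less_trans[OF _ n]) auto
    define s where "s = t / real n"
    have t: "t = real n * s" using \<open>real n > 0\<close> by (simp add: s_def)
    have "\<bar>t\<bar> < real n * min d 1"
      using n \<open>d > 0\<close> by (simp add: pos_divide_less_eq del: min_less_iff_conj)
    then have s: "\<bar>s\<bar> < min d 1"
      using \<open>real n > 0\<close> by (simp add: s_def abs_divide pos_divide_less_eq mult.commute del: min_less_iff_conj)
    have near: "\<bar>orbit_integral \<sigma> f x s - s * f x\<bar> \<le> \<bar>s\<bar> * c" for x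
    proof -
      obtain r where r: "\<bar>r\<bar> \<le> \<bar>s\<bar>" "orbit_integral \<sigma> f x s = s * f (\<sigma> r x)"
        using orbit_integral_mean_value[OF f] by metis
      have "\<bar>f (\<sigma> r x) - f (\<sigma> 0 x)\<bar> < c"
        using r(1) s \<open>d > 0\<close> by (intro d) auto
      then show ?thesis
        unfolding r(2) right_diff_distrib[symmetric] abs_mult by (intro mult_left_mono) auto
    qed
    have "J s - s * (\<integral>x. f x \<partial>m) = (\<integral>x. orbit_integral \<sigma> f x s - s * f x \<partial>m)"
      unfolding J_def using int integrable_continuous[OF m f]
      by (subst Bochner_Integration.integral_diff) auto
    also have "\<bar>\<dots>\<bar> \<le> (\<integral>x. \<bar>orbit_integral \<sigma> f x s - s * f x\<bar> \<partial>m)" by (rule integral_abs_bound)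
    also have "\<dots> \<le> (\<integral>x. \<bar>s\<bar> * c \<partial>m)"
      by (intro integral_mono near integrable_continuous[OF m] continuous_intros cont f) auto
    finally have small: "\<bar>J s - s * (\<integral>x. f x \<partial>m)\<bar> \<le> \<bar>s\<bar> * c" using prob_space by simp
    have "J t - t * (\<integral>x. f x \<partial>m) = real n * (J s - s * (\<integral>x. f x \<partial>m))"
      unfolding t J_mult by (simp add: algebra_simps)
    then have "\<bar>J t - t * (\<integral>x. f x \<partial>m)\<bar> \<le> real n * (\<bar>s\<bar> * c)"
      using mult_left_mono[OF small, of "real n"] by (simp add: abs_mult)
    also have "\<dots> = \<bar>t\<bar> * c" unfolding t by (simp add: abs_mult)
    also have "\<dots> \<le> e" using \<open>e > 0\<close> by (simp add: c_def field_simps)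
    finally show ?thesis .
  qed
  then have "\<bar>J t - t * (\<integral>x. f x \<partial>m)\<bar> \<le> 0 + e" if "e > 0" for e
    unfolding add_0 using that .
  from field_le_epsilon[OF this] have "\<bar>J t - t * (\<integral>x. f x \<partial>m)\<bar> \<le> 0" .
  then show ?thesis by (simp add: J_def)
qed

lemma orbit_average_measurable [measurable]:
  assumes "continuous_on UNIV f"
  shows "(\<lambda>x. orbit_integral \<sigma> f x t / c) \<in> borel_measurable borel"
  using borel_measurable_continuous_onI[OF continuous_on_orbit_integral[OF assms]] by simp

lemma time_avg_measurable [measurable]:
  assumes "continuous_on UNIV f"
  shows "time_avg f \<in> borel_measurable borel"
  unfolding time_avg_def[abs_def]
  by (intro borel_measurable_lim_metric orbit_average_measurable assms)

lemma measurable_inv_measure: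
  assumes "m \<in> inv_measures \<sigma>" and "f \<in> borel_measurable borel"
  shows "f \<in> borel_measurable m"
  using assms(2) measurable_cong_sets[OF inv_measures_sets[OF assms(1)] refl] by blast

lemma integral_time_avg:
  assumes m: "m \<in> inv_measures \<sigma>" and ae: "AE x in m. x \<in> quasi_regular" and f: "continuous_on UNIV f"
  shows "(\<integral>x. time_avg f x \<partial>m) = (\<integral>x. f x \<partial>m)"
proof -
  interpret prob_space m using m by (rule inv_measures_prob_space)
  obtain B where "B > 0" and B: "\<And>x. \<bar>f x\<bar> \<le> B" using bounded_continuous[OF f] by metis
  have "(\<lambda>n. \<integral>x. orbit_integral \<sigma> f x (real n) / real n \<partial>m) \<longlonglongrightarrow> (\<integral>x. time_avg f x \<partial>m)"
  proof (rule integral_dominated_convergence[where w = "\<lambda>_. B"])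
    show "AE x in m. (\<lambda>n. orbit_integral \<sigma> f x (real n) / real n) \<longlonglongrightarrow> time_avg f x"
      using ae by eventually_elim (rule time_avg_LIMSEQ[OF _ f])
    show "AE x in m. norm (orbit_integral \<sigma> f x (real n) / real n) \<le> B" for n
      using abs_average_le[OF f B, of _ n] by simp
  qed (auto intro!: measurable_inv_measure[OF m] time_avg_measurable orbit_average_measurable f)
  moreover have "(\<lambda>n. \<integral>x. orbit_integral \<sigma> f x (real n) / real n \<partial>m) \<longlonglongrightarrow> (\<integral>x. f x \<partial>m)"
    by (intro tendsto_eventually eventually_sequentiallyI[of 1])
      (simp add: integral_orbit_integral[OF m f])
  ultimately show ?thesis by (rule LIMSEQ_unique)
qed

text \<open>Uniformly close functions have uniformly close averages, so the Cauchy property passes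
  from the span of \<open>\<Theta>\<close> to every continuous \<open>f\<close>. For countable
  \<open>\<Theta>\<close> this makes the condition accessible to measure theory.\<close>

lemma quasi_regular_eq:
  assumes cont: "\<And>g. g \<in> \<Theta> \<Longrightarrow> continuous_on UNIV g"
    and span: "\<And>f :: 'a \<Rightarrow> real. \<And>e. \<lbrakk>continuous_on UNIV f; e > 0\<rbrakk> \<Longrightarrow>
      \<exists>I c g. finite (I :: 'a set) \<and> (\<forall>j\<in>I. g j \<in> \<Theta>) \<and> (\<forall>x. \<bar>f x - (\<Sum>j\<in>I. c j * g j x)\<bar> < e)"
  shows "quasi_regular = {x. \<forall>g\<in>\<Theta>. convergent (\<lambda>n. orbit_integral \<sigma> g x (real n) / real n)}"
proof (intro equalityI subsetI CollectI ballI)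
  fix x assume "x \<in> {x. \<forall>g\<in>\<Theta>. convergent (\<lambda>n. orbit_integral \<sigma> g x (real n) / real n)}"
  then have x: "convergent (\<lambda>n. orbit_integral \<sigma> g x (real n) / real n)" if "g \<in> \<Theta>" for g
    using that by blast
  have "convergent (\<lambda>n. orbit_integral \<sigma> f x (real n) / real n)"
    if f: "continuous_on UNIV f" for f
    unfolding Cauchy_convergent_iff[symmetric]
  proof (rule CauchyI)
    fix e :: real assume "e > 0"
    then obtain I c g where I: "finite (I :: 'a set)" "\<forall>j\<in>I. g j \<in> \<Theta>"
      and near: "\<And>x. \<bar>f x - (\<Sum>j\<in>I. c j * g j x)\<bar> < e / 3"
      using span[OF f, of "e / 3"] by auto
    define h where "h x = (\<Sum>j\<in>I. c j * g j x)" for x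
    have h_cont: "continuous_on UNIV h"
      unfolding h_def by (intro continuous_intros) (use I cont in auto)
    have "orbit_integral \<sigma> h x t = (\<Sum>j\<in>I. c j * orbit_integral \<sigma> (g j) x t)" for t
      unfolding h_def using I cont
      by (subst orbit_integral_sum) (auto intro!: continuous_intros simp: orbit_integral_cmult)
    then have eq: "(\<lambda>n. orbit_integral \<sigma> h x (real n) / real n)
        = (\<lambda>n. \<Sum>j\<in>I. c j * (orbit_integral \<sigma> (g j) x (real n) / real n))"
      by (simp add: sum_divide_distrib)
    have "Cauchy (\<lambda>n. orbit_integral \<sigma> h x (real n) / real n)"
      unfolding eq using I x
      by (intro convergent_Cauchy convergent_sum convergent_mult convergent_const) auto
    from CauchyD[OF this, of "e / 3"] \<open>e > 0\<close> obtain M where M: "\<forall>m\<ge>M. \<forall>n\<ge>M. norm (orbit_integral \<sigma> h x (real m) / real m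
        - orbit_integral \<sigma> h x (real n) / real n) < e / 3"
      by auto
    have diff: "\<bar>orbit_integral \<sigma> f x (real n) / real n - orbit_integral \<sigma> h x (real n) / real n\<bar> \<le> e / 3" for n
      using near by (intro average_diff_le f h_cont) (auto simp: h_def less_imp_le)
    show "\<exists>M. \<forall>m\<ge>M. \<forall>n\<ge>M. norm (orbit_integral \<sigma> f x (real m) / real m
        - orbit_integral \<sigma> f x (real n) / real n) < e"
    proof (intro exI[of _ M] allI impI)
      fix m n assume "M \<le> m" "M \<le> n"
      then have "norm (orbit_integral \<sigma> h x (real m) / real m
        - orbit_integral \<sigma> h x (real n) / real n) < e / 3" using M by blast
      then show "norm (orbit_integral \<sigma> f x (real m) / real m
        - orbit_integral \<sigma> f x (real n) / real n) < e"
        using diff[of m] diff[of n] unfolding real_norm_def by linarith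
    qed
  qed
  then show "x \<in> quasi_regular" by (simp add: quasi_regular_def)
qed (use cont in \<open>auto simp: quasi_regular_def\<close>)

lemma quasi_regular_countable:
  obtains \<Theta> :: "('a \<Rightarrow> real) set" where "countable \<Theta>" and "\<And>g. g \<in> \<Theta> \<Longrightarrow> continuous_on UNIV g"
    and "quasi_regular = {x. \<forall>g\<in>\<Theta>. convergent (\<lambda>n. orbit_integral \<sigma> g x (real n) / real n)}"
proof (rule countable_spanning_family[OF compact_space])
  fix \<Theta> :: "('a \<Rightarrow> real) set"
  assume *: "countable \<Theta>" "\<And>g. g \<in> \<Theta> \<Longrightarrow> continuous_on UNIV g"
    "\<And>f :: 'a \<Rightarrow> real. \<And>e. \<lbrakk>continuous_on UNIV f; e > 0\<rbrakk> \<Longrightarrow>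
      \<exists>I c g. finite (I :: 'a set) \<and> (\<forall>j\<in>I. g j \<in> \<Theta>) \<and> (\<forall>x. \<bar>f x - (\<Sum>j\<in>I. c j * g j x)\<bar> < e)"
  show thesis by (rule that[OF *(1,2) quasi_regular_eq[OF *(2,3)]])
qed

lemma quasi_regular_measurable [measurable]: "quasi_regular \<in> sets borel"
proof -
  obtain \<Theta> :: "('a \<Rightarrow> real) set" where "countable \<Theta>" and cont: "\<And>g. g \<in> \<Theta> \<Longrightarrow> continuous_on UNIV g"
    and eq: "quasi_regular = {x. \<forall>g\<in>\<Theta>. convergent (\<lambda>n. orbit_integral \<sigma> g x (real n) / real n)}"
    by (rule quasi_regular_countable) blast
  have "{x \<in> space borel. \<forall>g\<in>\<Theta>. Cauchy (\<lambda>n. orbit_integral \<sigma> g x (real n) / real n)} \<in> sets borel"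
    by (rule sets.sets_Collect_countable_All'[OF _ \<open>countable \<Theta>\<close>])
      (intro sets_Collect_Cauchy orbit_average_measurable cont)
  then show ?thesis by (simp add: eq Cauchy_convergent_iff)
qed

text \<open>Orbit integrals at integer times are Birkhoff sums, under the time-one map, of the orbit
  integral over unit time.\<close>

lemma AE_quasi_regular:
  assumes m: "m \<in> inv_measures \<sigma>"
  shows "AE x in m. x \<in> quasi_regular"
proof -
  interpret prob_space m using m by (rule inv_measures_prob_space)
  obtain \<Theta> :: "('a \<Rightarrow> real) set" where "countable \<Theta>" and cont: "\<And>g. g \<in> \<Theta> \<Longrightarrow> continuous_on UNIV g"
    and eq: "quasi_regular = {x. \<forall>g\<in>\<Theta>. convergent (\<lambda>n. orbit_integral \<sigma> g x (real n) / real n)}"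
    by (rule quasi_regular_countable) blast
  have "distr m m (\<sigma> 1) = distr m borel (\<sigma> 1)"
    by (rule distr_cong) (simp_all add: inv_measures_sets[OF m])
  then have pres: "distr m m (\<sigma> 1) = m" using m by (simp add: inv_measures_def)
  interpret measure_preserving m "\<sigma> 1"
  proof
    show "\<sigma> 1 \<in> m \<rightarrow>\<^sub>M m"
      using flow_map_measurable[of 1] measurable_cong_sets[OF inv_measures_sets[OF m] inv_measures_sets[OF m]]
      by blast
  qed (rule pres)
  have "AE x in m. convergent (\<lambda>n. orbit_integral \<sigma> g x (real n) / real n)" if "g \<in> \<Theta>" for g
  proof -
    note g = cont[OF that]
    obtain B where B: "\<And>x. \<bar>g x\<bar> \<le> B" using bounded_continuous[OF g] by metis
    have sum: "birkhoff_sum (\<sigma> 1) (\<lambda>x. orbit_integral \<sigma> g x 1) n x = orbit_integral \<sigma> g x (real n)" for n x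
    proof (induction n arbitrary: x)
      case (Suc n)
      then show ?case using orbit_integral_cocycle[OF g, of x 1 "real n"] by simp
    qed simp
    have "AE x in m. convergent (\<lambda>n. birkhoff_sum (\<sigma> 1) (\<lambda>x. orbit_integral \<sigma> g x 1) n x / real n)"
    proof (rule birkhoff_ergodic)
      show "(\<lambda>x. orbit_integral \<sigma> g x 1) \<in> borel_measurable m"
        by (intro measurable_inv_measure[OF m] borel_measurable_continuous_onI continuous_on_orbit_integral g)
      show "\<bar>orbit_integral \<sigma> g x 1\<bar> \<le> B" for x using abs_orbit_integral_le[OF g B, of x 1] by simp
    qed
    then show ?thesis by (simp add: sum)
  qed
  then have "AE x in m. \<forall>g\<in>\<Theta>. convergent (\<lambda>n. orbit_integral \<sigma> g x (real n) / real n)"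
    using \<open>countable \<Theta>\<close> by (intro AE_ball_countable')
  then show ?thesis by (simp add: eq)
qed

text \<open>The measure representing the time average at \<open>x\<close> satisfies the description
  in \<open>generic_measure\<close>, and continuous functions leave no other candidate.\<close>

lemma generic_measure_properties:
  assumes x: "x \<in> quasi_regular"
  shows "generic_measure \<sigma> x \<in> inv_measures \<sigma>"
    and "\<And>f. continuous_on UNIV f \<Longrightarrow> (\<integral>y. f y \<partial>generic_measure \<sigma> x) = time_avg f x"
proof -
  interpret L: normalized_positive_functional "\<lambda>f. time_avg f x"
    using x by (rule normalized_positive_functional_time_avg)
  let ?M = "L.repr_measure"
  note prob = L.prob_space_repr_measure
  interpret prob_space ?M by (rule prob)
  have flow_m: "\<sigma> t \<in> ?M \<rightarrow>\<^sub>M borel" for t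
    by (rule continuous_on_borel_measurable[OF L.sets_repr_measure continuous_on_flow_map])
  have "distr ?M borel (\<sigma> t) = ?M" for t
  proof (rule measure_eqI_continuous)
    fix f :: "'a \<Rightarrow> real" assume f: "continuous_on UNIV f"
    have "(\<integral>y. f y \<partial>distr ?M borel (\<sigma> t)) = (\<integral>y. f (\<sigma> t y) \<partial>?M)"
      by (rule integral_distr[OF flow_m borel_measurable_continuous_onI[OF f]])
    also have "\<dots> = time_avg (\<lambda>y. f (\<sigma> t y)) x"
      by (intro L.integral_repr_measure continuous_intros f)
    also have "\<dots> = (\<integral>y. f y \<partial>?M)"
      by (simp add: time_avg_comp_flow[OF x f] L.integral_repr_measure f)
    finally show "(\<integral>y. f y \<partial>distr ?M borel (\<sigma> t)) = (\<integral>y. f y \<partial>?M)" .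
  qed (simp_all add: prob_space_distr flow_m prob)
  then have inv: "?M \<in> inv_measures \<sigma>" by (simp add: inv_measures_def prob)
  have "generic_measure \<sigma> x = ?M"
    unfolding generic_measure_def
  proof (rule the_equality, intro conjI allI impI)
    show "((\<lambda>t. 1 / t * orbit_integral \<sigma> f x t) \<longlongrightarrow> (\<integral>y. f y \<partial>?M)) at_top"
      if "continuous_on UNIV f" for f
      using time_avg_at_top[OF x that] L.integral_repr_measure[OF that] by simp
    fix m assume m: "m \<in> inv_measures \<sigma> \<and> (\<forall>f :: 'a \<Rightarrow> real. continuous_on UNIV f \<longrightarrow>
        ((\<lambda>t. 1 / t * orbit_integral \<sigma> f x t) \<longlongrightarrow> (\<integral>y. f y \<partial>m)) at_top)"
    show "m = ?M"
    proof (rule measure_eqI_continuous)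
      fix f :: "'a \<Rightarrow> real" assume f: "continuous_on UNIV f"
      have "(\<integral>y. f y \<partial>m) = time_avg f x"
        by (rule tendsto_unique[OF trivial_limit_at_top_linorder _ time_avg_at_top[OF x f]]) (use m f in blast)
      then show "(\<integral>y. f y \<partial>m) = (\<integral>y. f y \<partial>?M)" by (simp add: L.integral_repr_measure f)
    qed (use m in \<open>auto simp: inv_measures_def prob\<close>)
  qed (rule inv)
  then show "generic_measure \<sigma> x \<in> inv_measures \<sigma>"
    and "\<And>f. continuous_on UNIV f \<Longrightarrow> (\<integral>y. f y \<partial>generic_measure \<sigma> x) = time_avg f x"
    by (simp_all add: inv L.integral_repr_measure)
qed

lemma quasi_regular_generic_point: "x \<in> quasi_regular \<Longrightarrow> generic_point \<sigma> x"
  unfolding generic_point_def using time_avg_at_top by blast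

end

section \<open>The kernel of generic measures\<close>

context compact_flow
begin

text \<open>The fallback \<open>m\<close> makes every fibre an invariant probability measure, so
  that the kernel is measurable on the whole space.\<close>

definition ergodic_kernel :: "'a measure \<Rightarrow> 'a \<Rightarrow> 'a measure" where
  "ergodic_kernel m x = (if x \<in> quasi_regular then generic_measure \<sigma> x else m)"

lemma ergodic_kernel_inv: "m \<in> inv_measures \<sigma> \<Longrightarrow> ergodic_kernel m x \<in> inv_measures \<sigma>"
  by (simp add: ergodic_kernel_def generic_measure_properties)

lemma integral_ergodic_kernel:
  "continuous_on UNIV f \<Longrightarrow>
    (\<integral>y. f y \<partial>ergodic_kernel m x) = (if x \<in> quasi_regular then time_avg f x else (\<integral>y. f y \<partial>m))"
  by (simp add: ergodic_kernel_def generic_measure_properties)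

text \<open>Closed sets suffice, and their fibre measure is a limit of fibre integrals of bumps,
  which are time averages on the quasi-regular points.\<close>

lemma ergodic_kernel_measurable [measurable]:
  assumes m: "m \<in> inv_measures \<sigma>"
  shows "ergodic_kernel m \<in> m \<rightarrow>\<^sub>M prob_algebra borel"
proof -
  note inv = ergodic_kernel_inv[OF m]
  have "ergodic_kernel m \<in> borel \<rightarrow>\<^sub>M prob_algebra borel"
  proof (rule measurable_prob_algebra_generated[where \<Omega> = UNIV and G = "Collect closed"])
    show "sets borel = sigma_sets UNIV (Collect closed :: 'a set set)" by (simp add: borel_eq_closed)
    show "Int_stable (Collect closed :: 'a set set)" by (auto simp: Int_stable_def)
    show "prob_space (ergodic_kernel m x)" for x by (rule inv_measures_prob_space[OF inv])
    show "sets (ergodic_kernel m x) = sets borel" for x by (rule inv_measures_sets[OF inv])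
    fix C :: "'a set" assume "C \<in> Collect closed"
    then have "closed C" by simp
    show "(\<lambda>x. emeasure (ergodic_kernel m x) C) \<in> borel_measurable borel"
    proof (cases "C = {}")
      case False
      have lim: "(\<lambda>k. \<integral>y. closed_bump C k y \<partial>ergodic_kernel m x) \<longlonglongrightarrow> measure (ergodic_kernel m x) C" for x
        by (rule closed_bump_integral_LIMSEQ[OF inv_measures_prob_space[OF inv] inv_measures_sets[OF inv] \<open>closed C\<close> False])
      have "(\<lambda>x. measure (ergodic_kernel m x) C) \<in> borel_measurable borel"
      proof (rule borel_measurable_LIMSEQ_real[OF lim])
        show "(\<lambda>x. \<integral>y. closed_bump C k y \<partial>ergodic_kernel m x) \<in> borel_measurable borel" for k
          unfolding integral_ergodic_kernel[OF continuous_on_closed_bump]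
          using time_avg_measurable[OF continuous_on_closed_bump[of C k]] quasi_regular_measurable
          by (intro measurable_If) auto
      qed
      moreover have "emeasure (ergodic_kernel m x) C = ennreal (measure (ergodic_kernel m x) C)" for x
      proof -
        interpret prob_space "ergodic_kernel m x" by (rule inv_measures_prob_space[OF inv])
        show ?thesis by (rule emeasure_eq_measure)
      qed
      ultimately show ?thesis by simp
    qed simp
  qed simp
  then show ?thesis
    using measurable_cong_sets[OF inv_measures_sets[OF m] refl] by blast
qed

text \<open>Tested on continuous functions: the fibre integral is almost everywhere the time
  average, which has the same mean as the function.\<close>

lemma bind_ergodic_kernel:
  assumes m: "m \<in> inv_measures \<sigma>"
  shows "m \<bind> ergodic_kernel m = m"
proof -
  interpret prob_space m using m by (rule inv_measures_prob_space)
  note K = measurable_prob_algebraD[OF ergodic_kernel_measurable[OF m]]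
  note inv = ergodic_kernel_inv[OF m]
  have alg: "m \<in> space (prob_algebra m)"
    by (simp add: space_prob_algebra prob_space_axioms)
  note prob = prob_space_bind'[OF alg ergodic_kernel_measurable[OF m]]
    and sets = sets_bind'[OF alg ergodic_kernel_measurable[OF m]]
  from prob interpret B: prob_space "m \<bind> ergodic_kernel m" by simp
  show ?thesis
  proof (rule measure_eqI_continuous[OF prob prob_space_axioms sets inv_measures_sets[OF m]])
    fix f :: "'a \<Rightarrow> real" assume f: "continuous_on UNIV f"
    obtain B where "B > 0" and B: "\<And>x. \<bar>f x\<bar> \<le> B" using bounded_continuous[OF f] by metis
    \<comment> \<open>The shift makes the function nonnegative, so that the integral under
      \<open>bind\<close> can be computed with \<open>nn_integral\<close>.\<close>
    define g where "g x = f x + B" for x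
    have g_cont: "continuous_on UNIV g" unfolding g_def by (intro continuous_intros f)
    have g_nonneg: "0 \<le> g x" and g_le: "\<bar>g x\<bar> \<le> 2 * B" for x
      using B[of x] unfolding g_def by linarith+
    note g = g_cont g_nonneg g_le
    have g_kernel: "(\<integral>y. g y \<partial>ergodic_kernel m x) \<ge> 0" for x
      using g(2) by simp
    have g_meas: "(\<lambda>x. \<integral>y. g y \<partial>ergodic_kernel m x) \<in> borel_measurable m"
      by (rule measurable_compose[OF K integral_measurable_subprob_algebra])
        (rule borel_measurable_continuous_onI[OF g(1)])
    have g_bound: "norm (\<integral>y. g y \<partial>ergodic_kernel m x) \<le> 2 * B" for x
    proof -
      interpret k: prob_space "ergodic_kernel m x" by (rule inv_measures_prob_space[OF inv])
      have "(\<integral>y. g y \<partial>ergodic_kernel m x) \<le> (\<integral>y. 2 * B \<partial>ergodic_kernel m x)"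
        using g(3) by (intro integral_mono integrable_continuous[OF inv] g) (auto simp: abs_le_iff)
      then show ?thesis using g_kernel[of x] k.prob_space by simp
    qed
    have int: "integrable m (\<lambda>x. \<integral>y. g y \<partial>ergodic_kernel m x)"
      by (rule integrable_const_bound[OF _ g_meas, of "2 * B"]) (use g_bound in simp)
    have int_bind: "integrable (m \<bind> ergodic_kernel m) h" if h: "continuous_on UNIV h" for h :: "'a \<Rightarrow> real"
    proof -
      obtain b where "\<And>x. \<bar>h x\<bar> \<le> b" using bounded_continuous[OF h] by metis
      then show ?thesis
        by (intro B.integrable_const_bound[where B = b] continuous_on_borel_measurable[OF sets h]) auto
    qed
    have "ennreal (\<integral>y. g y \<partial>(m \<bind> ergodic_kernel m)) = (\<integral>\<^sup>+y. g y \<partial>(m \<bind> ergodic_kernel m))"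
      by (rule nn_integral_eq_integral[symmetric]) (auto intro!: int_bind g)
    also have "\<dots> = (\<integral>\<^sup>+x. \<integral>\<^sup>+y. g y \<partial>ergodic_kernel m x \<partial>m)"
      using borel_measurable_continuous_onI[OF g(1)] by (intro nn_integral_bind[OF _ K]) auto
    also have "\<dots> = (\<integral>\<^sup>+x. ennreal (\<integral>y. g y \<partial>ergodic_kernel m x) \<partial>m)"
      using g by (intro nn_integral_cong nn_integral_eq_integral integrable_continuous[OF inv]) auto
    also have "\<dots> = ennreal (\<integral>x. \<integral>y. g y \<partial>ergodic_kernel m x \<partial>m)"
      by (rule nn_integral_eq_integral[OF int]) (simp add: g_kernel)
    also have "(\<integral>x. \<integral>y. g y \<partial>ergodic_kernel m x \<partial>m) = (\<integral>x. time_avg g x \<partial>m)"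
      using AE_quasi_regular[OF m] g_meas time_avg_measurable[OF g(1)]
      by (intro integral_cong_AE) (auto intro: measurable_inv_measure[OF m] simp: integral_ergodic_kernel[OF g(1)])
    also have "\<dots> = (\<integral>x. g x \<partial>m)" by (rule integral_time_avg[OF m AE_quasi_regular[OF m] g(1)])
    finally have "(\<integral>y. g y \<partial>(m \<bind> ergodic_kernel m)) = (\<integral>x. g x \<partial>m)"
      using g(2) by (simp add: ennreal_inj)
    moreover have "(\<integral>y. g y \<partial>(m \<bind> ergodic_kernel m)) = (\<integral>y. f y \<partial>(m \<bind> ergodic_kernel m)) + B"
      unfolding g_def using int_bind[OF f] B.prob_space by simp
    moreover have "(\<integral>x. g x \<partial>m) = (\<integral>x. f x \<partial>m) + B"
      unfolding g_def using integrable_continuous[OF m f] prob_space by simp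
    ultimately show "(\<integral>y. f y \<partial>(m \<bind> ergodic_kernel m)) = (\<integral>x. f x \<partial>m)" by simp
  qed
qed

lemma AE_AE_ergodic_kernel:
  assumes m: "m \<in> inv_measures \<sigma>" and P: "Measurable.pred borel P" and ae: "AE x in m. P x"
  shows "AE x in m. AE y in ergodic_kernel m x. P y"
  using AE_bind[OF measurable_prob_algebraD[OF ergodic_kernel_measurable[OF m]] P,
      unfolded bind_ergodic_kernel[OF m]] ae by blast

text \<open>Jensen's inequality under the kernel is an equality almost everywhere because the kernel
  preserves \<open>m\<close>, so the variance of \<open>time_avg f\<close> under almost every fibre measure vanishes.\<close>

lemma AE_time_avg_constant:
  assumes m: "m \<in> inv_measures \<sigma>" and f: "continuous_on UNIV f"
  shows "AE x in m. AE y in ergodic_kernel m x. time_avg f y = time_avg f x"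
proof -
  interpret prob_space m using m by (rule inv_measures_prob_space)
  note K = measurable_prob_algebraD[OF ergodic_kernel_measurable[OF m]]
  note inv = ergodic_kernel_inv[OF m]
  note Q = AE_quasi_regular[OF m]
  obtain B where "B > 0" and B: "\<And>x. \<bar>f x\<bar> \<le> B" using bounded_continuous[OF f] by metis
  define a where "a = time_avg f"
  have a_meas [measurable]: "a \<in> borel_measurable borel" unfolding a_def by (rule time_avg_measurable[OF f])
  have a_bound: "\<bar>a x\<bar> \<le> B" if "x \<in> quasi_regular" for x
    unfolding a_def by (rule abs_time_avg_le[OF that f B])
  have a2_bound: "(a x)\<^sup>2 \<le> B\<^sup>2" if "x \<in> quasi_regular" for x
    using a_bound[OF that] \<open>B > 0\<close> by (simp add: abs_le_square_iff[symmetric])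
  define v where "v x = (\<integral>\<^sup>+y. ennreal ((a y)\<^sup>2) \<partial>ergodic_kernel m x)" for x
  have v_meas: "v \<in> borel_measurable m"
    unfolding v_def by (rule measurable_compose[OF K nn_integral_measurable_subprob_algebra]) simp
  have v_int: "(\<integral>\<^sup>+x. v x \<partial>m) = (\<integral>\<^sup>+x. ennreal ((a x)\<^sup>2) \<partial>m)"
    unfolding v_def by (subst nn_integral_bind[OF _ K, symmetric]) (simp_all add: bind_ergodic_kernel[OF m])
  have am: "(\<lambda>x. ennreal ((a x)\<^sup>2)) \<in> borel_measurable m"
    by (rule measurable_cong_sets[THEN equalityD1, THEN subsetD, OF inv_measures_sets[OF m, symmetric] refl]) simp
  have fin: "(\<integral>\<^sup>+x. ennreal ((a x)\<^sup>2) \<partial>m) \<noteq> \<infinity>"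
  proof -
    have "(\<integral>\<^sup>+x. ennreal ((a x)\<^sup>2) \<partial>m) \<le> (\<integral>\<^sup>+x. ennreal (B\<^sup>2) \<partial>m)"
      using Q by (intro nn_integral_mono_AE) (auto elim!: eventually_mono intro!: ennreal_leI a2_bound)
    also have "\<dots> < \<infinity>" by (simp add: emeasure_space_1)
    finally show ?thesis by simp
  qed
  have QK: "AE x in m. AE y in ergodic_kernel m x. y \<in> quasi_regular"
    using quasi_regular_measurable by (intro AE_AE_ergodic_kernel[OF m _ Q]) auto
  have variance: "AE x in m. integrable (ergodic_kernel m x) (\<lambda>y. (a y - a x)\<^sup>2) \<and>
      v x = ennreal ((a x)\<^sup>2 + (\<integral>y. (a y - a x)\<^sup>2 \<partial>ergodic_kernel m x))"
    using Q QK
  proof eventually_elim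
    case (elim x)
    let ?K = "ergodic_kernel m x"
    have Qx: "x \<in> quasi_regular" and QK: "AE y in ?K. y \<in> quasi_regular"
      using elim quasi_regular_measurable by auto
    interpret k: prob_space ?K by (rule inv_measures_prob_space[OF inv])
    have meas: "a \<in> borel_measurable ?K" by (rule measurable_inv_measure[OF inv a_meas])
    have int: "integrable ?K a"
      using QK a_bound by (intro k.integrable_const_bound[OF _ meas, of B]) (auto elim!: eventually_mono)
    have int2: "integrable ?K (\<lambda>y. (a y)\<^sup>2)"
      using QK a2_bound meas by (intro k.integrable_const_bound[of _ "B\<^sup>2"]) (auto elim!: eventually_mono)
    \<comment> \<open>With fibre mean \<open>a x\<close>, the fibre second moment is
      \<open>(a x)\<^sup>2\<close> plus the variance.\<close>
    have mean: "(\<integral>y. a y \<partial>?K) = a x"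
      unfolding a_def integral_time_avg[OF inv QK f] by (simp add: integral_ergodic_kernel[OF f] Qx)
    have expand: "(a y - a x)\<^sup>2 = (a y)\<^sup>2 - 2 * a x * a y + (a x)\<^sup>2" for y
      by (simp add: power2_diff algebra_simps)
    have intv: "integrable ?K (\<lambda>y. (a y - a x)\<^sup>2)"
      unfolding expand using int int2 by simp
    have "(\<integral>y. (a y - a x)\<^sup>2 \<partial>?K) = (\<integral>y. (a y)\<^sup>2 \<partial>?K) - 2 * a x * a x + (a x)\<^sup>2"
      unfolding expand using int int2 k.prob_space by (simp add: mean)
    then have "(\<integral>y. (a y)\<^sup>2 \<partial>?K) = (a x)\<^sup>2 + (\<integral>y. (a y - a x)\<^sup>2 \<partial>?K)"
      by (simp add: power2_eq_square)
    moreover have "v x = ennreal (\<integral>y. (a y)\<^sup>2 \<partial>?K)"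
      unfolding v_def by (rule nn_integral_eq_integral[OF int2]) simp
    ultimately show ?case using intv by simp
  qed
  then have "AE x in m. ennreal ((a x)\<^sup>2) \<le> v x"
    by eventually_elim (auto intro!: ennreal_leI)
  \<comment> \<open>\<open>v\<close> dominates \<open>(a x)\<^sup>2\<close> almost everywhere and
    has the same finite integral, so the two agree almost everywhere.\<close>
  then have "(\<integral>\<^sup>+x. v x - ennreal ((a x)\<^sup>2) \<partial>m) = 0"
    using nn_integral_diff[OF v_meas am fin] fin by (simp add: v_int)
  then have "AE x in m. v x - ennreal ((a x)\<^sup>2) = 0"
    using v_meas am by (subst (asm) nn_integral_0_iff_AE) auto
  then show ?thesis
    using variance
  proof eventually_elim
    case (elim x)
    let ?V = "\<integral>y. (a y - a x)\<^sup>2 \<partial>ergodic_kernel m x"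
    have "0 \<le> ?V" by simp
    have "ennreal ((a x)\<^sup>2 + ?V) \<le> ennreal ((a x)\<^sup>2)"
      using elim by (simp add: ennreal_minus_eq_0)
    then have "?V = 0" using \<open>0 \<le> ?V\<close> by (simp add: ennreal_le_iff)
    then have "AE y in ergodic_kernel m x. (a y - a x)\<^sup>2 = 0"
      using elim by (subst (asm) integral_nonneg_eq_0_iff_AE) auto
    then show ?case by (auto simp: a_def)
  qed
qed

text \<open>This lets "for each function, almost everywhere" become "almost everywhere, for all
  functions" once \<open>\<Theta>\<close> is countable.\<close>

lemma time_avg_eq_of_family:
  assumes "x \<in> quasi_regular" and "y \<in> quasi_regular"
    and cont: "\<And>g. g \<in> \<Theta> \<Longrightarrow> continuous_on UNIV g"
    and span: "\<And>f :: 'a \<Rightarrow> real. \<And>e. \<lbrakk>continuous_on UNIV f; e > 0\<rbrakk> \<Longrightarrow>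
      \<exists>I c g. finite (I :: 'a set) \<and> (\<forall>j\<in>I. g j \<in> \<Theta>) \<and> (\<forall>x. \<bar>f x - (\<Sum>j\<in>I. c j * g j x)\<bar> < e)"
    and eq: "\<And>g. g \<in> \<Theta> \<Longrightarrow> time_avg g y = time_avg g x"
    and f: "continuous_on UNIV f"
  shows "time_avg f y = time_avg f x"
proof -
  have "\<bar>time_avg f y - time_avg f x\<bar> \<le> 0 + e" if "e > 0" for e
  proof -
    obtain I c g where I: "finite (I :: 'a set)" "\<forall>j\<in>I. g j \<in> \<Theta>"
      and near: "\<And>x. \<bar>f x - (\<Sum>j\<in>I. c j * g j x)\<bar> < e / 2"
      using span[OF f, of "e / 2"] \<open>e > 0\<close> by auto
    define h where "h x = (\<Sum>j\<in>I. c j * g j x)" for x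
    have h_cont: "continuous_on UNIV h"
      unfolding h_def by (intro continuous_intros) (use I cont in auto)
    have close: "\<bar>time_avg f z - time_avg h z\<bar> \<le> e / 2"
      and lin: "time_avg h z = (\<Sum>j\<in>I. c j * time_avg (g j) z)" if z: "z \<in> quasi_regular" for z
    proof -
      interpret L: normalized_positive_functional "\<lambda>f. time_avg f z"
        using z by (rule normalized_positive_functional_time_avg)
      have "\<bar>time_avg (\<lambda>x. f x - h x) z\<bar> \<le> e / 2"
        using near by (intro abs_time_avg_le z continuous_intros f h_cont) (auto simp: h_def less_imp_le)
      then show "\<bar>time_avg f z - time_avg h z\<bar> \<le> e / 2" by (simp add: L.L_diff f h_cont)
      show "time_avg h z = (\<Sum>j\<in>I. c j * time_avg (g j) z)"
        unfolding h_def using I cont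
        by (subst L.L_sum) (auto intro!: continuous_intros simp: time_avg_cmult z)
    qed
    have "time_avg h y = time_avg h x" using I eq by (simp add: lin assms(1,2))
    then show ?thesis using close[OF assms(1)] close[OF assms(2)] by linarith
  qed
  from field_le_epsilon[OF this] show ?thesis by simp
qed

text \<open>Conditioning on an invariant \<open>B\<close> of positive measure gives an invariant
  measure \<open>n\<close> with the same constants \<open>c f\<close> as time averages. Both
  measures integrate every continuous \<open>f\<close> to \<open>c f\<close>, so
  \<open>n = m\<close>, and \<open>n\<close> gives \<open>B\<close> full measure.\<close>

lemma ergodicI_time_avg_constant:
  assumes m: "m \<in> inv_measures \<sigma>" and Q: "AE y in m. y \<in> quasi_regular"
    and const: "AE y in m. \<forall>f :: 'a \<Rightarrow> real. continuous_on UNIV f \<longrightarrow> time_avg f y = c f"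
  shows "m \<in> erg_measures \<sigma>"
proof -
  interpret prob_space m using m by (rule inv_measures_prob_space)
  note sm = inv_measures_sets[OF m]
  have "measure m B = 1" if B: "B \<in> sets borel" "\<And>t. \<sigma> t ` B = B" "measure m B \<noteq> 0" for B
  proof -
    have Bm: "B \<in> sets m" using B(1) sm by simp
    have pos: "emeasure m B \<noteq> 0" using B(3) by (simp add: emeasure_eq_measure)
    define n where "n = uniform_measure m B"
    have sn: "sets n = sets borel" by (simp add: n_def sm)
    have flow_m: "\<sigma> t \<in> m \<rightarrow>\<^sub>M borel" and flow_n: "\<sigma> t \<in> n \<rightarrow>\<^sub>M borel" for t
      using continuous_on_borel_measurable[OF _ continuous_on_flow_map] sm sn by auto
    have B_iff: "\<sigma> t x \<in> B \<longleftrightarrow> x \<in> B" for t x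
    proof
      assume "\<sigma> t x \<in> B"
      then have "\<sigma> (- t) (\<sigma> t x) \<in> B" using B(2)[of "- t"] by blast
      then show "x \<in> B" by simp
    qed (use B(2)[of t] in blast)
    have "distr n borel (\<sigma> t) = n" for t
    proof (rule measure_eqI)
      fix A assume "A \<in> sets (distr n borel (\<sigma> t))"
      then have A: "A \<in> sets borel" by simp
      have pre: "\<sigma> t -` A \<in> sets m"
        using measurable_sets[OF flow_m A, of t] by (simp add: inv_measures_space[OF m])
      have "emeasure (distr n borel (\<sigma> t)) A = emeasure n (\<sigma> t -` A)"
        using sets_eq_imp_space_eq[OF sn] by (simp add: emeasure_distr[OF flow_n A])
      also have "\<dots> = emeasure m (B \<inter> \<sigma> t -` A) / emeasure m B"
        unfolding n_def by (rule emeasure_uniform_measure[OF Bm pre])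
      also have "B \<inter> \<sigma> t -` A = \<sigma> t -` (B \<inter> A)" using B_iff by auto
      also have "emeasure m (\<sigma> t -` (B \<inter> A)) = emeasure (distr m borel (\<sigma> t)) (B \<inter> A)"
        using A B(1) by (subst emeasure_distr[OF flow_m]) (auto simp: inv_measures_space[OF m])
      also have "distr m borel (\<sigma> t) = m" using m by (simp add: inv_measures_def)
      also have "emeasure m (B \<inter> A) / emeasure m B = emeasure n A"
        unfolding n_def using A sm by (simp add: emeasure_uniform_measure[OF Bm])
      finally show "emeasure (distr n borel (\<sigma> t)) A = emeasure n A" .
    qed (simp add: sn)
    moreover have "prob_space n"
      unfolding n_def by (rule prob_space_uniform_measure[OF pos]) simp
    ultimately have n: "n \<in> inv_measures \<sigma>" by (simp add: inv_measures_def sn)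
    have Qn: "AE y in n. y \<in> quasi_regular"
      unfolding n_def using Q by (intro AE_uniform_measureI Bm) auto
    have const_n: "AE y in n. \<forall>f :: 'a \<Rightarrow> real. continuous_on UNIV f \<longrightarrow> time_avg f y = c f"
      unfolding n_def using const by (intro AE_uniform_measureI Bm) auto
    have integral_c: "(\<integral>y. f y \<partial>p) = c f"
      if p: "p \<in> inv_measures \<sigma>" "AE y in p. y \<in> quasi_regular"
        "AE y in p. \<forall>f :: 'a \<Rightarrow> real. continuous_on UNIV f \<longrightarrow> time_avg f y = c f"
        and f: "continuous_on UNIV f" for p and f :: "'a \<Rightarrow> real"
    proof -
      interpret p: prob_space p using p(1) by (rule inv_measures_prob_space)
      have "(\<integral>y. f y \<partial>p) = (\<integral>y. time_avg f y \<partial>p)"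
        by (rule integral_time_avg[OF p(1,2) f, symmetric])
      also have "\<dots> = (\<integral>y. c f \<partial>p)"
        using p(3) f time_avg_measurable[OF f]
        by (intro integral_cong_AE) (auto intro: measurable_inv_measure[OF p(1)])
      finally show ?thesis using p.prob_space by simp
    qed
    have "n = m"
      by (rule measure_eqI_continuous[OF inv_measures_prob_space[OF n] inv_measures_prob_space[OF m] sn sm])
        (simp add: integral_c[OF m Q const] integral_c[OF n Qn const_n])
    then have "emeasure m B = emeasure n B" by simp
    also have "\<dots> = 1" unfolding n_def by (rule emeasure_uniform_measure_1[OF pos]) simp
    finally show ?thesis by (simp add: measure_def)
  qed
  then show ?thesis using m unfolding erg_measures_def by blast
qed

text \<open>For each \<open>g\<close> in the countable \<open>\<Theta>\<close> the time average is
  constant under almost every fibre; collecting the exceptional sets leaves fibres to which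
  \<open>ergodicI_time_avg_constant\<close> applies.\<close>

lemma AE_generic_ergodic:
  assumes m: "m \<in> inv_measures \<sigma>"
  shows "AE x in m. x \<in> quasi_regular \<and> generic_measure \<sigma> x \<in> erg_measures \<sigma>"
proof (rule countable_spanning_family[OF compact_space])
  fix \<Theta> :: "('a \<Rightarrow> real) set"
  assume "countable \<Theta>" and cont: "\<And>g. g \<in> \<Theta> \<Longrightarrow> continuous_on UNIV g"
    and span: "\<And>f :: 'a \<Rightarrow> real. \<And>e. \<lbrakk>continuous_on UNIV f; e > 0\<rbrakk> \<Longrightarrow>
      \<exists>I c g. finite (I :: 'a set) \<and> (\<forall>j\<in>I. g j \<in> \<Theta>) \<and> (\<forall>x. \<bar>f x - (\<Sum>j\<in>I. c j * g j x)\<bar> < e)"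
  note Q = AE_quasi_regular[OF m]
  have "AE x in m. \<forall>g\<in>\<Theta>. AE y in ergodic_kernel m x. time_avg g y = time_avg g x"
    using \<open>countable \<Theta>\<close> by (intro AE_ball_countable' AE_time_avg_constant[OF m] cont)
  moreover have "AE x in m. AE y in ergodic_kernel m x. y \<in> quasi_regular"
    using Q quasi_regular_measurable by (intro AE_AE_ergodic_kernel[OF m]) auto
  ultimately show ?thesis
    using Q
  proof eventually_elim
    case (elim x)
    have "AE y in ergodic_kernel m x. \<forall>g\<in>\<Theta>. time_avg g y = time_avg g x"
      using elim(1) \<open>countable \<Theta>\<close> by (simp add: AE_ball_countable)
    then have "AE y in ergodic_kernel m x. \<forall>f :: 'a \<Rightarrow> real. continuous_on UNIV f \<longrightarrow> time_avg f y = time_avg f x"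
      using elim(2)
    proof eventually_elim
      case (elim y)
      then show ?case
        using time_avg_eq_of_family[OF \<open>x \<in> quasi_regular\<close> _ cont span] by blast
    qed
    then have "ergodic_kernel m x \<in> erg_measures \<sigma>"
      by (rule ergodicI_time_avg_constant[OF ergodic_kernel_inv[OF m] elim(2)])
    then show ?case using elim(3) by (simp add: ergodic_kernel_def)
  qed
qed

text \<open>The hypothesis controls backward averages only; invariance of \<open>m\<close> transfers it to the
  forward averages in mean, which makes \<open>time_avg a\<close> nonnegative, hence zero.\<close>

lemma AE_time_avg_zero:
  assumes m: "m \<in> inv_measures \<sigma>" and a: "continuous_on UNIV a" and zero: "(\<integral>x. a x \<partial>m) = 0"
    and bdd: "AE x in m. bdd_above (orbit_integral \<sigma> a x ` {..0})"
  shows "AE x in m. time_avg a x = 0"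
proof -
  interpret prob_space m using m by (rule inv_measures_prob_space)
  note Q = AE_quasi_regular[OF m]
  obtain B where "B > 0" and B: "\<And>x. \<bar>a x\<bar> \<le> B" using bounded_continuous[OF a] by metis
  \<comment> \<open>The positive part of the backward average. Composed with
    \<open>\<sigma> n\<close> it is the negative part of the forward average, so the two have equal
    means.\<close>
  define b where "b n x = max 0 (orbit_integral \<sigma> a x (- real n) / real n)" for n x
  have b_cont: "continuous_on UNIV (b n)" for n
    unfolding b_def divide_inverse by (intro continuous_intros continuous_on_orbit_integral a)
  have b_bound: "\<bar>b n x\<bar> \<le> B" for n x
  proof (cases "n = 0")
    case False
    then have "\<bar>orbit_integral \<sigma> a x (- real n) / real n\<bar> \<le> B"
      using abs_orbit_integral_le[OF a B, of x "- real n"] by (simp add: field_simps)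
    then show ?thesis unfolding b_def by linarith
  qed (use \<open>B > 0\<close> in \<open>simp add: b_def\<close>)
  have b_lim: "(\<lambda>n. b n x) \<longlonglongrightarrow> 0" if "bdd_above (orbit_integral \<sigma> a x ` {..0})" for x
  proof -
    obtain C where C: "\<And>t. t \<le> 0 \<Longrightarrow> orbit_integral \<sigma> a x t \<le> C"
      using \<open>bdd_above _\<close> unfolding bdd_above_def by auto
    show ?thesis
    proof (rule Lim_null_comparison)
      show "\<forall>\<^sub>F n in sequentially. norm (b n x) \<le> \<bar>C\<bar> / real n"
      proof (rule always_eventually, rule allI)
        fix n
        have "orbit_integral \<sigma> a x (- real n) \<le> \<bar>C\<bar>" using C[of "- real n"] by simp
        then have "orbit_integral \<sigma> a x (- real n) / real n \<le> \<bar>C\<bar> / real n"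
          by (rule divide_right_mono) simp
        then show "norm (b n x) \<le> \<bar>C\<bar> / real n" by (simp add: b_def)
      qed
    qed (rule lim_const_over_n)
  qed
  have "(\<lambda>n. \<integral>x. b n x \<partial>m) \<longlonglongrightarrow> (\<integral>x. 0 \<partial>m)"
  proof (rule integral_dominated_convergence[where w = "\<lambda>_. B"])
    show "AE x in m. (\<lambda>n. b n x) \<longlonglongrightarrow> 0" using bdd by eventually_elim (rule b_lim)
  qed (use b_bound in \<open>auto intro!: continuous_on_borel_measurable[OF inv_measures_sets[OF m] b_cont]\<close>)
  moreover have "(\<integral>x. b n x \<partial>m) = (\<integral>x. max 0 (- (orbit_integral \<sigma> a x (real n) / real n)) \<partial>m)" for n
  proof -
    have "orbit_integral \<sigma> a (\<sigma> (real n) x) (- real n) = - orbit_integral \<sigma> a x (real n)" for x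
      using orbit_integral_cocycle[OF a, of x "real n" "- real n"] by simp
    then have "b n (\<sigma> (real n) x) = max 0 (- (orbit_integral \<sigma> a x (real n) / real n))" for x
      by (simp add: b_def)
    then show ?thesis
      using integral_comp_flow[OF m borel_measurable_continuous_onI[OF b_cont], of n "real n"] by simp
  qed
  moreover have "(\<lambda>n. \<integral>x. max 0 (- (orbit_integral \<sigma> a x (real n) / real n)) \<partial>m)
      \<longlonglongrightarrow> (\<integral>x. max 0 (- time_avg a x) \<partial>m)"
  proof (rule integral_dominated_convergence[where w = "\<lambda>_. B"])
    show "AE x in m. (\<lambda>n. max 0 (- (orbit_integral \<sigma> a x (real n) / real n))) \<longlonglongrightarrow> max 0 (- time_avg a x)"
      using Q by eventually_elim (intro tendsto_intros time_avg_LIMSEQ a)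
    show "AE x in m. norm (max 0 (- (orbit_integral \<sigma> a x (real n) / real n))) \<le> B" for n
    proof (rule AE_I2)
      show "norm (max 0 (- (orbit_integral \<sigma> a x (real n) / real n))) \<le> B" for x
        using abs_average_le[OF a B, of x n] \<open>B > 0\<close> unfolding real_norm_def by linarith
    qed
    show "(\<lambda>x. max 0 (- time_avg a x)) \<in> borel_measurable m"
      using measurable_inv_measure[OF m time_avg_measurable[OF a]] by simp
    show "(\<lambda>x. max 0 (- (orbit_integral \<sigma> a x (real n) / real n))) \<in> borel_measurable m" for n
      using measurable_inv_measure[OF m orbit_average_measurable[OF a]] by simp
  qed simp
  ultimately have neg: "(\<integral>x. max 0 (- time_avg a x) \<partial>m) = 0"
    using LIMSEQ_unique by fastforce
  have int: "integrable m (time_avg a)"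
    using Q by (intro integrable_const_bound[OF _ measurable_inv_measure[OF m time_avg_measurable[OF a]], of B])
      (auto elim!: eventually_mono simp: abs_time_avg_le[OF _ a B])
  have "AE x in m. max 0 (- time_avg a x) = 0"
    using neg int by (subst (asm) integral_nonneg_eq_0_iff_AE) auto
  then have "AE x in m. 0 \<le> time_avg a x" by eventually_elim (simp add: max_def split: if_splits)
  moreover have "(\<integral>x. time_avg a x \<partial>m) = 0"
    using integral_time_avg[OF m Q a] zero by simp
  ultimately show ?thesis
    using integral_nonneg_eq_0_iff_AE[OF int] by simp
qed

text \<open>The intersection over \<open>t\<close> is uncountable, but its members are closed, so it
  is closed; the union over the bounds \<open>k\<close> is countable.\<close>

lemma bdd_above_orbit_integral_measurable:
  assumes a: "continuous_on UNIV a"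
  shows "Measurable.pred borel (\<lambda>x. bdd_above (orbit_integral \<sigma> a x ` {..0}))"
proof -
  have "bdd_above (orbit_integral \<sigma> a x ` {..0}) \<longleftrightarrow> (\<exists>k::nat. \<forall>t\<in>{..0}. orbit_integral \<sigma> a x t \<le> real k)" for x
  proof
    assume "bdd_above (orbit_integral \<sigma> a x ` {..0})"
    then obtain C where "\<forall>t\<in>{..0}. orbit_integral \<sigma> a x t \<le> C" by (auto simp: bdd_above_def)
    moreover obtain k where "C \<le> real k" using real_arch_simple by blast
    ultimately show "\<exists>k::nat. \<forall>t\<in>{..0}. orbit_integral \<sigma> a x t \<le> real k" by (meson order_trans)
  qed (auto simp: bdd_above_def)
  then have "{x. bdd_above (orbit_integral \<sigma> a x ` {..0})}
      = (\<Union>k::nat. \<Inter>t\<in>{..0}. {x. orbit_integral \<sigma> a x t \<le> real k})" by auto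
  also have "\<dots> \<in> sets borel"
  proof -
    have "closed (\<Inter>t\<in>{..0}. {x. orbit_integral \<sigma> a x t \<le> real k})" for k
      by (intro closed_INT ballI closed_Collect_le continuous_on_orbit_integral a continuous_on_const)
    then show ?thesis by (intro sets.countable_UN) (auto intro: borel_closed)
  qed
  finally show ?thesis by (simp add: pred_def)
qed

text \<open>Absence of a primitive does not involve the measure, the mean of \<open>a\<close> under
  the generic measure is its time average at \<open>x\<close>, and the backward bound passes to
  almost every fibre.\<close>

lemma AE_R_set_generic_measure:
  assumes m: "m \<in> inv_measures \<sigma>" and a: "a \<in> R_set \<sigma> m"
  shows "AE x in m. x \<in> generic_ergodic_points \<sigma> \<and> a \<in> R_set \<sigma> (generic_measure \<sigma> x)"
proof -
  have cont: "continuous_on UNIV a" and zero: "(\<integral>x. a x \<partial>m) = 0"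
    and no_primitive: "\<not> has_continuous_primitive \<sigma> a"
    and bdd: "AE x in m. bdd_above (orbit_integral \<sigma> a x ` {..0})"
    using a by (auto simp: R_set_def)
  have "AE x in m. AE y in ergodic_kernel m x. bdd_above (orbit_integral \<sigma> a y ` {..0})"
    by (rule AE_AE_ergodic_kernel[OF m bdd_above_orbit_integral_measurable[OF cont] bdd])
  with AE_generic_ergodic[OF m] AE_time_avg_zero[OF m cont zero bdd] show ?thesis
  proof eventually_elim
    case (elim x)
    then have "AE y in generic_measure \<sigma> x. bdd_above (orbit_integral \<sigma> a y ` {..0})"
      unfolding ergodic_kernel_def by presburger
    then show ?case
      using elim cont no_primitive
      by (simp add: generic_ergodic_points_def quasi_regular_generic_point R_set_def
          generic_measure_properties)
  qed
qed

end

theorem theorem2p14: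
  fixes \<sigma> :: "real \<Rightarrow> 'a::metric_space \<Rightarrow> 'a"
  assumes "compact (UNIV :: 'a set)"
    and "continuous_flow \<sigma>"
    and "minimal_flow \<sigma>"
    and "\<not> periodic_flow \<sigma>"
  shows
    "(\<forall>m \<in> inv_measures \<sigma>.
        R_set \<sigma> m \<noteq> {} \<and> (\<exists>a \<in> R_set \<sigma> m. sacker_sell_spectrum \<sigma> a = {0})) \<and>
     (\<exists>a \<in> (\<Inter>m \<in> inv_measures \<sigma>. R_set \<sigma> m). sacker_sell_spectrum \<sigma> a = {0}) \<and>
     (\<forall>m \<in> inv_measures \<sigma>. \<forall>a \<in> R_set \<sigma> m.
        (\<exists>m' \<in> erg_measures \<sigma>. a \<in> R_set \<sigma> m') \<and>
        (AE \<omega>\<^sub>0 in m. \<omega>\<^sub>0 \<in> generic_ergodic_points \<sigma> \<and> a \<in> R_set \<sigma> (generic_measure \<sigma> \<omega>\<^sub>0)))"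
proof -
  interpret minimal_nonperiodic_flow \<sigma>
    by unfold_locales (fact assms)+
  obtain a where a: "sacker_sell_spectrum \<sigma> a = {0}" "\<And>m. m \<in> inv_measures \<sigma> \<Longrightarrow> a \<in> R_set \<sigma> m"
    using exists_common_R_set by blast
  have "\<exists>m' \<in> erg_measures \<sigma>. b \<in> R_set \<sigma> m'" if m: "m \<in> inv_measures \<sigma>" and b: "b \<in> R_set \<sigma> m" for m b
  proof -
    interpret prob_space m using m by (rule inv_measures_prob_space)
    \<comment> \<open>The assertion does not depend on \<open>x\<close>, so holding almost
      everywhere for a probability measure makes it true.\<close>
    have "AE x in m. \<exists>m' \<in> erg_measures \<sigma>. b \<in> R_set \<sigma> m'"
      using AE_R_set_generic_measure[OF m b]
      by eventually_elim (auto simp: generic_ergodic_points_def)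
    then show ?thesis by simp
  qed
  with a AE_R_set_generic_measure show ?thesis by blast
qed

end
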